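(* Let $K\subset\mathbb{R}^2$ be a convex body not reduced to a point. If $\gamma$ is a self-distancing curve from $K$ with starting point $x_0\in\partial K$, then $$\gamma\subset\mathrm{cl}\big(\mathbb{R}^2\setminus(\mathfrak{J}(K,x_0)\cup K)\big).$$
   Context: CURVES. A self-distancing set is a bounded set $\sigma\subset\mathbb{R}^2$ linearly ordered by $\preceq$ such that $x_1\preceq x_2\preceq x_3$ in $\sigma$ implies $|x_2-x_1|\le|x_3-x_1|$. A steepest descent curve (SDC) is a closed connected self-distancing set not reduced to a point (such a set is known to be a rectifiable curve oriented by $\preceq$). For a convex body $K$, a self-distancing curve from $K$ ($SDC_K$) is an SDC $\gamma\subset\mathbb{R}^2\setminus\mathrm{relint}K$ which meets the relative boundary of $K$ and satisfies $|x-y|\le|x_1-y|$ for all $y\in K$ and all $x\preceq x_1$ in $\gamma$ (relint and relative boundary are taken in the affine hull of $K$). Its starting point is its first point for $\preceq$. INVOLUTES. Let $K\subset\mathbb{R}^2$ be a convex body (nonempty compact convex set) not reduced to a point, $L=|\partial K|$ (if $K$ is a segment, $\partial K$ is regarded as the closed curve traversing it back and forth, $L$ being twice its length). $n_\vartheta=(\cos\vartheta,\sin\vartheta)$, $t_\vartheta=(-\sin\vartheta,\cos\vartheta)$, $h(\vartheta)=\max_{y\in K}\langle n_\vartheta,y\rangle$, $F(\vartheta)=\{x\in K:\langle n_\vartheta,x\rangle=h(\vartheta)\}$. $x_l,x_r:\mathbb{R}\to\partial K$ are the $L$-periodic arc-length parametrizations, counterclockwise and clockwise respectively. Fix $x_0=x_l(s_0)=x_r(s_0)\in\partial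 K$ and $\vartheta_0$ with $x_0\in F(\vartheta_0)$. $s_{l+}:\mathbb{R}\to\mathbb{R}$ is the nondecreasing right-continuous function with $s_{l+}(\vartheta+2\pi)=s_{l+}(\vartheta)+L$, such that $x_l$ maps $[s_{l+}(\vartheta-),s_{l+}(\vartheta)]$ one-to-one onto $F(\vartheta)$ for every $\vartheta$, and $s_0\in[s_{l+}(\vartheta_0-),s_{l+}(\vartheta_0)]$. $s_{r-}$ is the nonincreasing left-continuous function with $s_{r-}(\vartheta+2\pi)=s_{r-}(\vartheta)-L$, such that $x_r$ maps $[s_{r-}(\vartheta+),s_{r-}(\vartheta)]$ one-to-one onto $F(\vartheta)$, and $s_0\in[s_{r-}(\vartheta_0+),s_{r-}(\vartheta_0)]$. Put $\vartheta_0^+=\inf\{\vartheta:s_{l+}(\vartheta)>s_0\}$, $\vartheta_0^-=\sup\{\vartheta:s_{r-}(\vartheta)>s_0\}$. The left and right involutes of $\partial K$ starting at $x_0$ are $$i_{l,x_0}(\vartheta)=x_l(s_{l+}(\vartheta))-(s_{l+}(\vartheta)-s_0)t_\vartheta\ (\vartheta\ge\vartheta_0^+),\qquad i_{r,x_0}(\vartheta)=x_r(s_{r-}(\vartheta))+(s_{r-}(\vartheta)-s_0)t_\vartheta\ (\vartheta\le\vartheta_0^-).$$ $\mathfrak{J}$-FENCE. For $x_0\in\partial K$ (an endpoint if $K$ is a segment) the arcs $i_{l,x_0}([\vartheta_0^+,\vartheta_0^++2\pi])$ and $i_{r,x_0}([\vartheta_0^--2\pi,\vartheta_0^-])$ have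 exactly one common point $\overline y\ne x_0$, $\overline y=i_{l,x_0}(\tilde\vartheta_l)=i_{r,x_0}(\tilde\vartheta_r)$. Put $\mathfrak{J}_l(K,x_0)=\{tx_0+(1-t)i_{l,x_0}(\vartheta):0\le t\le1,\ \vartheta_0^+\le\vartheta\le\tilde\vartheta_l\}$, $\mathfrak{J}_r(K,x_0)=\{tx_0+(1-t)i_{r,x_0}(\vartheta):0\le t\le1,\ \tilde\vartheta_r\le\vartheta\le\vartheta_0^-\}$ and $\mathfrak{J}(K,x_0)=(\mathfrak{J}_l(K,x_0)\cup\mathfrak{J}_r(K,x_0))\setminus\mathrm{Int}(K)$.
   Formalization: The far ends of the two involute arcs (parameters θ₀⁺+2π and θ₀⁻−2π) are excluded when choosing the common point ȳ: if K is a segment they coincide and give a second common point, so ȳ would not be unique; for K with interior points nothing changes. *)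

theory Defs
  imports "HOL-Complex_Analysis.Complex_Analysis"
begin

text \<open>The Euclidean plane is the type \<^typ>\<open>complex\<close>, with its library distance and inner product.
  An order on a point set is a relation, with \<open>(x, y) \<in> r\<close> for \<open>x \<preceq> y\<close>.\<close>

section \<open>Self-distancing curves\<close>

definition self_distancing :: "complex set \<Rightarrow> complex rel \<Rightarrow> bool" where
  "self_distancing \<sigma> r \<longleftrightarrow>
     bounded \<sigma> \<and> linear_order_on \<sigma> r \<and>
     (\<forall>x1 x2 x3. (x1, x2) \<in> r \<longrightarrow> (x2, x3) \<in> r \<longrightarrow> dist x2 x1 \<le> dist x3 x1)"

definition SDC :: "complex set \<Rightarrow> complex rel \<Rightarrow> bool" where
  "SDC \<gamma> r \<longleftrightarrow>
     closed \<gamma> \<and> connected \<gamma> \<and> self_distancing \<gamma> r \<and> \<gamma> \<noteq> {} \<and> (\<nexists>p. \<gamma> = {p})"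

definition SDC_from :: "complex set \<Rightarrow> complex set \<Rightarrow> complex rel \<Rightarrow> bool" where
  "SDC_from K \<gamma> r \<longleftrightarrow>
     SDC \<gamma> r \<and> \<gamma> \<subseteq> - rel_interior K \<and> \<gamma> \<inter> rel_frontier K \<noteq> {} \<and>
     (\<forall>x x1. (x, x1) \<in> r \<longrightarrow> (\<forall>y\<in>K. dist x y \<le> dist x1 y))"

definition starting_point :: "complex set \<Rightarrow> complex rel \<Rightarrow> complex \<Rightarrow> bool" where
  "starting_point \<gamma> r x0 \<longleftrightarrow> x0 \<in> \<gamma> \<and> (\<forall>x\<in>\<gamma>. (x0, x) \<in> r)"

section \<open>Convex bodies and their boundary parametrizations\<close>

definition convex_body :: "complex set \<Rightarrow> bool" where
  "convex_body K \<longleftrightarrow> convex K \<and> compact K \<and> K \<noteq> {}"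

definition nvec :: "real \<Rightarrow> complex" where
  "nvec \<theta> = Complex (cos \<theta>) (sin \<theta>)"

definition tvec :: "real \<Rightarrow> complex" where
  "tvec \<theta> = Complex (- sin \<theta>) (cos \<theta>)"

definition support_fun :: "complex set \<Rightarrow> real \<Rightarrow> real" where
  "support_fun K \<theta> = (SUP y\<in>K. nvec \<theta> \<bullet> y)"

definition face :: "complex set \<Rightarrow> real \<Rightarrow> complex set" where
  "face K \<theta> = {x \<in> K. nvec \<theta> \<bullet> x = support_fun K \<theta>}"

text \<open>Length of the curve \<open>g\<close> on \<open>[a, b]\<close>: supremum over the inscribed polygons.\<close>

definition curve_length :: "(real \<Rightarrow> complex) \<Rightarrow> real \<Rightarrow> real \<Rightarrow> ennreal" where
  "curve_length g a b =
     (SUP ts \<in> {ts. sorted ts \<and> set ts \<subseteq> {a..b}}.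
        \<Sum>i<length ts - 1. ennreal (dist (g (ts ! i)) (g (ts ! Suc i))))"

text \<open>Arc-length parametrization of \<open>\<partial>K\<close> with period \<open>L\<close>.  One period is a simple closed curve if
  \<open>K\<close> has interior points; otherwise \<open>K\<close> is a segment, and it is traversed from one endpoint \<open>x a\<close>
  to the other and then back.  In both cases \<open>L\<close> is the length of one period, that is \<open>|\<partial>K|\<close>.\<close>

definition boundary_arclength_param ::
    "complex set \<Rightarrow> real \<Rightarrow> (real \<Rightarrow> complex) \<Rightarrow> bool" where
  "boundary_arclength_param K L x \<longleftrightarrow>
     0 < L \<and> (\<forall>s. x (s + L) = x s) \<and> range x = frontier K \<and>
     (\<forall>a b. a \<le> b \<longrightarrow> curve_length x a b = ennreal (b - a)) \<and>
     (if interior K \<noteq> {} then inj_on x {0..<L}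
      else \<exists>a. bij_betw x {a..a + L / 2} K \<and> (\<forall>s. x (a + s) = x (a - s)))"

text \<open>Orientation of one period, by its winding number around the interior points of \<open>K\<close>;
  no condition if \<open>K\<close> is a segment.\<close>

definition counterclockwise :: "complex set \<Rightarrow> real \<Rightarrow> (real \<Rightarrow> complex) \<Rightarrow> bool" where
  "counterclockwise K L x \<longleftrightarrow> (\<forall>p\<in>interior K. winding_number (\<lambda>u. x (L * u)) p = 1)"

definition clockwise :: "complex set \<Rightarrow> real \<Rightarrow> (real \<Rightarrow> complex) \<Rightarrow> bool" where
  "clockwise K L x \<longleftrightarrow> (\<forall>p\<in>interior K. winding_number (\<lambda>u. x (L * u)) p = - 1)"

section \<open>Involutes\<close>

text \<open>The functions \<open>s\<^sub>l\<^sub>+\<close> and \<open>s\<^sub>r\<^sub>-\<close>.\<close>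

definition left_arc_fun ::
    "complex set \<Rightarrow> real \<Rightarrow> (real \<Rightarrow> complex) \<Rightarrow> real \<Rightarrow> real \<Rightarrow> (real \<Rightarrow> real) \<Rightarrow> bool" where
  "left_arc_fun K L xl s0 \<theta>0 sl \<longleftrightarrow>
     mono sl \<and> (\<forall>\<theta>. continuous (at_right \<theta>) sl) \<and>
     (\<forall>\<theta>. sl (\<theta> + 2 * pi) = sl \<theta> + L) \<and>
     (\<forall>\<theta>. bij_betw xl {Lim (at_left \<theta>) sl..sl \<theta>} (face K \<theta>)) \<and>
     s0 \<in> {Lim (at_left \<theta>0) sl..sl \<theta>0}"

definition right_arc_fun ::
    "complex set \<Rightarrow> real \<Rightarrow> (real \<Rightarrow> complex) \<Rightarrow> real \<Rightarrow> real \<Rightarrow> (real \<Rightarrow> real) \<Rightarrow> bool" where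
  "right_arc_fun K L xr s0 \<theta>0 sr \<longleftrightarrow>
     antimono sr \<and> (\<forall>\<theta>. continuous (at_left \<theta>) sr) \<and>
     (\<forall>\<theta>. sr (\<theta> + 2 * pi) = sr \<theta> - L) \<and>
     (\<forall>\<theta>. bij_betw xr {Lim (at_right \<theta>) sr..sr \<theta>} (face K \<theta>)) \<and>
     s0 \<in> {Lim (at_right \<theta>0) sr..sr \<theta>0}"

definition theta_plus :: "(real \<Rightarrow> real) \<Rightarrow> real \<Rightarrow> real" where
  "theta_plus sl s0 = Inf {\<theta>. sl \<theta> > s0}"

definition theta_minus :: "(real \<Rightarrow> real) \<Rightarrow> real \<Rightarrow> real" where
  "theta_minus sr s0 = Sup {\<theta>. sr \<theta> > s0}"

definition left_involute ::
    "(real \<Rightarrow> complex) \<Rightarrow> (real \<Rightarrow> real) \<Rightarrow> real \<Rightarrow> real \<Rightarrow> complex" where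
  "left_involute xl sl s0 \<theta> = xl (sl \<theta>) - (sl \<theta> - s0) *\<^sub>R tvec \<theta>"

definition right_involute ::
    "(real \<Rightarrow> complex) \<Rightarrow> (real \<Rightarrow> real) \<Rightarrow> real \<Rightarrow> real \<Rightarrow> complex" where
  "right_involute xr sr s0 \<theta> = xr (sr \<theta>) + (sr \<theta> - s0) *\<^sub>R tvec \<theta>"

definition involute_data ::
    "complex set \<Rightarrow> complex \<Rightarrow> real \<Rightarrow> (real \<Rightarrow> complex) \<Rightarrow> (real \<Rightarrow> complex) \<Rightarrow>
     real \<Rightarrow> real \<Rightarrow> (real \<Rightarrow> real) \<Rightarrow> (real \<Rightarrow> real) \<Rightarrow> bool" where
  "involute_data K x0 L xl xr s0 \<theta>0 sl sr \<longleftrightarrow>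
     boundary_arclength_param K L xl \<and> counterclockwise K L xl \<and>
     boundary_arclength_param K L xr \<and> clockwise K L xr \<and>
     xl s0 = x0 \<and> xr s0 = x0 \<and> x0 \<in> face K \<theta>0 \<and>
     left_arc_fun K L xl s0 \<theta>0 sl \<and> right_arc_fun K L xr s0 \<theta>0 sr"

section \<open>The fence\<close>

text \<open>The parameters of the common point of the two involute arcs other than \<open>x0\<close>.  The far ends of
  the arcs are left out: if \<open>K\<close> has interior points they are never common points, but if \<open>K\<close> is a
  segment and \<open>x0\<close> an endpoint, the two far ends coincide (at distance \<open>L\<close> from \<open>x0\<close>) and would be
  a second, unintended common point.\<close>

definition fence_params ::
    "complex \<Rightarrow> (real \<Rightarrow> complex) \<Rightarrow> (real \<Rightarrow> complex) \<Rightarrow> real \<Rightarrow> real \<Rightarrow> real \<Rightarrow> real \<Rightarrow> bool" where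
  "fence_params x0 il ir \<theta>p \<theta>m \<theta>l \<theta>r \<longleftrightarrow>
     \<theta>l \<in> {\<theta>p..<\<theta>p + 2 * pi} \<and> \<theta>r \<in> {\<theta>m - 2 * pi<..\<theta>m} \<and>
     il \<theta>l = ir \<theta>r \<and> il \<theta>l \<noteq> x0"

definition cone_over_arc :: "complex \<Rightarrow> (real \<Rightarrow> complex) \<Rightarrow> real \<Rightarrow> real \<Rightarrow> complex set" where
  "cone_over_arc x0 i \<alpha> \<beta> =
     {t *\<^sub>R x0 + (1 - t) *\<^sub>R i \<theta> | t \<theta>. 0 \<le> t \<and> t \<le> 1 \<and> \<alpha> \<le> \<theta> \<and> \<theta> \<le> \<beta>}"

text \<open>\<open>is_fence K x0 J\<close>: \<open>J\<close> is the fence \<open>\<JJ>(K, x0)\<close>, constructed from any admissible choice of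
  parametrizations, of \<open>s0\<close> and of \<open>\<theta>0\<close>.\<close>

definition is_fence :: "complex set \<Rightarrow> complex \<Rightarrow> complex set \<Rightarrow> bool" where
  "is_fence K x0 J \<longleftrightarrow>
     (\<exists>L xl xr s0 \<theta>0 sl sr \<theta>l \<theta>r.
        involute_data K x0 L xl xr s0 \<theta>0 sl sr \<and>
        fence_params x0 (left_involute xl sl s0) (right_involute xr sr s0)
          (theta_plus sl s0) (theta_minus sr s0) \<theta>l \<theta>r \<and>
        J = (cone_over_arc x0 (left_involute xl sl s0) (theta_plus sl s0) \<theta>l \<union>
             cone_over_arc x0 (right_involute xr sr s0) \<theta>r (theta_minus sr s0)) - interior K)"

end

theory Submission imports Defs begin

text \<open>Write \<open>n\<close>, \<open>t\<close> for the rotating frame \<open>nvec \<theta>\<close>, \<open>tvec \<theta>\<close> and \<open>h\<close> for the support function of \<open>K\<close>.  A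
  direction \<open>\<theta>\<close> is visible from a point \<open>p\<close> when its excess \<open>n \<bullet> p - h \<theta>\<close> is positive, that is, when
  the support line with outer normal \<open>n\<close> separates \<open>p\<close> from \<open>K\<close>.

  The left involute \<open>i\<close> has two defining properties: \<open>i \<theta>\<close> lies on the support line with normal \<open>n\<close>,
  and its coordinate \<open>t \<bullet> i \<theta>\<close> along that line is a primitive of \<open>- h\<close>.  The right involute, which is
  the left involute of the mirror image, has the same two properties, and both curves pass through
  \<open>x0\<close> at the parameter \<open>\<theta>0\<close>.  Hence they are one and the same function of \<open>\<theta>\<close> in \<open>\<real>\<close>: it is the left
  involute for large \<open>\<theta>\<close>, the right one for small \<open>\<theta>\<close>, and rests at \<open>x0\<close> in between, while \<open>n\<close> is in
  the normal cone of \<open>x0\<close>.  Everything is controlled by the single function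
  \<open>\<Phi> \<theta> p = t \<bullet> (i \<theta> - p)\<close>.  It is affine in \<open>p\<close>, its derivative in \<open>\<theta>\<close> is the excess, and
  it drops by the perimeter \<open>L\<close> in each turn.  Call \<open>p\<close> reachable if \<open>\<Phi> \<theta> p = 0\<close> for some \<open>\<theta>\<close> of
  nonnegative excess; this says that \<open>p = i \<theta> + c n\<close> with \<open>c \<ge> 0\<close>.

  Every point of the curve \<open>\<gamma>\<close> is reachable.  Seen from \<open>p\<close>, the visible directions form an arc on
  which \<open>\<Phi>\<close> increases; at its two ends, where the lines of sight touch \<open>K\<close>, the values are, up to sign
  and a constant, the lengths of the strings from \<open>p\<close> wrapped around \<open>K\<close> on either side.  Along \<open>\<gamma>\<close>
  the distance to each point of \<open>K\<close> is nondecreasing, in particular the distance to the points of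
  contact, so neither string gets shorter and the zero of \<open>\<Phi>\<close> cannot leave the arc.  For a finite
  step the string may lose an amount quadratic in the step; this is harmless because \<open>\<gamma>\<close> is a
  Lipschitz curve, as the squared distance to the centre of a ball inside \<open>K\<close> grows at least
  linearly along it (\<open>SDC_from_path\<close>, \<open>level_persists\<close>, \<open>path_reaches_level\<close>).  If \<open>K\<close> is a segment with
  endpoint \<open>x0\<close>, it is enough that \<open>\<gamma>\<close> does not come closer to the other endpoint than \<open>x0\<close>
  (\<open>segment_reaches_level\<close>).

  No point of the fence is reachable with positive excess.  For a point \<open>i \<psi>\<close> of the left arc, \<open>\<psi>\<close> is
  an end of the visible arc, and \<open>\<Phi>\<close> is negative on that arc.  The values on the preceding turn are
  larger by \<open>L\<close>, and they are positive as long as \<open>i \<psi>\<close> has not passed the meeting point of the two arcs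
  (\<open>fence_bound\<close>, \<open>\<Phi>_left_arc_bound\<close>).  Since \<open>\<Phi>\<close> and the excess are affine in the point, this carries
  over to the cone over the arc (\<open>left_cone_avoids\<close>) and, by reflection, to the right cone.

  A reachable point becomes reachable with positive excess when it is pushed slightly along \<open>n\<close>.
  So points outside \<open>J \<union> K\<close> accumulate at every point of \<open>\<gamma>\<close> (\<open>level_in_closure\<close>).\<close>

section \<open>Auxiliary facts of real analysis\<close>

lemma cos_half_angle: "cos u = 1 - 2 * (sin (u / 2))\<^sup>2" for u :: real
  using cos_double_sin[of "u / 2"] by (metis mult.commute nonzero_eq_divide_eq zero_neq_numeral)

lemma one_minus_cos_le: "1 - cos u \<le> u\<^sup>2 / 2" for u :: real
proof -
  have "1 - cos u = 2 * (sin (u / 2))\<^sup>2" using cos_half_angle[of u] by simp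
  also have "\<dots> \<le> 2 * (u / 2)\<^sup>2"
    using abs_sin_x_le_abs_x[of "u / 2"] by (intro mult_left_mono abs_le_square_iff[THEN iffD1]) auto
  finally show ?thesis by (simp add: power_divide)
qed

lemma minus_sin_le:
  fixes u :: real
  assumes "0 \<le> u" "u \<le> 1"
  shows "u - sin u \<le> u\<^sup>2"
proof -
  have "0\<^sup>2 + sin 0 - 0 \<le> u\<^sup>2 + sin u - u"
  proof (rule DERIV_nonneg_imp_nondecreasing[where f = "\<lambda>u. u\<^sup>2 + sin u - u", OF assms(1)])
    fix v assume v: "0 \<le> v" "v \<le> u"
    have "v\<^sup>2 \<le> v" using v assms by (simp add: power2_eq_square mult_left_le)
    then have "0 \<le> 2 * v + cos v - 1" using one_minus_cos_le[of v] v by linarith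
    moreover have "((\<lambda>u. u\<^sup>2 + sin u - u) has_real_derivative 2 * v + cos v - 1) (at v)"
      by (auto intro!: derivative_eq_intros)
    ultimately show "\<exists>y. ((\<lambda>u. u\<^sup>2 + sin u - u) has_real_derivative y) (at v) \<and> 0 \<le> y" by blast
  qed
  then show ?thesis by simp
qed

text \<open>A first-order expansion that is uniform in the base point is assumed only to the right.  Applied at
  the left neighbour \<open>v\<close> of \<open>u\<close>, and with the Lipschitz bound used to replace \<open>g v\<close> by \<open>g u\<close>, it gives the
  derivative from the left as well.\<close>

lemma two_sided_derivative:
  fixes f g :: "real \<Rightarrow> real"
  assumes "C \<ge> 0" "\<And>u v. u \<le> v \<Longrightarrow> v \<le> u + 1 \<Longrightarrow> \<bar>f v - f u - (v - u) * g u\<bar> \<le> C * (v - u)\<^sup>2"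
    and "\<And>u v. \<bar>g u - g v\<bar> \<le> C * \<bar>u - v\<bar>"
  shows "(f has_real_derivative g u) (at u)"
proof -
  have b: "\<bar>(f v - f u) / (v - u) - g u\<bar> \<le> 2 * C * \<bar>v - u\<bar>" if v: "v \<noteq> u" "\<bar>v - u\<bar> \<le> 1" for v
  proof -
    have "\<bar>f v - f u - (v - u) * g u\<bar> \<le> 2 * C * (v - u)\<^sup>2"
    proof (cases "u \<le> v")
      case True
      then have "\<bar>f v - f u - (v - u) * g u\<bar> \<le> C * (v - u)\<^sup>2" using assms(2)[of u v] v by auto
      also have "\<dots> \<le> 2 * C * (v - u)\<^sup>2" using assms(1) by (intro mult_right_mono) auto
      finally show ?thesis .
    next
      case False
      have "\<bar>f u - f v - (u - v) * g v\<bar> \<le> C * (v - u)\<^sup>2"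
        using assms(2)[of v u] False v by (auto simp: power2_commute)
      moreover have "\<bar>(u - v) * (g v - g u)\<bar> \<le> C * (v - u)\<^sup>2"
      proof -
        have "\<bar>u - v\<bar> * \<bar>g v - g u\<bar> \<le> \<bar>u - v\<bar> * (C * \<bar>v - u\<bar>)"
          using assms(3)[of v u] by (rule mult_left_mono) simp
        also have "\<dots> = C * \<bar>v - u\<bar>\<^sup>2"
          unfolding power2_eq_square by (simp only: abs_minus_commute[of u v] mult_ac)
        finally show ?thesis by (simp only: abs_mult power2_abs)
      qed
      moreover have "f v - f u - (v - u) * g u = - (f u - f v - (u - v) * g v) - (u - v) * (g v - g u)"
        by (simp only: left_diff_distrib right_diff_distrib)
      ultimately show ?thesis by linarith
    qed
    moreover have "(v - u) * ((f v - f u) / (v - u) - g u) = f v - f u - (v - u) * g u"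
    proof -
      have "(v - u) * ((f v - f u) / (v - u)) = f v - f u" using v by simp
      then show ?thesis by (simp only: right_diff_distrib)
    qed
    moreover have "2 * C * (v - u)\<^sup>2 = \<bar>v - u\<bar> * (2 * C * \<bar>v - u\<bar>)"
      by (metis abs_mult_self_eq mult.assoc mult.left_commute power2_eq_square)
    ultimately have "\<bar>(v - u) * ((f v - f u) / (v - u) - g u)\<bar> \<le> \<bar>v - u\<bar> * (2 * C * \<bar>v - u\<bar>)"
      by simp
    then show ?thesis using v by (simp add: abs_mult)
  qed
  have "((\<lambda>v. (f v - f u) / (v - u) - g u) \<longlongrightarrow> 0) (at u)"
  proof (rule Lim_null_comparison)
    show "eventually (\<lambda>v. norm ((f v - f u) / (v - u) - g u) \<le> 2 * C * \<bar>v - u\<bar>) (at u)"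
      unfolding eventually_at using b by (intro exI[of _ 1]) (auto simp: dist_real_def)
    have "((\<lambda>v. 2 * C * \<bar>v - u\<bar>) \<longlongrightarrow> 2 * C * \<bar>u - u\<bar>) (at u)" by (intro tendsto_intros)
    then show "((\<lambda>v. 2 * C * \<bar>v - u\<bar>) \<longlongrightarrow> 0) (at u)" by simp
  qed
  then have "((\<lambda>v. (f v - f u) / (v - u)) \<longlongrightarrow> g u) (at u)" by (simp only: LIM_zero_iff)
  then show ?thesis by (simp add: has_field_derivative_iff)
qed

lemma mono_tendsto_left:
  fixes f :: "real \<Rightarrow> real"
  assumes "mono f"
  shows "(f \<longlongrightarrow> Sup (f ` {..<x})) (at_left x)"
proof -
  have bdd: "bdd_above (f ` {..<x})"
    using assms by (auto intro!: bdd_aboveI[of _ "f x"] dest: monoD less_imp_le)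
  have ne: "f ` {..<x} \<noteq> {}" by auto
  show ?thesis
  proof (rule order_tendstoI)
    fix c assume "c < Sup (f ` {..<x})"
    then obtain y where y: "y < x" "c < f y"
      using less_cSup_iff[OF ne bdd] by auto
    show "eventually (\<lambda>y. c < f y) (at_left x)"
    proof (rule eventually_mono[OF eventually_at_left_real[OF y(1)]])
      fix z assume "z \<in> {y<..<x}"
      then show "c < f z" using y(2) monoD[OF assms, of y z] by simp
    qed
  next
    fix c assume c: "Sup (f ` {..<x}) < c"
    show "eventually (\<lambda>y. f y < c) (at_left x)"
      unfolding eventually_at_filter
    proof (intro always_eventually allI impI)
      fix y assume "y \<noteq> x" "y \<in> {..<x}"
      then have "f y \<le> Sup (f ` {..<x})" using bdd by (intro cSup_upper) auto
      then show "f y < c" using c by simp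
    qed
  qed
qed

text \<open>The supremum of the parameters at which \<open>P\<close> holds is attained by closedness, and a step to the
  right of it is possible unless it is \<open>v\<close>.\<close>

lemma right_step_induction:
  fixes P :: "real \<Rightarrow> bool"
  assumes "u \<le> v" "P u"
    and step: "\<And>\<sigma>. u \<le> \<sigma> \<Longrightarrow> \<sigma> < v \<Longrightarrow> P \<sigma> \<Longrightarrow> \<exists>\<zeta>>0. \<forall>h. 0 < h \<longrightarrow> h < \<zeta> \<longrightarrow> \<sigma> + h \<le> v \<longrightarrow> P (\<sigma> + h)"
    and closed: "\<And>s \<sigma>. (\<And>n. u \<le> s n \<and> s n \<le> v \<and> P (s n)) \<Longrightarrow> s \<longlonglongrightarrow> \<sigma> \<Longrightarrow> P \<sigma>"
  shows "P v"
proof -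
  define T where "T = {\<sigma>. u \<le> \<sigma> \<and> \<sigma> \<le> v \<and> P \<sigma>}"
  have T: "u \<in> T" "bdd_above T" using assms(1,2) by (auto simp: T_def bdd_above_def)
  define s where "s = Sup T"
  have "closed T"
    unfolding closed_sequential_limits
  proof (intro allI impI, elim conjE)
    fix f l assume f: "\<forall>n. f n \<in> T" "f \<longlonglongrightarrow> l"
    have "P l" using f closed[of f l] by (auto simp: T_def)
    moreover have "u \<le> l" "l \<le> v"
      using f by (auto simp: T_def intro: LIMSEQ_le_const LIMSEQ_le_const2)
    ultimately show "l \<in> T" by (simp add: T_def)
  qed
  then have "s \<in> T" unfolding s_def using T by (intro closed_contains_Sup) auto
  then have s: "u \<le> s" "s \<le> v" "P s" by (auto simp: T_def)
  have "s = v"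
  proof (rule ccontr)
    assume "s \<noteq> v"
    then have "s < v" using s by simp
    then obtain \<zeta> where \<zeta>: "\<zeta> > 0" "\<And>h. 0 < h \<Longrightarrow> h < \<zeta> \<Longrightarrow> s + h \<le> v \<Longrightarrow> P (s + h)"
      using step[of s] s by blast
    define h where "h = min (\<zeta> / 2) (v - s)"
    have h: "0 < h" "h < \<zeta>" "s + h \<le> v" using \<zeta>(1) \<open>s < v\<close> by (auto simp: h_def)
    then have "s + h \<in> T" using \<zeta>(2) s by (simp add: T_def)
    then have "s + h \<le> s" using T(2) unfolding s_def by (rule cSup_upper)
    then show False using h by simp
  qed
  then show ?thesis using s by simp
qed

section \<open>Rotating frames and support functions in the plane\<close>

lemma nvec_inner_nvec: "nvec \<phi> \<bullet> nvec \<theta> = cos (\<phi> - \<theta>)"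
  by (simp add: nvec_def inner_complex_def cos_diff)

lemma tvec_inner_tvec: "tvec \<phi> \<bullet> tvec \<theta> = cos (\<phi> - \<theta>)"
  by (simp add: tvec_def inner_complex_def cos_diff)

lemma nvec_inner_tvec: "nvec \<phi> \<bullet> tvec \<theta> = sin (\<phi> - \<theta>)"
  by (simp add: nvec_def tvec_def inner_complex_def sin_diff)

lemma tvec_inner_nvec: "tvec \<theta> \<bullet> nvec \<phi> = sin (\<phi> - \<theta>)"
  by (simp add: nvec_def tvec_def inner_complex_def sin_diff)

lemmas frame_inner = nvec_inner_nvec tvec_inner_tvec nvec_inner_tvec tvec_inner_nvec

lemma norm_nvec [simp]: "norm (nvec \<theta>) = 1" and norm_tvec [simp]: "norm (tvec \<theta>) = 1"
  by (simp_all add: nvec_def tvec_def norm_complex_def)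

lemma frame_decomposition: "v = (nvec \<theta> \<bullet> v) *\<^sub>R nvec \<theta> + (tvec \<theta> \<bullet> v) *\<^sub>R tvec \<theta>"
proof -
  have e: "cos \<theta> * cos \<theta> = 1 - sin \<theta> * sin \<theta>"
    using sin_cos_squared_add[of \<theta>] by (simp add: power2_eq_square)
  show ?thesis
    by (simp add: nvec_def tvec_def inner_complex_def complex_eq_iff algebra_simps e)
qed

lemma norm_sq_frame: "(norm v)\<^sup>2 = (nvec \<theta> \<bullet> v)\<^sup>2 + (tvec \<theta> \<bullet> v)\<^sup>2"
proof -
  have "(norm v)\<^sup>2 = v \<bullet> v" by (simp add: power2_norm_eq_inner)
  also have "\<dots> = v \<bullet> ((nvec \<theta> \<bullet> v) *\<^sub>R nvec \<theta> + (tvec \<theta> \<bullet> v) *\<^sub>R tvec \<theta>)"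
    by (metis frame_decomposition)
  finally show ?thesis
    by (simp add: inner_add_right inner_commute power2_eq_square)
qed

lemma frame_eqI: "nvec \<theta> \<bullet> u = nvec \<theta> \<bullet> v \<Longrightarrow> tvec \<theta> \<bullet> u = tvec \<theta> \<bullet> v \<Longrightarrow> u = v"
  by (metis frame_decomposition)

lemma nvec_add: "nvec (\<theta> + \<eta>) = cos \<eta> *\<^sub>R nvec \<theta> + sin \<eta> *\<^sub>R tvec \<theta>"
  by (simp add: nvec_def tvec_def complex_eq_iff cos_add sin_add)

lemma tvec_add: "tvec (\<theta> + \<eta>) = cos \<eta> *\<^sub>R tvec \<theta> - sin \<eta> *\<^sub>R nvec \<theta>"
  by (simp add: nvec_def tvec_def complex_eq_iff cos_add sin_add)

lemma nvec_plus_pi [simp]: "nvec (\<theta> + pi) = - nvec \<theta>"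
  and tvec_plus_pi [simp]: "tvec (\<theta> + pi) = - tvec \<theta>"
  by (simp_all add: nvec_def tvec_def complex_eq_iff)

lemma cos_sin_of_int_2pi [simp]:
  "cos (\<theta> + of_int k * (2 * pi)) = cos \<theta>" "sin (\<theta> + of_int k * (2 * pi)) = sin \<theta>"
  using sin_int_2pin[of k] cos_int_2pin[of k] by (simp_all add: cos_add sin_add mult_ac)

lemma nvec_2pi [simp]: "nvec (\<theta> + of_int k * (2 * pi)) = nvec \<theta>"
  and tvec_2pi [simp]: "tvec (\<theta> + of_int k * (2 * pi)) = tvec \<theta>"
  unfolding nvec_def tvec_def cos_sin_of_int_2pi by simp_all

lemma cnj_tvec: "cnj (tvec \<theta>) = - tvec (- \<theta>)"
  by (simp add: tvec_def complex_eq_iff)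

lemma inner_nvec_cnj: "nvec \<theta> \<bullet> cnj v = nvec (- \<theta>) \<bullet> v"
  and inner_tvec_cnj: "tvec \<theta> \<bullet> cnj v = - (tvec (- \<theta>) \<bullet> v)"
  by (simp_all add: nvec_def tvec_def inner_complex_def)

text \<open>Cramer's rule: for \<open>\<beta> - \<alpha>\<close> in \<open>(0, \<pi>)\<close> a normal in between is a combination of the two outer ones with
  nonnegative coefficients.\<close>

lemma nvec_between:
  "sin (\<beta> - \<alpha>) *\<^sub>R nvec \<phi> = sin (\<beta> - \<phi>) *\<^sub>R nvec \<alpha> + sin (\<phi> - \<alpha>) *\<^sub>R nvec \<beta>"
  by (simp add: nvec_def complex_eq_iff sin_diff algebra_simps)

lemma tvec_between:
  "sin (\<beta> - \<alpha>) *\<^sub>R tvec \<phi> = sin (\<beta> - \<phi>) *\<^sub>R tvec \<alpha> + sin (\<phi> - \<alpha>) *\<^sub>R tvec \<beta>"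
  by (simp add: tvec_def complex_eq_iff sin_diff algebra_simps)

lemma has_derivative_frame [derivative_intros]:
  "((\<lambda>\<theta>. nvec \<theta> \<bullet> v) has_real_derivative (tvec \<theta> \<bullet> v)) (at \<theta> within S)"
  "((\<lambda>\<theta>. tvec \<theta> \<bullet> v) has_real_derivative - (nvec \<theta> \<bullet> v)) (at \<theta> within S)"
  by (auto simp: nvec_def tvec_def inner_complex_def intro!: derivative_eq_intros)

lemma continuous_frame: "continuous_on S nvec" "continuous_on S tvec"
proof -
  have n: "nvec = cis" by (simp add: nvec_def cis.code fun_eq_iff)
  have t: "tvec = (\<lambda>\<theta>. \<i> * cis \<theta>)" by (simp add: tvec_def cis.code complex_eq_iff fun_eq_iff)
  show "continuous_on S nvec" "continuous_on S tvec"
    unfolding n t by (intro continuous_intros)+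
qed

lemma obtain_polar: obtains \<theta> \<rho> where "0 \<le> \<rho>" "v = \<rho> *\<^sub>R nvec \<theta>"
proof -
  have "v = norm v *\<^sub>R nvec (Arg v)"
    using rcis_cmod_Arg[of v] by (simp add: rcis_def cis.code nvec_def scaleR_conv_of_real)
  then show thesis using that[of "norm v" "Arg v"] by simp
qed

lemma reduce_mod_2pi:
  fixes \<theta> c :: real
  obtains k :: int where "c < \<theta> + of_int k * (2 * pi)" "\<theta> + of_int k * (2 * pi) \<le> c + 2 * pi"
proof -
  define k where "k = \<lfloor>(c - \<theta>) / (2 * pi)\<rfloor> + 1"
  have "of_int k > (c - \<theta>) / (2 * pi)" "of_int k \<le> (c - \<theta>) / (2 * pi) + 1"
    by (auto simp: k_def; linarith)+
  then have "of_int k * (2 * pi) > c - \<theta>" "of_int k * (2 * pi) \<le> c - \<theta> + 2 * pi"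
    by (simp_all add: field_simps)
  then show thesis using that[of k] by linarith
qed

text \<open>Signed distance of \<open>p\<close> from the support line with outer normal \<open>nvec \<theta>\<close>, positive on the side away
  from \<open>K\<close>.\<close>

definition excess :: "complex set \<Rightarrow> real \<Rightarrow> complex \<Rightarrow> real" where
  "excess K \<theta> p = nvec \<theta> \<bullet> p - support_fun K \<theta>"

locale plane_body =
  fixes K :: "complex set"
  assumes compact: "compact K" and nonempty: "K \<noteq> {}" and convex: "convex K"
begin

lemma bdd_above_inner: "bdd_above ((\<lambda>y. nvec \<theta> \<bullet> y) ` K)"
  using compact
  by (intro bounded_imp_bdd_above compact_imp_bounded compact_continuous_image continuous_intros)

lemma inner_le_support: "y \<in> K \<Longrightarrow> nvec \<theta> \<bullet> y \<le> support_fun K \<theta>"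
  unfolding support_fun_def using bdd_above_inner by (rule cSUP_upper2) auto

lemma face_nonempty: obtains y where "y \<in> face K \<theta>"
proof -
  have "continuous_on K (\<lambda>y. nvec \<theta> \<bullet> y)" by (intro continuous_intros)
  from continuous_attains_sup[OF compact nonempty this]
  obtain y where y: "y \<in> K" "\<forall>z\<in>K. nvec \<theta> \<bullet> z \<le> nvec \<theta> \<bullet> y" by blast
  then have "support_fun K \<theta> \<le> nvec \<theta> \<bullet> y"
    unfolding support_fun_def using nonempty by (auto intro!: cSUP_least)
  with inner_le_support[OF y(1), of \<theta>] y(1) show thesis
    by (intro that[of y]) (auto simp: face_def)
qed

lemma faceD: "y \<in> face K \<theta> \<Longrightarrow> y \<in> K" "y \<in> face K \<theta> \<Longrightarrow> nvec \<theta> \<bullet> y = support_fun K \<theta>"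
  by (auto simp: face_def)

lemma excess_nonpos: "y \<in> K \<Longrightarrow> excess K \<theta> y \<le> 0"
  using inner_le_support by (simp add: excess_def)

lemma excess_face: "y \<in> face K \<theta> \<Longrightarrow> excess K \<theta> y = 0"
  by (simp add: excess_def face_def)

lemma excess_2pi: "excess K (\<theta> + of_int k * (2 * pi)) p = excess K \<theta> p"
  by (simp only: excess_def support_fun_def nvec_2pi)

lemma excess_point_dist: "\<bar>excess K \<theta> p - excess K \<theta> q\<bar> \<le> dist p q"
proof -
  have "\<bar>nvec \<theta> \<bullet> (p - q)\<bar> \<le> norm (nvec \<theta>) * norm (p - q)" by (rule Cauchy_Schwarz_ineq2)
  then show ?thesis by (simp add: excess_def inner_diff_right dist_norm)
qed

lemma excess_convex_combination:
  "excess K \<theta> (t *\<^sub>R p + (1 - t) *\<^sub>R q) = t * excess K \<theta> p + (1 - t) * excess K \<theta> q"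
  by (simp add: excess_def inner_add_right algebra_simps)

text \<open>The support function is sublinear, so minus the excess is sublinear in the normal.\<close>

lemma excess_between:
  assumes "\<alpha> \<le> \<phi>" "\<phi> \<le> \<beta>" "\<beta> - \<alpha> \<le> pi"
  shows "sin (\<beta> - \<alpha>) * excess K \<phi> p
           \<ge> sin (\<beta> - \<phi>) * excess K \<alpha> p + sin (\<phi> - \<alpha>) * excess K \<beta> p"
proof -
  obtain y where y: "y \<in> face K \<phi>" by (rule face_nonempty)
  have c: "sin (\<beta> - \<alpha>) * (nvec \<phi> \<bullet> v)
      = sin (\<beta> - \<phi>) * (nvec \<alpha> \<bullet> v) + sin (\<phi> - \<alpha>) * (nvec \<beta> \<bullet> v)" for v
    using arg_cong[OF nvec_between[of \<beta> \<alpha> \<phi>], of "\<lambda>u. u \<bullet> v"] by (simp add: inner_add_left)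
  have "sin (\<beta> - \<alpha>) * support_fun K \<phi>
      = sin (\<beta> - \<phi>) * (nvec \<alpha> \<bullet> y) + sin (\<phi> - \<alpha>) * (nvec \<beta> \<bullet> y)"
    using c[of y] faceD(2)[OF y] by simp
  also have "\<dots> \<le> sin (\<beta> - \<phi>) * support_fun K \<alpha> + sin (\<phi> - \<alpha>) * support_fun K \<beta>"
    using assms inner_le_support[OF faceD(1)[OF y]]
    by (intro add_mono mult_left_mono sin_ge_zero) auto
  finally show ?thesis using c[of p] by (simp add: excess_def algebra_simps)
qed

text \<open>The directions visible from a point form an arc.  One may take a direction tangent to \<open>K\<close> as one of
  the two ends.\<close>

lemma excess_pos_between:
  assumes "excess K \<alpha> p \<ge> 0" "excess K \<beta> p \<ge> 0" "excess K \<alpha> p > 0 \<or> excess K \<beta> p > 0"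
    and "\<alpha> < \<phi>" "\<phi> < \<beta>" "\<beta> - \<alpha> < pi"
  shows "excess K \<phi> p > 0"
proof -
  have "sin (\<beta> - \<alpha>) > 0" "sin (\<beta> - \<phi>) > 0" "sin (\<phi> - \<alpha>) > 0"
    using assms by (auto intro!: sin_gt_zero)
  moreover from this have "sin (\<beta> - \<phi>) * excess K \<alpha> p + sin (\<phi> - \<alpha>) * excess K \<beta> p > 0"
    using assms by (smt (verit) mult_pos_pos mult_nonneg_nonneg)
  ultimately show ?thesis
    using excess_between[of \<alpha> \<phi> \<beta> p] assms by (smt (verit) zero_less_mult_pos)
qed

lemma outside_visible:
  assumes "p \<notin> K" obtains \<theta> where "excess K \<theta> p > 0"
proof -
  obtain u b where u: "u \<bullet> p < b" "\<forall>y\<in>K. u \<bullet> y > b"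
    using separating_hyperplane_closed_point[OF convex compact_imp_closed[OF compact] assms] by blast
  obtain \<rho> \<theta> where r: "0 \<le> \<rho>" "- u = \<rho> *\<^sub>R nvec \<theta>" by (rule obtain_polar)
  obtain y where y: "y \<in> face K \<theta>" by (rule face_nonempty)
  have "- u \<bullet> y < - u \<bullet> p" using u faceD(1)[OF y] by (smt (verit) inner_minus_left)
  then have "\<rho> * (nvec \<theta> \<bullet> y) < \<rho> * (nvec \<theta> \<bullet> p)" by (simp only: r(2) inner_scaleR_left)
  then have "nvec \<theta> \<bullet> y < nvec \<theta> \<bullet> p" using r(1) by (simp add: mult_less_cancel_left)
  then show thesis using faceD(2)[OF y] by (intro that[of \<theta>]) (simp add: excess_def)
qed

lemma support_lipschitz:
  obtains R where "R \<ge> 0" "\<And>y. y \<in> K \<Longrightarrow> norm y \<le> R"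
    "\<And>\<theta> \<theta>'. \<bar>support_fun K \<theta> - support_fun K \<theta>'\<bar> \<le> R * \<bar>\<theta> - \<theta>'\<bar>"
proof -
  obtain R where R: "\<And>y. y \<in> K \<Longrightarrow> norm y \<le> R" "R > 0"
    using compact_imp_bounded[OF compact] bounded_pos by blast
  have n: "norm (nvec \<theta> - nvec \<theta>') \<le> \<bar>\<theta> - \<theta>'\<bar>" for \<theta> \<theta>'
  proof -
    have "(norm (nvec \<theta> - nvec \<theta>'))\<^sup>2 = 2 - 2 * cos (\<theta> - \<theta>')"
      by (simp add: power2_norm_eq_inner inner_diff_left inner_diff_right frame_inner
          cos_diff mult_ac)
    also have "\<dots> = (2 * sin ((\<theta> - \<theta>') / 2))\<^sup>2"
      using cos_half_angle[of "\<theta> - \<theta>'"] by (simp add: power_mult_distrib)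
    also have "\<dots> \<le> (\<theta> - \<theta>')\<^sup>2"
      using abs_sin_x_le_abs_x[of "(\<theta> - \<theta>') / 2"] by (intro abs_le_square_iff[THEN iffD1]) auto
    finally show ?thesis using abs_le_square_iff[of "norm (nvec \<theta> - nvec \<theta>')" "\<theta> - \<theta>'"] by simp
  qed
  have "support_fun K \<theta> - support_fun K \<theta>' \<le> R * \<bar>\<theta> - \<theta>'\<bar>" for \<theta> \<theta>'
  proof -
    obtain y where y: "y \<in> face K \<theta>" by (rule face_nonempty)
    have "support_fun K \<theta> - support_fun K \<theta>' \<le> (nvec \<theta> - nvec \<theta>') \<bullet> y"
      using faceD(2)[OF y] inner_le_support[OF faceD(1)[OF y], of \<theta>'] by (simp add: inner_diff_left)
    also have "\<dots> \<le> norm (nvec \<theta> - nvec \<theta>') * norm y" by (rule norm_cauchy_schwarz)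
    also have "\<dots> \<le> \<bar>\<theta> - \<theta>'\<bar> * R" using n R(1)[OF faceD(1)[OF y]] by (intro mult_mono) auto
    finally show ?thesis by (simp add: mult_ac)
  qed
  then have "\<bar>support_fun K \<theta> - support_fun K \<theta>'\<bar> \<le> R * \<bar>\<theta> - \<theta>'\<bar>" for \<theta> \<theta>'
    by (metis abs_le_iff abs_minus_commute minus_diff_eq)
  with R show thesis by (intro that[of R]) auto
qed

lemma continuous_support: "continuous_on S (support_fun K)"
proof -
  obtain R where "R \<ge> 0" "\<And>\<theta> \<theta>'. \<bar>support_fun K \<theta> - support_fun K \<theta>'\<bar> \<le> R * \<bar>\<theta> - \<theta>'\<bar>"
    by (rule support_lipschitz) blast
  then have "R-lipschitz_on UNIV (support_fun K)"
    by (intro lipschitz_onI) (auto simp: dist_real_def)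
  then show ?thesis using lipschitz_on_continuous_on continuous_on_subset by blast
qed

lemma continuous_excess: "continuous_on S (\<lambda>\<theta>. excess K \<theta> p)"
  unfolding excess_def by (intro continuous_intros continuous_support continuous_frame)

lemma excess_near:
  assumes "excess K \<theta> p > 0"
  obtains e where "e > 0" "\<And>\<phi>. \<bar>\<phi> - \<theta>\<bar> < e \<Longrightarrow> excess K \<phi> p > 0"
proof -
  have "isCont (\<lambda>\<phi>. excess K \<phi> p) \<theta>"
    using continuous_excess[of UNIV] by (simp add: continuous_on_eq_continuous_at)
  then have "\<forall>\<^sub>F \<phi> in at \<theta>. excess K \<phi> p > 0"
    using assms unfolding isCont_def by (rule order_tendstoD(1))
  then obtain e where "e > 0" "\<And>\<phi>. \<phi> \<noteq> \<theta> \<Longrightarrow> dist \<phi> \<theta> < e \<Longrightarrow> excess K \<phi> p > 0"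
    by (auto simp: eventually_at)
  then show thesis using assms by (intro that[of e]) (metis dist_real_def)+
qed

end

section \<open>Unrolling the boundary\<close>

text \<open>What the proof needs to know about an involute that starts at \<open>x0\<close> and leaves \<open>x0\<close> at the parameter \<open>\<tau>\<close>.
  The vector \<open>X - i \<psi>\<close> in \<open>tangent\<close> is the unrolled part of the string; it points forward, which fixes the
  direction of unrolling.\<close>

locale unrolling = plane_body K for K +
  fixes L :: real and x0 :: complex and i :: "real \<Rightarrow> complex" and \<theta>0 \<tau> :: real
  assumes L_pos: "0 < L"
    and inner_nvec: "nvec \<theta> \<bullet> i \<theta> = support_fun K \<theta>"
    and derivative: "((\<lambda>\<theta>. tvec \<theta> \<bullet> i \<theta>) has_real_derivative - support_fun K \<theta>) (at \<theta>)"
    and period: "tvec (\<theta> + 2 * pi) \<bullet> i (\<theta> + 2 * pi) = tvec \<theta> \<bullet> i \<theta> - L"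
    and start: "x0 \<in> face K \<theta>0" "i \<theta>0 = x0"
    and leave: "\<theta>0 \<le> \<tau>" "i \<tau> = x0"
    and tangent: "\<tau> < \<psi> \<Longrightarrow> \<exists>X\<in>face K \<psi>. \<exists>\<rho>>0. i \<psi> = X - \<rho> *\<^sub>R tvec \<psi>"
    and meets_body: "i \<psi> \<in> K \<Longrightarrow> i \<psi> = x0"
    and advance: "\<tau> \<le> \<psi> \<Longrightarrow> \<psi> \<le> \<psi>' \<Longrightarrow> \<psi>' \<le> \<psi> + pi / 2 \<Longrightarrow> tvec \<psi> \<bullet> (i \<psi>' - i \<psi>) \<ge> 0"

text \<open>The data behind a left involute.  That \<open>x\<close> runs counterclockwise is encoded in the monotonicity of
  \<open>sl\<close>, see \<open>right_end\<close> and \<open>face_mono\<close>.\<close>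

locale left_arc = plane_body K for K +
  fixes L :: real and x :: "real \<Rightarrow> complex" and s0 \<theta>0 :: real and sl :: "real \<Rightarrow> real"
  assumes L_pos: "0 < L"
    and x_period: "x (s + L) = x s"
    and arclength: "a \<le> b \<Longrightarrow> curve_length x a b = ennreal (b - a)"
    and arc_fun: "left_arc_fun K L x s0 \<theta>0 sl"
begin

lemma sl_mono: "\<theta> \<le> \<theta>' \<Longrightarrow> sl \<theta> \<le> sl \<theta>'"
  and sl_right: "continuous (at_right \<theta>) sl"
  and sl_period: "sl (\<theta> + 2 * pi) = sl \<theta> + L"
  and face_bij: "bij_betw x {Lim (at_left \<theta>) sl..sl \<theta>} (face K \<theta>)"
  and s0_mem: "s0 \<in> {Lim (at_left \<theta>0) sl..sl \<theta>0}"
  using arc_fun by (auto simp: left_arc_fun_def mono_def)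

definition face_interval :: "real \<Rightarrow> real set" where "face_interval \<theta> = {Lim (at_left \<theta>) sl..sl \<theta>}"

lemma Lim_left: "Lim (at_left \<theta>) sl = Sup (sl ` {..<\<theta>})"
  using mono_tendsto_left[of sl \<theta>] sl_mono by (intro tendsto_Lim) (auto simp: mono_def)

lemma face_interval_lower: "s \<in> face_interval \<theta> \<Longrightarrow> \<theta>' < \<theta> \<Longrightarrow> sl \<theta>' \<le> s"
proof -
  assume s: "s \<in> face_interval \<theta>" "\<theta>' < \<theta>"
  have "bdd_above (sl ` {..<\<theta>})" by (auto intro!: bdd_aboveI[of _ "sl \<theta>"] sl_mono)
  then have "sl \<theta>' \<le> Sup (sl ` {..<\<theta>})" using s by (intro cSup_upper) auto
  then show ?thesis using s by (simp add: face_interval_def Lim_left)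
qed

lemma face_interval_upper: "s \<in> face_interval \<theta> \<Longrightarrow> s \<le> sl \<theta>"
  by (simp add: face_interval_def)

lemma face_intervalI:
  assumes "\<And>\<theta>'. lo \<le> \<theta>' \<Longrightarrow> \<theta>' < \<theta> \<Longrightarrow> sl \<theta>' \<le> s" "lo < \<theta>" "s \<le> sl \<theta>"
  shows "s \<in> face_interval \<theta>"
proof -
  have "Sup (sl ` {..<\<theta>}) \<le> s"
  proof (rule cSup_least)
    fix y assume "y \<in> sl ` {..<\<theta>}"
    then obtain \<theta>' where "\<theta>' < \<theta>" "y = sl \<theta>'" by auto
    then show "y \<le> s" using assms(1)[of "max lo \<theta>'"] assms(2) sl_mono[of \<theta>' "max lo \<theta>'"] by auto
  qed auto
  then show ?thesis using assms(3) by (simp add: face_interval_def Lim_left)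
qed

lemma sl_in_face_interval: "sl \<theta> \<in> face_interval \<theta>"
  by (rule face_intervalI[of "\<theta> - 1"]) (auto intro: sl_mono)

lemma face_interval_face: "x ` face_interval \<theta> = face K \<theta>" and face_interval_inj: "inj_on x (face_interval \<theta>)"
  using face_bij[of \<theta>] by (auto simp: bij_betw_def face_interval_def)

lemma x_face: "s \<in> face_interval \<theta> \<Longrightarrow> x s \<in> face K \<theta>"
  using face_interval_face by blast

lemma right_limit_ge:
  assumes "\<And>\<theta>. \<theta>' < \<theta> \<Longrightarrow> c \<le> sl \<theta>" shows "c \<le> sl \<theta>'"
proof (rule tendsto_lowerbound)
  show "(sl \<longlongrightarrow> sl \<theta>') (at_right \<theta>')" using sl_right[of \<theta>'] by (simp add: continuous_within)
  show "eventually (\<lambda>\<theta>. c \<le> sl \<theta>) (at_right \<theta>')"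
    using eventually_at_right_less[of \<theta>'] by (rule eventually_mono) (rule assms)
qed simp

lemma dist_le:
  assumes "s \<le> s'" shows "dist (x s) (x s') \<le> s' - s"
proof -
  have "ennreal (dist (x s) (x s')) \<le> curve_length x s s'"
    unfolding curve_length_def by (rule SUP_upper2[of "[s, s']"]) (use assms in auto)
  then show ?thesis using assms by (simp add: arclength)
qed

lemma continuous_x: "continuous_on S x"
proof -
  have "1-lipschitz_on UNIV x"
  proof (rule lipschitz_onI)
    fix s s' show "dist (x s) (x s') \<le> 1 * dist s s'"
      using dist_le[of s s'] dist_le[of s' s] by (cases "s \<le> s'") (auto simp: dist_real_def dist_commute)
  qed simp
  then show ?thesis using lipschitz_on_continuous_on continuous_on_subset by blast
qed

lemma chord_inner_le:
  assumes "s \<le> s'" shows "tvec \<theta> \<bullet> (x s' - x s) \<le> s' - s"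
proof -
  have "tvec \<theta> \<bullet> (x s' - x s) \<le> norm (tvec \<theta>) * norm (x s' - x s)" by (rule norm_cauchy_schwarz)
  also have "\<dots> \<le> s' - s" using dist_le[OF assms] by (simp add: dist_norm norm_minus_commute)
  finally show ?thesis .
qed

text \<open>A point of a later face lies below the support line of the earlier one and \<open>y\<close> lies below that of the
  later one; turning the normal by less than a right angle leaves only displacements in forward
  direction.\<close>

lemma face_left_of_later:
  assumes "y \<in> face K \<theta>" "y' \<in> face K \<theta>'" "\<theta> < \<theta>'" "\<theta>' < \<theta> + pi / 2"
  shows "tvec \<theta> \<bullet> y \<le> tvec \<theta> \<bullet> y'"
proof -
  define \<delta> where "\<delta> = \<theta>' - \<theta>"
  have d: "sin \<delta> > 0" "cos \<delta> > 0"
    using assms by (auto simp: \<delta>_def intro!: sin_gt_zero cos_gt_zero_pi)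
  have "nvec \<theta> \<bullet> (y' - y) \<le> 0"
    using assms faceD inner_le_support by (auto simp: inner_diff_right)
  then have "cos \<delta> * (nvec \<theta> \<bullet> (y' - y)) \<le> 0" using d by (simp add: mult_nonneg_nonpos)
  moreover have "nvec \<theta>' \<bullet> (y' - y) \<ge> 0"
    using assms faceD inner_le_support by (auto simp: inner_diff_right)
  then have "cos \<delta> * (nvec \<theta> \<bullet> (y' - y)) + sin \<delta> * (tvec \<theta> \<bullet> (y' - y)) \<ge> 0"
    using nvec_add[of \<theta> \<delta>] by (simp add: \<delta>_def inner_add_left)
  ultimately have "0 \<le> sin \<delta> * (tvec \<theta> \<bullet> (y' - y))" by linarith
  then show ?thesis using d by (simp add: zero_le_mult_iff inner_diff_right)
qed

text \<open>The points \<open>x (sl \<theta>')\<close> with \<open>\<theta>' > \<theta>\<close> lie beyond the whole face \<open>F \<theta>\<close>, and they converge to \<open>x (sl \<theta>)\<close> by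
  right-continuity.\<close>

lemma right_end:
  assumes "y \<in> face K \<theta>" shows "tvec \<theta> \<bullet> y \<le> tvec \<theta> \<bullet> x (sl \<theta>)"
proof (rule tendsto_lowerbound)
  have "(sl \<longlongrightarrow> sl \<theta>) (at_right \<theta>)" using sl_right by (simp add: continuous_within)
  then show "((\<lambda>\<theta>'. tvec \<theta> \<bullet> x (sl \<theta>')) \<longlongrightarrow> tvec \<theta> \<bullet> x (sl \<theta>)) (at_right \<theta>)"
    by (intro tendsto_intros continuous_on_tendsto_compose[OF continuous_x[of UNIV]]) auto
  show "eventually (\<lambda>\<theta>'. tvec \<theta> \<bullet> y \<le> tvec \<theta> \<bullet> x (sl \<theta>')) (at_right \<theta>)"
    using eventually_at_right_real[of \<theta> "\<theta> + pi / 2"]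
    by (rule eventually_mono) (use assms face_interval_face sl_in_face_interval in \<open>auto intro!: face_left_of_later\<close>)
qed simp

text \<open>Otherwise, since the last point of the parameter interval is mapped to the right end of the face,
  the intermediate value theorem would produce two parameters of the same point.\<close>

lemma face_mono:
  assumes "s1 \<in> face_interval \<theta>" "s2 \<in> face_interval \<theta>" "s1 \<le> s2"
  shows "tvec \<theta> \<bullet> x s1 \<le> tvec \<theta> \<bullet> x s2"
proof (rule ccontr)
  assume neg: "\<not> ?thesis"
  have "tvec \<theta> \<bullet> x s1 \<le> tvec \<theta> \<bullet> x (sl \<theta>)" using assms face_interval_face by (intro right_end) auto
  moreover have "continuous_on {s2..sl \<theta>} (\<lambda>s. tvec \<theta> \<bullet> x s)"
    by (intro continuous_intros continuous_x)
  ultimately obtain s where s: "s2 \<le> s" "s \<le> sl \<theta>" "tvec \<theta> \<bullet> x s = tvec \<theta> \<bullet> x s1"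
    using IVT'[of "\<lambda>s. tvec \<theta> \<bullet> x s" s2 "tvec \<theta> \<bullet> x s1" "sl \<theta>"] neg face_interval_upper[OF assms(2)] by auto
  have sI: "s \<in> face_interval \<theta>" using s assms by (auto simp: face_interval_def)
  have "x s = x s1"
    using faceD(2)[OF x_face[OF sI]] faceD(2)[OF x_face[OF assms(1)]] s(3) by (intro frame_eqI[of \<theta>]) auto
  then have "s = s1" using face_interval_inj sI assms(1) by (auto dest: inj_onD)
  then show False using s assms(3) neg by auto
qed

text \<open>Every boundary parameter belongs to some face; \<open>\<phi>\<close> is the first direction at which \<open>sl\<close> reaches \<open>s\<close>.\<close>

lemma locate:
  assumes "s1 \<in> face_interval \<psi>" "s2 \<in> face_interval \<psi>'" "s1 \<le> s" "s \<le> s2" "\<psi> \<le> \<psi>'"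
  obtains \<phi> where "\<psi> \<le> \<phi>" "\<phi> \<le> \<psi>'" "s \<in> face_interval \<phi>"
proof -
  define A where "A = {\<phi>. \<psi> \<le> \<phi> \<and> s \<le> sl \<phi>}"
  have A: "\<psi>' \<in> A" "bdd_below A" "A \<noteq> {}"
    using assms face_interval_upper[OF assms(2)] by (auto simp: A_def bdd_below_def)
  define \<phi> where "\<phi> = Inf A"
  have b: "\<psi> \<le> \<phi>" "\<phi> \<le> \<psi>'"
    using A by (auto simp: \<phi>_def A_def intro!: cInf_lower cInf_greatest)
  have up: "s \<le> sl \<theta>" if "\<phi> < \<theta>" for \<theta>
  proof -
    have "\<exists>a\<in>A. a < \<theta>" using cInf_lessD[OF A(3)] that by (simp add: \<phi>_def)
    then obtain a where "a \<in> A" "a < \<theta>" by blast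
    then show ?thesis using sl_mono[of a \<theta>] by (auto simp: A_def)
  qed
  then have up': "s \<le> sl \<phi>" by (rule right_limit_ge)
  have lo: "sl \<theta> \<le> s" if "\<psi> \<le> \<theta>" "\<theta> < \<phi>" for \<theta>
    using that A(2) cInf_lower[of \<theta> A] by (force simp: \<phi>_def A_def)
  have "s \<in> face_interval \<phi>"
  proof (cases "\<psi> < \<phi>")
    case True then show ?thesis using lo up' by (intro face_intervalI[of \<psi>]) auto
  next
    case False
    then have "\<phi> = \<psi>" using b by simp
    then show ?thesis using up' assms(1,3) by (auto simp: face_interval_def)
  qed
  then show thesis using b that by blast
qed

text \<open>Between faces with normals \<open>\<phi>a\<close> and \<open>\<phi>b\<close> the boundary turns from \<open>tvec \<phi>a\<close> to \<open>tvec \<phi>b\<close>, so a chord has the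
  direction \<open>tvec (\<phi>a + \<mu>)\<close> with \<open>0 \<le> \<mu> \<le> \<phi>b - \<phi>a\<close>.  Hence it makes an angle of at most \<open>\<psi>' - \<psi>\<close> with \<open>tvec \<psi>\<close>.\<close>

lemma chord_direction:
  assumes "sa \<in> face_interval \<phi>a" "sb \<in> face_interval \<phi>b" "sa \<le> sb" "\<psi> \<le> \<phi>a" "\<phi>a \<le> \<phi>b" "\<phi>b \<le> \<psi>'" "\<psi>' \<le> \<psi> + pi / 2"
  shows "cos (\<psi>' - \<psi>) * dist (x sa) (x sb) \<le> tvec \<psi> \<bullet> (x sb - x sa)"
proof -
  define \<Delta> where "\<Delta> = x sb - x sa"
  define c e where "c = tvec \<phi>a \<bullet> \<Delta>" and "e = - (nvec \<phi>a \<bullet> \<Delta>)"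
  define d where "d = \<phi>b - \<phi>a"
  have fa: "x sa \<in> face K \<phi>a" and fb: "x sb \<in> face K \<phi>b" using assms face_interval_face by auto
  have e0: "e \<ge> 0"
    using faceD[OF fa] faceD[OF fb] inner_le_support by (simp add: e_def \<Delta>_def inner_diff_right)
  have "nvec \<phi>b \<bullet> \<Delta> \<ge> 0"
    using faceD[OF fa] faceD[OF fb] inner_le_support by (simp add: \<Delta>_def inner_diff_right)
  then have ec: "e * cos d \<le> c * sin d"
    using nvec_add[of \<phi>a d] by (simp add: d_def c_def e_def inner_add_left mult.commute)
  have d: "0 \<le> d" "d \<le> pi / 2" using assms by (auto simp: d_def)
  have c0: "c \<ge> 0"
  proof (cases "d = 0")
    case True
    then show ?thesis using assms face_mono[of sa \<phi>a sb] by (simp add: d_def c_def \<Delta>_def inner_diff_right)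
  next
    case False
    then have "sin d > 0" "cos d \<ge> 0" using d by (auto intro!: sin_gt_zero cos_ge_zero)
    then show ?thesis using ec e0 by (smt (verit) mult_nonneg_nonneg mult_neg_pos)
  qed
  define m where "m = norm \<Delta>"
  have m2: "m\<^sup>2 = c\<^sup>2 + e\<^sup>2" using norm_sq_frame[of \<Delta> \<phi>a] by (simp add: m_def c_def e_def)
  obtain \<mu> where \<mu>: "0 \<le> \<mu>" "\<mu> \<le> pi / 2" "c = m * cos \<mu>" "e = m * sin \<mu>"
  proof (cases "m = 0")
    case True then show ?thesis using that[of 0] m2 by auto
  next
    case False
    then have "m > 0" by (simp add: m_def)
    have "(c / m)\<^sup>2 + (e / m)\<^sup>2 = (c\<^sup>2 + e\<^sup>2) / m\<^sup>2"
      by (simp add: power_divide add_divide_distrib)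
    also have "\<dots> = 1" unfolding m2[symmetric] using False by simp
    finally have one: "(c / m)\<^sup>2 + (e / m)\<^sup>2 = 1" .
    have nonneg: "0 \<le> c / m" "0 \<le> e / m" using c0 e0 \<open>m > 0\<close> by simp_all
    obtain \<mu> where "0 \<le> \<mu>" "\<mu> \<le> pi / 2" "c / m = cos \<mu>" "e / m = sin \<mu>"
      using sincos_total_pi_half[OF nonneg one] by blast
    then show ?thesis using False that[of \<mu>] by (metis nonzero_mult_div_cancel_left times_divide_eq_right)
  qed
  have "m * cos (\<psi>' - \<psi>) \<le> m * cos (\<mu> + (\<phi>a - \<psi>))"
  proof (cases "m = 0")
    case False
    then have "m > 0" by (simp add: m_def)
    have "m * sin (\<mu> - d) \<le> 0" using ec by (simp add: \<mu>(3,4) sin_diff algebra_simps)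
    then have "sin (\<mu> - d) \<le> 0" using \<open>m > 0\<close> by (simp add: mult_le_0_iff)
    then have "\<mu> \<le> d" using sin_gt_zero[of "\<mu> - d"] \<mu> d by force
    then have "cos (\<psi>' - \<psi>) \<le> cos (\<mu> + (\<phi>a - \<psi>))"
      using assms \<mu> by (intro cos_monotone_0_pi_le) (auto simp: d_def)
    then show ?thesis using \<open>m > 0\<close> by simp
  qed simp
  also have "m * cos (\<mu> + (\<phi>a - \<psi>)) = tvec \<psi> \<bullet> \<Delta>"
  proof -
    define \<eta> where "\<eta> = \<phi>a - \<psi>"
    have "tvec \<psi> = cos \<eta> *\<^sub>R tvec \<phi>a + sin \<eta> *\<^sub>R nvec \<phi>a"
    proof -
      have "\<phi>a + - \<eta> = \<psi>" by (simp add: \<eta>_def)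
      from tvec_add[of \<phi>a "- \<eta>", unfolded this] show ?thesis by simp
    qed
    then have "tvec \<psi> \<bullet> \<Delta> = cos \<eta> * c - sin \<eta> * e"
      by (simp add: inner_add_left c_def e_def)
    then show ?thesis by (simp add: \<mu>(3,4) cos_add \<eta>_def[symmetric] algebra_simps)
  qed
  finally show ?thesis by (simp add: \<Delta>_def m_def dist_norm norm_minus_commute mult.commute)
qed

text \<open>Summing the chord estimate over an inscribed polygon telescopes, and the supremum over all polygons
  is the arc length.  Together with the trivial \<open>chord_inner_le\<close> this determines the arc length up to the
  factor \<open>cos (\<psi>' - \<psi>)\<close>, which is second-order in the angle.\<close>

lemma arc_bound:
  assumes "s1 \<in> face_interval \<psi>" "s2 \<in> face_interval \<psi>'" "s1 \<le> s2" "\<psi> \<le> \<psi>'" "\<psi>' \<le> \<psi> + pi / 2"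
  shows "(s2 - s1) * cos (\<psi>' - \<psi>) \<le> tvec \<psi> \<bullet> (x s2 - x s1)"
proof -
  define c where "c = cos (\<psi>' - \<psi>)"
  have c0: "c \<ge> 0" unfolding c_def using assms by (intro cos_ge_zero) auto
  have chord: "c * dist (x sa) (x sb) \<le> tvec \<psi> \<bullet> (x sb - x sa)"
    if s: "s1 \<le> sa" "sa \<le> sb" "sb \<le> s2" for sa sb
  proof -
    obtain \<phi>a where a: "\<psi> \<le> \<phi>a" "\<phi>a \<le> \<psi>'" "sa \<in> face_interval \<phi>a"
      using locate[OF assms(1,2), of sa] s assms by auto
    obtain \<phi>b where b: "\<phi>a \<le> \<phi>b" "\<phi>b \<le> \<psi>'" "sb \<in> face_interval \<phi>b"
      using locate[OF a(3) assms(2), of sb] s a by auto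
    show ?thesis unfolding c_def using a b s assms by (intro chord_direction) auto
  qed
  have nonneg: "tvec \<psi> \<bullet> (x sb - x sa) \<ge> 0" if "s1 \<le> sa" "sa \<le> sb" "sb \<le> s2" for sa sb
    using chord[OF that] c0 by (meson mult_nonneg_nonneg order_trans zero_le_dist)
  show ?thesis
  proof (cases "c = 0")
    case True then show ?thesis using nonneg[of s1 s2] assms by (simp flip: c_def)
  next
    case False
    define M where "M = tvec \<psi> \<bullet> (x s2 - x s1) / c"
    have "curve_length x s1 s2 \<le> ennreal M"
      unfolding curve_length_def
    proof (rule SUP_least)
      fix ts assume "ts \<in> {ts. sorted ts \<and> set ts \<subseteq> {s1..s2}}"
      then have ts: "sorted ts" "set ts \<subseteq> {s1..s2}" by auto
      have tsb: "s1 \<le> ts ! j \<and> ts ! j \<le> s2" if "j < length ts" for j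
        using ts(2) nth_mem[OF that] by auto
      define g where "g j = tvec \<psi> \<bullet> x (ts ! j) / c" for j
      have "(\<Sum>j<length ts - 1. dist (x (ts ! j)) (x (ts ! Suc j))) \<le> (\<Sum>j<length ts - 1. g (Suc j) - g j)"
      proof (rule sum_mono)
        fix j assume "j \<in> {..<length ts - 1}"
        then have j: "Suc j < length ts" by auto
        then have "ts ! j \<le> ts ! Suc j" using ts(1) by (auto intro: sorted_nth_mono)
        then show "dist (x (ts ! j)) (x (ts ! Suc j)) \<le> g (Suc j) - g j"
          using chord[of "ts ! j" "ts ! Suc j"] tsb[of j] tsb[OF j] j c0 False
          by (simp add: g_def field_simps inner_diff_right)
      qed
      also have "\<dots> = g (length ts - 1) - g 0" by (rule sum_lessThan_telescope)
      also have "\<dots> \<le> M"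
      proof (cases "ts = []")
        case True then show ?thesis using nonneg[of s1 s2] assms c0 by (simp add: M_def)
      next
        case False
        then have l: "0 < length ts" "length ts - 1 < length ts" by auto
        have "tvec \<psi> \<bullet> x (ts ! (length ts - 1)) - tvec \<psi> \<bullet> x (ts ! 0) \<le> tvec \<psi> \<bullet> x s2 - tvec \<psi> \<bullet> x s1"
          using nonneg[of s1 "ts ! 0"] nonneg[of "ts ! (length ts - 1)" s2] tsb[OF l(1)] tsb[OF l(2)]
          by (simp add: inner_diff_right)
        then show ?thesis using c0 by (simp add: M_def g_def inner_diff_right divide_right_mono flip: diff_divide_distrib)
      qed
      finally show "(\<Sum>j<length ts - 1. ennreal (dist (x (ts ! j)) (x (ts ! Suc j)))) \<le> ennreal M"
        by (simp add: sum_ennreal ennreal_leI)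
    qed
    then have "ennreal (s2 - s1) \<le> ennreal M" using arclength[OF assms(3)] by simp
    moreover have "0 \<le> M" using nonneg[of s1 s2] assms c0 by (simp add: M_def)
    ultimately have "s2 - s1 \<le> M" by simp
    then show ?thesis using False c0 by (simp add: M_def c_def field_simps)
  qed
qed


abbreviation "i \<equiv> left_involute x sl s0"
abbreviation "\<tau> \<equiv> theta_plus sl s0"

lemma s0_in_face_interval: "s0 \<in> face_interval \<theta>0" using s0_mem by (simp add: face_interval_def)

lemma theta_plus_props: "\<theta>0 \<le> \<tau>" "s0 \<in> face_interval \<tau>" "\<tau> < \<psi> \<Longrightarrow> s0 < sl \<psi>"
proof -
  define A where "A = {\<theta>. sl \<theta> > s0}"
  have ne: "\<theta>0 + 2 * pi \<in> A" using sl_period[of \<theta>0] face_interval_upper[OF s0_in_face_interval] L_pos by (simp add: A_def)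
  have lb: "\<theta>0 \<le> \<theta>" if "\<theta> \<in> A" for \<theta>
    using that face_interval_lower[OF s0_in_face_interval, of \<theta>] by (force simp: A_def)
  have bdd: "bdd_below A" using lb by (auto simp: bdd_below_def)
  have \<tau>: "\<tau> = Inf A" by (simp add: theta_plus_def A_def)
  show "\<theta>0 \<le> \<tau>" unfolding \<tau> using ne lb by (intro cInf_greatest) auto
  show up: "s0 < sl \<psi>" if "\<tau> < \<psi>" for \<psi>
  proof -
    have "\<exists>a\<in>A. a < \<psi>" using cInf_lessD[of A \<psi>] ne that by (auto simp: \<tau>)
    then obtain a where "a \<in> A" "a < \<psi>" by blast
    then show ?thesis using sl_mono[of a \<psi>] by (auto simp: A_def)
  qed
  have "s0 \<le> sl \<theta>" if "\<tau> < \<theta>" for \<theta> using up[OF that] by simp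
  then have "s0 \<le> sl \<tau>" by (rule right_limit_ge)
  moreover have "sl \<theta> \<le> s0" if "\<theta> < \<tau>" for \<theta>
    using that cInf_lower[OF _ bdd, of \<theta>] by (force simp: \<tau> A_def)
  ultimately show "s0 \<in> face_interval \<tau>" by (intro face_intervalI[of "\<tau> - 1"]) auto
qed

lemma tvec_i: "tvec \<theta> \<bullet> i \<theta> = tvec \<theta> \<bullet> x (sl \<theta>) - (sl \<theta> - s0)"
  by (simp add: left_involute_def inner_diff_right frame_inner)

lemma nvec_i: "nvec \<theta> \<bullet> i \<theta> = support_fun K \<theta>"
  using faceD(2)[OF x_face[OF sl_in_face_interval]]
  by (simp add: left_involute_def inner_diff_right frame_inner)

lemma face_speed:
  assumes "s \<in> face_interval \<theta>" shows "tvec \<theta> \<bullet> (x (sl \<theta>) - x s) = sl \<theta> - s"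
  using arc_bound[OF assms sl_in_face_interval face_interval_upper[OF assms]] chord_inner_le[OF face_interval_upper[OF assms]]
  by (intro antisym) auto

lemma i_start: assumes "s0 \<in> face_interval \<theta>" shows "i \<theta> = x s0"
proof (rule frame_eqI)
  show "nvec \<theta> \<bullet> i \<theta> = nvec \<theta> \<bullet> x s0" using nvec_i faceD(2)[OF x_face[OF assms]] by simp
  show "tvec \<theta> \<bullet> i \<theta> = tvec \<theta> \<bullet> x s0"
    using face_speed[OF assms] by (simp add: tvec_i inner_diff_right)
qed

text \<open>On its own face an involute point has a definite arc length coordinate, which is \<open>s0\<close>.\<close>

lemma i_meets: assumes "i \<psi> \<in> K" shows "i \<psi> = x s0"
proof -
  have "i \<psi> \<in> face K \<psi>" using assms nvec_i by (simp add: face_def)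
  then obtain s where s: "s \<in> face_interval \<psi>" "i \<psi> = x s" using face_interval_face by (metis imageE)
  then have "s = s0" using face_speed[OF s(1)] tvec_i[of \<psi>] by (simp add: inner_diff_right)
  then show ?thesis using s by simp
qed

lemma i_advance:
  assumes "\<tau> \<le> \<psi>" "\<psi> \<le> \<psi>'" "\<psi>' \<le> \<psi> + pi / 2"
  shows "tvec \<psi> \<bullet> (i \<psi>' - i \<psi>) \<ge> 0"
proof -
  define c where "c = cos (\<psi>' - \<psi>)"
  have s: "s0 \<le> sl \<psi>" using face_interval_upper[OF theta_plus_props(2)] sl_mono[OF assms(1)] by simp
  have "(sl \<psi>' - sl \<psi>) * c \<le> tvec \<psi> \<bullet> (x (sl \<psi>') - x (sl \<psi>))"
    unfolding c_def using assms by (intro arc_bound sl_in_face_interval sl_mono)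
  moreover have "tvec \<psi> \<bullet> (i \<psi>' - i \<psi>)
      = tvec \<psi> \<bullet> (x (sl \<psi>') - x (sl \<psi>)) - (sl \<psi>' - s0) * c + (sl \<psi> - s0)"
    by (simp add: left_involute_def inner_diff_right frame_inner c_def cos_diff algebra_simps)
  moreover have "(sl \<psi> - s0) * (1 - c) \<ge> 0" using s by (simp add: c_def)
  moreover have "(sl \<psi>' - sl \<psi>) * c - (sl \<psi>' - s0) * c + (sl \<psi> - s0) = (sl \<psi> - s0) * (1 - c)"
    by (simp add: left_diff_distrib right_diff_distrib)
  ultimately show ?thesis by linarith
qed


text \<open>The difference of \<open>tvec \<theta> \<bullet> i \<theta>\<close> between \<open>u\<close> and \<open>v\<close> splits into \<open>(tvec v - tvec u) \<bullet> X'\<close>, where \<open>X'\<close> lies on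
  the face of \<open>v\<close>, and the defect of the arc length against its projection to \<open>tvec u\<close>.  The first part is
  \<open>- (v - u) h u\<close> up to second order because \<open>X'\<close> is close to the support line of \<open>u\<close>, and the second part
  is of second order by \<open>arc_bound\<close>.\<close>

lemma i_derivative: "((\<lambda>\<theta>. tvec \<theta> \<bullet> i \<theta>) has_real_derivative - support_fun K \<theta>) (at \<theta>)"
proof -
  let ?h = "support_fun K"
  obtain R where R: "R \<ge> 0" "\<And>y. y \<in> K \<Longrightarrow> norm y \<le> R"
    "\<And>\<theta> \<theta>'. \<bar>?h \<theta> - ?h \<theta>'\<bar> \<le> R * \<bar>\<theta> - \<theta>'\<bar>"
    by (rule support_lipschitz) (rule that)
  define C where "C = 4 * R + L"
  show ?thesis
  proof (rule two_sided_derivative[where C = C and g = "\<lambda>\<theta>. - ?h \<theta>"])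
    show "C \<ge> 0" using R(1) L_pos by (simp add: C_def)
    show "\<bar>- ?h u - - ?h v\<bar> \<le> C * \<bar>u - v\<bar>" for u v
    proof -
      have "R * \<bar>u - v\<bar> \<le> C * \<bar>u - v\<bar>" using R(1) L_pos by (intro mult_right_mono) (auto simp: C_def)
      then show ?thesis using R(3)[of u v] by linarith
    qed
    fix u v :: real assume uv: "u \<le> v" "v \<le> u + 1"
    define \<delta> where "\<delta> = v - u"
    have d: "0 \<le> \<delta>" "\<delta> \<le> 1" "v = u + \<delta>" using uv by (auto simp: \<delta>_def)
    have pi3: "pi > 3" by (rule pi_gt3)
    define X X' where "X = x (sl u)" and "X' = x (sl v)"
    have X': "X' \<in> K" "nvec v \<bullet> X' = ?h v" using faceD[OF x_face[OF sl_in_face_interval]] by (auto simp: X'_def)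
    have sL: "sl v - sl u \<le> L" "sl u \<le> sl v"
      using sl_mono[of v "u + 2 * pi"] sl_period[of u] uv pi3 sl_mono[of u v] by auto
    have c1: "1 - cos \<delta> \<le> \<delta>\<^sup>2 / 2" "cos \<delta> \<le> 1"
      using one_minus_cos_le[of \<delta>] by auto
    have 1: "(sl v - sl u) * cos \<delta> \<le> tvec u \<bullet> (X' - X)"
      unfolding X_def X'_def \<delta>_def using uv pi3 by (intro arc_bound sl_in_face_interval sL(2)) auto
    have 2: "(sl v - sl u) * (1 - cos \<delta>) \<le> L * (\<delta>\<^sup>2 / 2)"
      using sL c1 L_pos by (intro mult_mono) auto
    have lo: "tvec u \<bullet> (X' - X) - (sl v - sl u) \<ge> - (L * \<delta>\<^sup>2)"
    proof -
      have "(sl v - sl u) * (1 - cos \<delta>) = (sl v - sl u) - (sl v - sl u) * cos \<delta>" by (simp only: right_diff_distrib mult_1_right)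
      moreover have "L * (\<delta>\<^sup>2 / 2) = L * \<delta>\<^sup>2 / 2" "0 \<le> L * \<delta>\<^sup>2" using L_pos by auto
      ultimately show ?thesis using 1 2 by linarith
    qed
    have hi: "tvec u \<bullet> (X' - X) - (sl v - sl u) \<le> 0"
      using chord_inner_le[OF sL(2), of u] by (simp add: X_def X'_def)
    have tv: "tvec v = cos \<delta> *\<^sub>R tvec u - sin \<delta> *\<^sub>R nvec u" and nv: "nvec v = cos \<delta> *\<^sub>R nvec u + sin \<delta> *\<^sub>R tvec u"
      using tvec_add[of u \<delta>] nvec_add[of u \<delta>] d by auto
    have bn: "\<bar>nvec u \<bullet> X'\<bar> \<le> R" and bt: "\<bar>tvec u \<bullet> X'\<bar> \<le> R"
      using Cauchy_Schwarz_ineq2[of "nvec u" X'] Cauchy_Schwarz_ineq2[of "tvec u" X'] R(2)[OF X'(1)] by auto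
    have sd: "0 \<le> sin \<delta>" "sin \<delta> \<le> \<delta>" "0 \<le> cos \<delta>" "\<delta> - sin \<delta> \<le> \<delta>\<^sup>2"
      using d pi3 sin_x_le_x[of \<delta>] minus_sin_le[of \<delta>] by (auto intro!: sin_ge_zero cos_ge_zero)
    have e1: "tvec v \<bullet> i v - tvec u \<bullet> i u - (v - u) * (- ?h u)
        = (tvec u \<bullet> (X' - X) - (sl v - sl u)) + (tvec v - tvec u) \<bullet> X' + \<delta> * ?h u"
      by (simp add: tvec_i X_def X'_def inner_diff_right inner_diff_left \<delta>_def algebra_simps)
    have e2: "(tvec v - tvec u) \<bullet> X' + \<delta> * ?h u
       = (cos \<delta> - 1) * (tvec u \<bullet> X') + (\<delta> - sin \<delta>) * (nvec u \<bullet> X') + \<delta> * (?h u - nvec u \<bullet> X')"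
      by (simp add: tv inner_diff_left algebra_simps)
    have eq: "tvec v \<bullet> i v - tvec u \<bullet> i u - (v - u) * (- ?h u)
      = (tvec u \<bullet> (X' - X) - (sl v - sl u)) + ((cos \<delta> - 1) * (tvec u \<bullet> X')
         + (\<delta> - sin \<delta>) * (nvec u \<bullet> X') + \<delta> * (?h u - nvec u \<bullet> X'))"
      using e1 e2 by linarith
    have t1: "\<bar>(cos \<delta> - 1) * (tvec u \<bullet> X')\<bar> \<le> \<delta>\<^sup>2 / 2 * R"
      unfolding abs_mult using c1 bt by (intro mult_mono) auto
    have t2: "\<bar>(\<delta> - sin \<delta>) * (nvec u \<bullet> X')\<bar> \<le> \<delta>\<^sup>2 * R"
      unfolding abs_mult using sd bn by (intro mult_mono) auto
    have "?h u - nvec u \<bullet> X' = (?h u - ?h v) + (cos \<delta> - 1) * (nvec u \<bullet> X') + sin \<delta> * (tvec u \<bullet> X')"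
      using X'(2) by (simp add: nv inner_add_left algebra_simps)
    moreover have "\<bar>(cos \<delta> - 1) * (nvec u \<bullet> X')\<bar> \<le> \<delta> / 2 * R"
    proof -
      have "\<delta>\<^sup>2 \<le> \<delta>" using d by (simp add: power2_eq_square mult_left_le)
      then show ?thesis unfolding abs_mult using c1 bn d(1) by (intro mult_mono) auto
    qed
    moreover have "\<bar>sin \<delta> * (tvec u \<bullet> X')\<bar> \<le> \<delta> * R"
      unfolding abs_mult using sd bt by (intro mult_mono) auto
    moreover have "\<bar>?h u - ?h v\<bar> \<le> R * \<delta>" using R(3)[of u v] d by simp
    moreover have "5 / 2 * R * \<delta> = R * \<delta> + \<delta> / 2 * R + \<delta> * R" by simp
    ultimately have "\<bar>?h u - nvec u \<bullet> X'\<bar> \<le> 5 / 2 * R * \<delta>" by linarith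
    then have t3: "\<bar>\<delta> * (?h u - nvec u \<bullet> X')\<bar> \<le> \<delta> * (5 / 2 * R * \<delta>)"
      unfolding abs_mult using d by (intro mult_mono) auto
    have "C * \<delta>\<^sup>2 = L * \<delta>\<^sup>2 + \<delta>\<^sup>2 / 2 * R + \<delta>\<^sup>2 * R + \<delta> * (5 / 2 * R * \<delta>)"
      by (simp add: C_def algebra_simps power2_eq_square)
    then show "\<bar>tvec v \<bullet> i v - tvec u \<bullet> i u - (v - u) * (- ?h u)\<bar> \<le> C * (v - u)\<^sup>2"
      unfolding eq unfolding \<delta>_def[symmetric] using lo hi t1 t2 t3 by linarith
  qed
qed


lemma involute_unrolling: "unrolling K L (x s0) i \<theta>0 \<tau>"
proof
  show "\<exists>X\<in>face K \<psi>. \<exists>\<rho>>0. i \<psi> = X - \<rho> *\<^sub>R tvec \<psi>" if "\<tau> < \<psi>" for \<psi>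
    using theta_plus_props(3)[OF that] x_face[OF sl_in_face_interval, of \<psi>]
    by (intro bexI[of _ "x (sl \<psi>)"] exI[of _ "sl \<psi> - s0"]) (auto simp: left_involute_def)
  have t2: "tvec (\<theta> + 2 * pi) = tvec \<theta>" for \<theta> using tvec_2pi[of \<theta> 1] by simp
  show "tvec (\<theta> + 2 * pi) \<bullet> i (\<theta> + 2 * pi) = tvec \<theta> \<bullet> i \<theta> - L" for \<theta>
    unfolding tvec_i unfolding t2 sl_period x_period by simp
  show "0 < L" by (rule L_pos)
  show "x s0 \<in> face K \<theta>0" by (rule x_face[OF s0_in_face_interval])
  show "i \<theta>0 = x s0" by (rule i_start[OF s0_in_face_interval])
  show "i \<tau> = x s0" by (rule i_start[OF theta_plus_props(2)])
  show "\<theta>0 \<le> \<tau>" by (rule theta_plus_props(1))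
  show "nvec \<theta> \<bullet> i \<theta> = support_fun K \<theta>" for \<theta> by (rule nvec_i)
  show "((\<lambda>\<theta>. tvec \<theta> \<bullet> i \<theta>) has_real_derivative - support_fun K \<theta>) (at \<theta>)" for \<theta>
    by (rule i_derivative)
  show "i \<psi> = x s0" if "i \<psi> \<in> K" for \<psi> using that by (rule i_meets)
  show "0 \<le> tvec \<psi> \<bullet> (i \<psi>' - i \<psi>)" if "\<tau> \<le> \<psi>" "\<psi> \<le> \<psi>'" "\<psi>' \<le> \<psi> + pi / 2" for \<psi> \<psi>'
    using that by (rule i_advance)
qed

end

section \<open>The potential of an involute\<close>

context plane_body
begin

text \<open>A point reached from \<open>X\<close> in \<open>K\<close> by going backwards along \<open>tvec \<psi>\<close> stays below the support lines of the half
  turn that follows \<open>\<psi>\<close>.\<close>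

lemma excess_behind_tangent:
  assumes "X \<in> K" "0 \<le> \<rho>" "\<psi> \<le> \<phi>" "\<phi> \<le> \<psi> + pi"
  shows "excess K \<phi> (X - \<rho> *\<^sub>R tvec \<psi>) \<le> 0"
proof -
  have "0 \<le> \<rho> * sin (\<phi> - \<psi>)" using assms by (intro mult_nonneg_nonneg sin_ge_zero) auto
  then show ?thesis
    using inner_le_support[OF assms(1), of \<phi>] by (simp add: excess_def inner_diff_right frame_inner)
qed

lemma excess_ahead_tangent:
  assumes "X \<in> K" "0 \<le> \<rho>" "\<psi> - pi \<le> \<phi>" "\<phi> \<le> \<psi>"
  shows "excess K \<phi> (X + \<rho> *\<^sub>R tvec \<psi>) \<le> 0"
proof -
  have "0 \<le> \<rho> * sin (\<psi> - \<phi>)" using assms by (intro mult_nonneg_nonneg sin_ge_zero) auto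
  moreover have "sin (\<psi> - \<phi>) = - sin (\<phi> - \<psi>)" by (simp add: sin_diff)
  ultimately show ?thesis
    using inner_le_support[OF assms(1), of \<phi>] by (simp add: excess_def inner_add_right frame_inner)
qed

end

text \<open>The part of the theory that depends only on a primitive of \<open>- h\<close>.  In contrast to \<open>unrolling\<close> it is
  invariant under reflection without further data.\<close>

locale support_potential = plane_body K for K +
  fixes a :: "real \<Rightarrow> real"
  assumes potential: "(a has_real_derivative - support_fun K \<theta>) (at \<theta>)"
begin

text \<open>With \<open>a \<theta> = tvec \<theta> \<bullet> i \<theta>\<close> this is \<open>tvec \<theta> \<bullet> (i \<theta> - p)\<close>.  If \<open>\<theta>\<close> is the last direction visible from \<open>p\<close>, it is the
  length of the string from \<open>p\<close> to its point of contact, minus the arc length from \<open>x0\<close> to there.\<close>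

definition \<Phi> :: "real \<Rightarrow> complex \<Rightarrow> real" where "\<Phi> \<theta> p = a \<theta> - tvec \<theta> \<bullet> p"

lemma \<Phi>_derivative: "((\<lambda>\<theta>. \<Phi> \<theta> p) has_real_derivative excess K \<theta> p) (at \<theta>)"
proof -
  have "((\<lambda>\<theta>. a \<theta> - tvec \<theta> \<bullet> p) has_real_derivative (- support_fun K \<theta> - - (nvec \<theta> \<bullet> p))) (at \<theta>)"
    by (intro DERIV_diff potential has_derivative_frame)
  then show ?thesis by (simp add: \<Phi>_def excess_def)
qed

lemma continuous_\<Phi>: "continuous_on S (\<lambda>\<theta>. \<Phi> \<theta> p)"
  by (intro continuous_at_imp_continuous_on ballI DERIV_isCont[OF \<Phi>_derivative])

lemma \<Phi>_point: "\<Phi> \<theta> q = \<Phi> \<theta> p + tvec \<theta> \<bullet> (p - q)"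
  by (simp add: \<Phi>_def inner_diff_right)

lemma \<Phi>_point_dist: "\<bar>\<Phi> \<theta> p - \<Phi> \<theta> q\<bar> \<le> dist p q"
proof -
  have "\<bar>tvec \<theta> \<bullet> (q - p)\<bar> \<le> norm (tvec \<theta>) * norm (q - p)" by (rule Cauchy_Schwarz_ineq2)
  then show ?thesis using \<Phi>_point[of \<theta> p q] by (simp add: dist_norm norm_minus_commute)
qed

lemma \<Phi>_convex_combination: "\<Phi> \<theta> (t *\<^sub>R p + (1 - t) *\<^sub>R q) = t * \<Phi> \<theta> p + (1 - t) * \<Phi> \<theta> q"
  by (simp add: \<Phi>_def inner_add_right inner_diff_right algebra_simps)

lemma \<Phi>_mono:
  assumes "\<alpha> \<le> \<beta>" "\<And>\<phi>. \<alpha> \<le> \<phi> \<Longrightarrow> \<phi> \<le> \<beta> \<Longrightarrow> excess K \<phi> p \<ge> 0"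
  shows "\<Phi> \<alpha> p \<le> \<Phi> \<beta> p"
  using assms \<Phi>_derivative by (intro DERIV_nonneg_imp_nondecreasing[OF assms(1)]) blast

lemma \<Phi>_antimono:
  assumes "\<alpha> \<le> \<beta>" "\<And>\<phi>. \<alpha> \<le> \<phi> \<Longrightarrow> \<phi> \<le> \<beta> \<Longrightarrow> excess K \<phi> p \<le> 0"
  shows "\<Phi> \<beta> p \<le> \<Phi> \<alpha> p"
  using assms \<Phi>_derivative by (intro DERIV_nonpos_imp_nonincreasing[OF assms(1)]) blast

lemma \<Phi>_strict_mono:
  assumes "\<alpha> < \<beta>" "\<And>\<phi>. \<alpha> < \<phi> \<Longrightarrow> \<phi> < \<beta> \<Longrightarrow> excess K \<phi> p > 0"
  shows "\<Phi> \<alpha> p < \<Phi> \<beta> p"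
proof (rule DERIV_pos_imp_increasing_open[OF assms(1)])
  show "\<exists>y. ((\<lambda>\<theta>. \<Phi> \<theta> p) has_real_derivative y) (at \<phi>) \<and> 0 < y" if "\<alpha> < \<phi>" "\<phi> < \<beta>" for \<phi>
    using \<Phi>_derivative assms(2)[OF that] by blast
qed (rule continuous_\<Phi>)

end

sublocale unrolling \<subseteq> support_potential K "\<lambda>\<theta>. tvec \<theta> \<bullet> i \<theta>"
  by unfold_locales (rule derivative)

context unrolling
begin

lemma \<Phi>_period: "\<Phi> (\<theta> + of_int k * (2 * pi)) p = \<Phi> \<theta> p - of_int k * L"
proof -
  have step: "\<Phi> (\<theta> + 2 * pi) p = \<Phi> \<theta> p - L" for \<theta>
    using period[of \<theta>] tvec_2pi[of \<theta> 1] by (simp add: \<Phi>_def)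
  have nat: "\<Phi> (\<theta> + of_nat n * (2 * pi)) p = \<Phi> \<theta> p - of_nat n * L" for \<theta> n
  proof (induction n)
    case (Suc n)
    have eq: "\<theta> + of_nat (Suc n) * (2 * pi) = \<theta> + of_nat n * (2 * pi) + 2 * pi" by (simp add: distrib_right)
    show ?case unfolding eq step Suc by (simp add: distrib_right)
  qed simp
  show ?thesis
  proof (cases "k \<ge> 0")
    case True
    then show ?thesis using nat[of \<theta> "nat k"] by simp
  next
    case False
    then have "real (nat (- k)) = - of_int k" by simp
    then show ?thesis using nat[of "\<theta> + of_int k * (2 * pi)" "nat (- k)"] by simp
  qed
qed

lemma x0_in: "x0 \<in> K" using start faceD by blast

lemma \<Phi>_i [simp]: "\<Phi> \<psi> (i \<psi>) = 0" by (simp add: \<Phi>_def)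

lemma excess_i [simp]: "excess K \<psi> (i \<psi>) = 0" by (simp add: excess_def inner_nvec)

lemma \<Phi>_x0_antimono: "\<alpha> \<le> \<beta> \<Longrightarrow> \<Phi> \<beta> x0 \<le> \<Phi> \<alpha> x0"
  using excess_nonpos[OF x0_in] by (intro \<Phi>_antimono) auto

lemma \<Phi>_x0_\<tau>: "\<Phi> \<tau> x0 = 0" "excess K \<tau> x0 = 0"
  using \<Phi>_i[of \<tau>] excess_i[of \<tau>] leave by simp_all

lemma excess_after:
  assumes "\<tau> \<le> \<psi>" "\<psi> \<le> \<phi>" "\<phi> \<le> \<psi> + pi"
  shows "excess K \<phi> (i \<psi>) \<le> 0"
proof (cases "\<psi> = \<tau>")
  case True then show ?thesis using leave excess_nonpos[OF x0_in] by simp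
next
  case False
  then obtain X \<rho> where "X \<in> face K \<psi>" "\<rho> > 0" "i \<psi> = X - \<rho> *\<^sub>R tvec \<psi>"
    using tangent[of \<psi>] assms by auto
  then show ?thesis using assms excess_behind_tangent[of X \<rho>] faceD by auto
qed

text \<open>The directions visible from \<open>i \<psi>\<close> end at \<open>\<psi>\<close>, where the line of sight is the unrolled string.\<close>

lemma visible_before:
  assumes "\<tau> \<le> \<psi>" "excess K \<theta> (i \<psi>) > 0"
  obtains k :: int where "\<psi> - pi < \<theta> + of_int k * (2 * pi)" "\<theta> + of_int k * (2 * pi) < \<psi>"
    "excess K (\<theta> + of_int k * (2 * pi)) (i \<psi>) > 0"
proof -
  obtain k where k: "\<psi> - pi < \<theta> + of_int k * (2 * pi)" "\<theta> + of_int k * (2 * pi) \<le> \<psi> - pi + 2 * pi"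
    by (rule reduce_mod_2pi)
  have e: "excess K (\<theta> + of_int k * (2 * pi)) (i \<psi>) > 0" using assms(2) excess_2pi by metis
  then have "\<theta> + of_int k * (2 * pi) < \<psi>"
    using excess_after[OF assms(1), of "\<theta> + of_int k * (2 * pi)"] k by fastforce
  then show thesis using that k(1) e by blast
qed

lemma excess_pos_until:
  assumes "\<psi> - pi < \<theta>" "\<theta> \<le> \<phi>" "\<phi> < \<psi>" "excess K \<theta> (i \<psi>) > 0"
  shows "excess K \<phi> (i \<psi>) > 0"
  using excess_pos_between[of \<theta> "i \<psi>" \<psi> \<phi>] assms by (cases "\<theta> = \<phi>") auto

lemma \<Phi>_neg_visible:
  assumes "\<psi> - pi < \<theta>" "\<theta> < \<psi>" "excess K \<theta> (i \<psi>) > 0"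
  shows "\<Phi> \<theta> (i \<psi>) < 0"
proof -
  have "\<Phi> \<theta> (i \<psi>) < \<Phi> \<psi> (i \<psi>)"
    by (rule \<Phi>_strict_mono[OF assms(2)], rule excess_pos_until[of _ \<theta>]) (use assms in auto)
  then show ?thesis by simp
qed

text \<open>By \<open>advance\<close> the displacement \<open>v\<close> does not point backwards along \<open>tvec \<psi>\<close>, and it does not point forward
  along \<open>tvec \<psi>'\<close> because \<open>i \<psi>\<close> is below the support lines between \<open>\<psi>\<close> and \<open>\<psi>'\<close>.  So it has the direction
  of a normal between \<open>nvec \<psi>\<close> and \<open>nvec \<psi>'\<close>, as expected from \<open>i' = (sl - s0) nvec\<close>.\<close>

lemma \<Phi>_advance_step:
  assumes "\<tau> \<le> \<psi>" "\<psi> \<le> \<psi>'" "\<psi>' \<le> \<psi> + pi / 2" "\<theta> \<le> \<psi>" "\<psi>' \<le> \<theta> + pi"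
  shows "tvec \<theta> \<bullet> (i \<psi>' - i \<psi>) \<ge> 0"
proof (cases "\<psi> = \<psi>'")
  case False
  define v where "v = i \<psi>' - i \<psi>"
  have "\<Phi> \<psi>' (i \<psi>) \<le> \<Phi> \<psi> (i \<psi>)"
    using assms(1-3) excess_after by (intro \<Phi>_antimono) auto
  then have v': "tvec \<psi>' \<bullet> v \<le> 0" by (simp add: \<Phi>_def v_def inner_diff_right)
  have v: "tvec \<psi> \<bullet> v \<ge> 0" using advance[OF assms(1-3)] by (simp add: v_def)
  have "sin (\<psi>' - \<psi>) * (tvec \<theta> \<bullet> v) = sin (\<psi>' - \<theta>) * (tvec \<psi> \<bullet> v) + sin (\<theta> - \<psi>) * (tvec \<psi>' \<bullet> v)"
    using arg_cong[OF tvec_between[of \<psi>' \<psi> \<theta>], of "\<lambda>u. u \<bullet> v"] by (simp add: inner_add_left)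
  moreover have "sin (\<psi>' - \<theta>) * (tvec \<psi> \<bullet> v) \<ge> 0"
    using assms v by (intro mult_nonneg_nonneg sin_ge_zero) auto
  moreover have "sin (\<theta> - \<psi>) * (tvec \<psi>' \<bullet> v) \<ge> 0"
  proof (rule mult_nonpos_nonpos[OF _ v'])
    have "sin (\<psi> - \<theta>) \<ge> 0" using assms by (intro sin_ge_zero) auto
    then show "sin (\<theta> - \<psi>) \<le> 0" by (metis minus_diff_eq neg_le_0_iff_le sin_minus)
  qed
  ultimately have "0 \<le> sin (\<psi>' - \<psi>) * (tvec \<theta> \<bullet> v)" by simp
  moreover have "sin (\<psi>' - \<psi>) > 0" using assms False by (intro sin_gt_zero) auto
  ultimately show ?thesis by (simp add: v_def zero_le_mult_iff)
qed simp

lemma \<Phi>_advance: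
  assumes "\<tau> \<le> \<psi>" "\<psi> \<le> \<psi>'" "\<theta> \<le> \<psi>" "\<psi>' \<le> \<theta> + pi"
  shows "\<Phi> \<theta> (i \<psi>') \<le> \<Phi> \<theta> (i \<psi>)"
proof -
  define m where "m = (\<psi> + \<psi>') / 2"
  have m: "\<psi> \<le> m" "m \<le> \<psi>'" "m \<le> \<psi> + pi / 2" "\<psi>' \<le> m + pi / 2"
    using assms by (simp_all add: m_def field_simps)
  have "tvec \<theta> \<bullet> (i m - i \<psi>) \<ge> 0" "tvec \<theta> \<bullet> (i \<psi>' - i m) \<ge> 0"
    using assms m by (auto intro!: \<Phi>_advance_step)
  then show ?thesis by (simp add: \<Phi>_def inner_diff_right)
qed

text \<open>Here \<open>\<Phi> \<theta> (i (\<theta> + \<pi>))\<close> is a sum of two primitives, and its derivative is minus the width of \<open>K\<close> in the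
  direction \<open>nvec \<theta>\<close>.\<close>

lemma \<Phi>_antipodal_antimono:
  assumes "\<alpha> \<le> \<beta>"
  shows "\<Phi> \<beta> (i (\<beta> + pi)) \<le> \<Phi> \<alpha> (i (\<alpha> + pi))"
proof -
  have eq: "\<Phi> \<theta> (i (\<theta> + pi)) = tvec \<theta> \<bullet> i \<theta> + tvec (\<theta> + pi) \<bullet> i (\<theta> + pi)" for \<theta>
    by (simp add: \<Phi>_def inner_diff_right)
  have "tvec \<beta> \<bullet> i \<beta> + tvec (\<beta> + pi) \<bullet> i (\<beta> + pi) \<le> tvec \<alpha> \<bullet> i \<alpha> + tvec (\<alpha> + pi) \<bullet> i (\<alpha> + pi)"
  proof (rule DERIV_nonpos_imp_nonincreasing[OF assms])
    fix \<theta>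
    have "((\<lambda>\<theta>. tvec (\<theta> + pi) \<bullet> i (\<theta> + pi)) has_real_derivative - support_fun K (\<theta> + pi)) (at \<theta>)"
      using derivative[of "\<theta> + pi"] by (simp add: DERIV_shift)
    from DERIV_add[OF derivative this]
    have "((\<lambda>\<theta>. tvec \<theta> \<bullet> i \<theta> + tvec (\<theta> + pi) \<bullet> i (\<theta> + pi)) has_real_derivative
        - support_fun K \<theta> + - support_fun K (\<theta> + pi)) (at \<theta>)" .
    moreover have "support_fun K \<theta> + support_fun K (\<theta> + pi) \<ge> 0"
      using inner_le_support[OF x0_in, of \<theta>] inner_le_support[OF x0_in, of "\<theta> + pi"] by simp
    ultimately show "\<exists>y. ((\<lambda>\<theta>. tvec \<theta> \<bullet> i \<theta> + tvec (\<theta> + pi) \<bullet> i (\<theta> + pi)) has_real_derivative y) (at \<theta>) \<and> y \<le> 0"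
      by (intro exI conjI) auto
  qed
  then show ?thesis by (simp only: eq)
qed

end

section \<open>Bounds along the arcs of the fence\<close>

lemma support_fun_cnj: "support_fun (cnj ` K) \<theta> = support_fun K (- \<theta>)"
  by (simp add: support_fun_def image_image inner_nvec_cnj)

lemma face_cnj: "face (cnj ` K) \<theta> = cnj ` face K (- \<theta>)"
  by (auto simp: face_def support_fun_cnj inner_nvec_cnj)

lemma excess_cnj: "excess (cnj ` K) \<theta> (cnj p) = excess K (- \<theta>) p"
  by (simp add: excess_def support_fun_cnj inner_nvec_cnj)

text \<open>Both halves of the curve: it leaves \<open>x0\<close> to the left at \<open>\<tau>\<close> and to the right, read backwards, at \<open>\<tau>'\<close>.
  The second half is stated as an unrolling of the reflected body, so that every fact about the left
  half can be transferred.\<close>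

locale two_sided_unrolling = unrolling K L x0 i \<theta>0 \<tau> +
  mirror: unrolling "cnj ` K" L "cnj x0" "\<lambda>\<theta>. cnj (i (- \<theta>))" "- \<theta>0" "- \<tau>'"
  for K L x0 i \<theta>0 \<tau> \<tau>' +
  assumes not_point: "\<nexists>p. K = {p}"
begin

lemma leave': "\<tau>' \<le> \<theta>0" "i \<tau>' = x0"
  using mirror.leave by simp_all

lemma tangent':
  assumes "\<psi> < \<tau>'"
  obtains X \<rho> where "X \<in> face K \<psi>" "\<rho> > 0" "i \<psi> = X + \<rho> *\<^sub>R tvec \<psi>"
proof -
  have "- \<tau>' < - \<psi>" using assms by simp
  from mirror.tangent[OF this]
  obtain X \<rho> where X: "X \<in> face K \<psi>" "\<rho> > 0" "cnj (i \<psi>) = cnj X - \<rho> *\<^sub>R tvec (- \<psi>)"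
    by (auto simp: face_cnj)
  have "i \<psi> = cnj (cnj X - \<rho> *\<^sub>R tvec (- \<psi>))" by (simp flip: X(3))
  then have "i \<psi> = X + \<rho> *\<^sub>R tvec \<psi>" by (simp add: cnj_tvec)
  then show thesis using that X by blast
qed

lemma visible_after:
  assumes "\<psi> < \<tau>'" "excess K \<theta> (i \<psi>) > 0"
  obtains k :: int where "\<psi> + of_int k * (2 * pi) < \<theta>" "\<theta> < \<psi> + of_int k * (2 * pi) + pi"
proof -
  obtain k where k: "\<psi> - pi < \<theta> + of_int k * (2 * pi)" "\<theta> + of_int k * (2 * pi) \<le> \<psi> - pi + 2 * pi"
    by (rule reduce_mod_2pi)
  obtain X \<rho> where X: "X \<in> face K \<psi>" "\<rho> > 0" "i \<psi> = X + \<rho> *\<^sub>R tvec \<psi>"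
    using tangent'[OF assms(1)] by blast
  have e: "excess K (\<theta> + of_int k * (2 * pi)) (i \<psi>) > 0" using assms(2) excess_2pi by metis
  have "\<psi> < \<theta> + of_int k * (2 * pi)"
    using excess_ahead_tangent[OF faceD(1)[OF X(1)], of \<rho> \<psi> "\<theta> + of_int k * (2 * pi)"] X e k by force
  moreover have "\<theta> + of_int k * (2 * pi) \<noteq> \<psi> + pi"
  proof
    assume eq: "\<theta> + of_int k * (2 * pi) = \<psi> + pi"
    have "\<psi> + pi = \<psi> - pi + of_int 1 * (2 * pi)" by simp
    then have "excess K (\<psi> + pi) (i \<psi>) = excess K (\<psi> - pi) (i \<psi>)" by (simp only: excess_2pi)
    moreover have "excess K (\<psi> - pi) (i \<psi>) \<le> 0"
      using excess_ahead_tangent[OF faceD(1)[OF X(1)], of \<rho> \<psi> "\<psi> - pi"] X by simp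
    ultimately show False using e unfolding eq by linarith
  qed
  ultimately show thesis using k by (intro that[of "- k"]) auto
qed

lemma \<Phi>_x0_zero: "\<tau>' \<le> \<phi> \<Longrightarrow> \<phi> \<le> \<tau> \<Longrightarrow> \<Phi> \<phi> x0 = 0"
  using \<Phi>_x0_antimono[of \<tau>' \<phi>] \<Phi>_x0_antimono[of \<phi> \<tau>] \<Phi>_x0_\<tau> \<Phi>_i[of \<tau>'] leave' by simp

lemma excess_x0_zero:
  assumes "\<tau>' < \<phi>" "\<phi> < \<tau>" shows "excess K \<phi> x0 = 0"
proof -
  have "((\<lambda>\<theta>. 0) has_real_derivative excess K \<phi> x0) (at \<phi>)"
    by (rule has_field_derivative_transform_within_open[OF \<Phi>_derivative, of "{\<tau>'<..<\<tau>}"])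
       (use assms \<Phi>_x0_zero in auto)
  then show ?thesis using DERIV_unique DERIV_const by blast
qed

text \<open>Around \<open>\<phi>\<close> all support lines pass through \<open>x0\<close>.  A point of \<open>K\<close> on the middle one is below the
  neighbours on both sides, hence equal to \<open>x0\<close>.\<close>

lemma vertex_face:
  assumes "\<tau>' < \<phi>" "\<phi> < \<tau>" "X \<in> face K \<phi>" shows "X = x0"
proof -
  define \<eta> where "\<eta> = min 1 (min (\<phi> - \<tau>') (\<tau> - \<phi>) / 2)"
  have \<eta>: "0 < \<eta>" "\<tau>' < \<phi> - \<eta>" "\<phi> + \<eta> < \<tau>" "\<eta> < pi"
    using assms pi_gt3 by (auto simp: \<eta>_def min_def field_simps)
  define v where "v = X - x0"
  have le: "nvec \<theta> \<bullet> v \<le> 0" if "\<tau>' < \<theta>" "\<theta> < \<tau>" for \<theta>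
    using inner_le_support[OF faceD(1)[OF assms(3)], of \<theta>] excess_x0_zero[OF that]
    by (simp add: v_def inner_diff_right excess_def)
  have n: "nvec \<phi> \<bullet> v = 0"
    using faceD(2)[OF assms(3)] excess_x0_zero[OF assms(1,2)] by (simp add: v_def inner_diff_right excess_def)
  have "sin \<eta> * (tvec \<phi> \<bullet> v) \<le> 0"
    using le[of "\<phi> + \<eta>"] \<eta> nvec_add[of \<phi> \<eta>] n by (simp add: inner_add_left)
  moreover have "- sin \<eta> * (tvec \<phi> \<bullet> v) \<le> 0"
    using le[of "\<phi> - \<eta>"] \<eta> nvec_add[of \<phi> "- \<eta>"] n by (simp add: inner_diff_left)
  moreover have "sin \<eta> > 0" using \<eta> by (intro sin_gt_zero) auto
  ultimately have "tvec \<phi> \<bullet> v = 0" by (smt (verit) mult_minus_left mult_pos_pos mult_pos_neg)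
  then have "v = 0" using n by (intro frame_eqI[of \<phi>]) auto
  then show ?thesis by (simp add: v_def)
qed

text \<open>Otherwise two opposite directions belong to the interior of the normal cone of \<open>x0\<close>.  Then every
  point of \<open>K\<close> lies on a common support line through \<open>x0\<close>, and is \<open>x0\<close> by \<open>vertex_face\<close>.\<close>

lemma normal_cone_width: "\<tau> - \<tau>' \<le> pi"
proof (rule ccontr)
  assume neg: "\<not> ?thesis"
  define \<phi> where "\<phi> = (\<tau>' + (\<tau> - pi)) / 2"
  have \<phi>: "\<tau>' < \<phi>" "\<phi> + pi < \<tau>" using neg by (auto simp: \<phi>_def field_simps)
  have "y = x0" if "y \<in> K" for y
  proof (rule vertex_face[OF \<phi>(1)])
    have "excess K \<phi> x0 = 0" "excess K (\<phi> + pi) x0 = 0" using \<phi> pi_gt3 by (auto intro!: excess_x0_zero)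
    then have "nvec \<phi> \<bullet> y = support_fun K \<phi>"
      using inner_le_support[OF that, of \<phi>] inner_le_support[OF that, of "\<phi> + pi"] by (simp add: excess_def)
    then show "y \<in> face K \<phi>" using that by (simp add: face_def)
  qed (use \<phi> pi_gt3 in auto)
  then have "K = {x0}" using x0_in by blast
  then show False using not_point by blast
qed

text \<open>At the meeting point \<open>y\<close> the visible arc ends at \<open>\<beta>\<close>, with \<open>\<Phi> \<beta> y = 0\<close>, and begins at a translate
  \<open>\<alpha>' = \<alpha> + 2 \<pi> k\<close> of \<open>\<alpha>\<close>, with \<open>\<Phi> \<alpha>' y = - k L\<close>.  This beginning is the minimum of \<open>\<Phi>\<close> over the half turn in
  question.  If \<open>k\<close> were at least \<open>2\<close>, both \<open>\<alpha>'\<close> and \<open>\<beta>\<close> would lie, up to a full turn, in the interior of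
  the normal cone of \<open>x0\<close>.  Both strings would then end at \<open>x0\<close>, so that \<open>\<alpha>'\<close> and \<open>\<beta>\<close> would be opposite
  directions, which the width of the cone forbids.\<close>

lemma fence_bound:
  assumes \<alpha>: "\<tau>' - 2 * pi < \<alpha>" "\<alpha> \<le> \<tau>'" and \<beta>: "\<tau> \<le> \<beta>" "\<beta> < \<tau> + 2 * pi"
    and meet: "i \<beta> = i \<alpha>" "i \<beta> \<noteq> x0"
    and \<theta>: "\<beta> - pi \<le> \<theta>" "\<theta> \<le> \<beta>"
  shows "- L \<le> \<Phi> \<theta> (i \<beta>)"
proof -
  define y where "y = i \<beta>"
  have y\<alpha>: "y = i \<alpha>" using meet by (simp add: y_def)
  have ne: "\<alpha> < \<tau>'" using \<alpha> meet leave' by (cases "\<alpha> = \<tau>'") auto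
  have ne': "\<tau> < \<beta>" using \<beta> meet leave by (cases "\<tau> = \<beta>") auto
  have "y \<notin> K" using meets_body meet by (auto simp: y_def)
  then obtain \<theta>1 where "excess K \<theta>1 y > 0" by (rule outside_visible)
  then obtain \<theta>v where v: "\<beta> - pi < \<theta>v" "\<theta>v < \<beta>" "excess K \<theta>v y > 0"
    using visible_before[OF \<beta>(1)] unfolding y_def by metis
  obtain k where k: "\<alpha> + of_int k * (2 * pi) < \<theta>v" "\<theta>v < \<alpha> + of_int k * (2 * pi) + pi"
    using visible_after[OF ne] v(3) unfolding y\<alpha> by metis
  define \<alpha>' where "\<alpha>' = \<alpha> + of_int k * (2 * pi)"
  have \<alpha>': "\<alpha>' < \<theta>v" "\<theta>v < \<alpha>' + pi" using k by (auto simp: \<alpha>'_def)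
  have e\<alpha>: "excess K \<alpha>' y = 0" unfolding \<alpha>'_def excess_2pi y\<alpha> by simp
  have e\<beta>: "excess K \<beta> y = 0" by (simp add: y_def)
  have pos: "excess K \<phi> y > 0" if "\<alpha>' < \<phi>" "\<phi> < \<beta>" for \<phi>
  proof (cases \<phi> \<theta>v rule: linorder_cases)
    case less then show ?thesis using excess_pos_between[of \<alpha>' y \<theta>v \<phi>] that v \<alpha>' e\<alpha> by auto
  next
    case equal then show ?thesis using v by simp
  next
    case greater then show ?thesis using excess_pos_between[of \<theta>v y \<beta> \<phi>] that v e\<beta> by auto
  qed
  have \<Phi>\<alpha>: "\<Phi> \<alpha>' y = - of_int k * L" unfolding \<alpha>'_def \<Phi>_period y\<alpha> by simp
  have k1: "k \<le> 1"
  proof (rule ccontr)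
    assume "\<not> k \<le> 1"
    then have "of_int k \<ge> (2::real)" by simp
    then have "of_int k * (2 * pi) \<ge> 2 * (2 * pi)" by (intro mult_right_mono) auto
    then have b: "\<tau>' < \<alpha>' - 2 * pi" "\<beta> - 2 * pi < \<tau>" using \<alpha> \<beta> unfolding \<alpha>'_def by linarith+
    have shift: "face K (\<psi> - 2 * pi) = face K \<psi>" "tvec (\<psi> - 2 * pi) = tvec \<psi>" for \<psi>
      using nvec_2pi[of \<psi> "- 1"] tvec_2pi[of \<psi> "- 1"] by (simp_all add: face_def support_fun_def)
    obtain X \<rho> where X: "X \<in> face K \<beta>" "\<rho> > 0" "y = X - \<rho> *\<^sub>R tvec \<beta>"
      using tangent[OF ne'] by (auto simp: y_def)
    obtain X' \<rho>' where X': "X' \<in> face K \<alpha>" "\<rho>' > 0" "y = X' + \<rho>' *\<^sub>R tvec \<alpha>"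
      using tangent'[OF ne] unfolding y\<alpha> by metis
    have \<alpha>eq: "face K \<alpha> = face K \<alpha>'" "tvec \<alpha> = tvec \<alpha>'"
      by (simp_all only: \<alpha>'_def face_def support_fun_def nvec_2pi tvec_2pi)
    have ord: "\<tau>' < \<beta> - 2 * pi" "\<alpha>' - 2 * pi < \<tau>" using b \<alpha>' v by linarith+
    have "X = x0" by (rule vertex_face[OF ord(1) b(2)]) (simp add: shift X(1))
    moreover have "X' = x0" by (rule vertex_face[OF b(1) ord(2)]) (simp add: shift X'(1) flip: \<alpha>eq)
    ultimately have "\<rho>' *\<^sub>R tvec \<alpha>' = - (\<rho> *\<^sub>R tvec \<beta>)" using X(3) X'(3) by (simp add: \<alpha>eq)
    then have "nvec \<beta> \<bullet> (\<rho>' *\<^sub>R tvec \<alpha>') = nvec \<beta> \<bullet> (- (\<rho> *\<^sub>R tvec \<beta>))" by simp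
    then have "sin (\<beta> - \<alpha>') = 0" using X'(2) by (simp add: frame_inner)
    moreover have "0 < \<beta> - \<alpha>'" "\<beta> - \<alpha>' < pi"
      using \<alpha>' v b normal_cone_width by auto
    ultimately show False using sin_gt_zero[of "\<beta> - \<alpha>'"] by simp
  qed
  have "- L \<le> \<Phi> \<alpha>' y"
    using mult_right_mono[of "of_int k" 1 L] k1 L_pos by (simp add: \<Phi>\<alpha>)
  also have "\<Phi> \<alpha>' y \<le> \<Phi> \<theta> y"
  proof (cases "\<alpha>' \<le> \<theta>")
    case True
    show ?thesis
    proof (rule \<Phi>_mono[OF True])
      fix \<phi> assume "\<alpha>' \<le> \<phi>" "\<phi> \<le> \<theta>"
      then show "0 \<le> excess K \<phi> y"
        using pos[of \<phi>] e\<alpha> e\<beta> \<theta> by (cases "\<phi> = \<alpha>' \<or> \<phi> = \<beta>") (auto intro: less_imp_le)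
    qed
  next
    case False
    show ?thesis
    proof (rule \<Phi>_antimono)
      fix \<phi> assume \<phi>: "\<theta> \<le> \<phi>" "\<phi> \<le> \<alpha>'"
      obtain X' \<rho>' where X': "X' \<in> face K \<alpha>" "\<rho>' > 0" "y = X' + \<rho>' *\<^sub>R tvec \<alpha>"
        using tangent'[OF ne] unfolding y\<alpha> by metis
      have "tvec \<alpha> = tvec \<alpha>'" by (simp only: \<alpha>'_def tvec_2pi)
      then show "excess K \<phi> y \<le> 0"
        using excess_ahead_tangent[OF faceD(1)[OF X'(1)], of \<rho>' \<alpha>' \<phi>] X' \<phi> \<theta> v \<alpha>' by simp
    qed (use False in auto)
  qed
  finally show ?thesis by (simp add: y_def)
qed

text \<open>The bound at the end \<open>\<beta>\<close> of the arc passes to earlier points by \<open>\<Phi>_advance\<close> as long as \<open>\<beta>\<close> is within half a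
  turn of \<open>\<theta>\<close>.  If it is not, advance \<open>\<psi>\<close> to \<open>\<theta> + \<pi>\<close> and then move \<open>\<theta>\<close> and \<open>\<theta> + \<pi>\<close> together until the latter
  is \<open>\<beta>\<close>.\<close>

lemma \<Phi>_left_arc_bound:
  assumes \<alpha>: "\<tau>' - 2 * pi < \<alpha>" "\<alpha> \<le> \<tau>'" and \<beta>: "\<tau> \<le> \<beta>" "\<beta> < \<tau> + 2 * pi"
    and meet: "i \<beta> = i \<alpha>" "i \<beta> \<noteq> x0"
    and \<psi>: "\<tau> \<le> \<psi>" "\<psi> \<le> \<beta>" and \<theta>: "\<psi> - pi \<le> \<theta>" "\<theta> \<le> \<psi>"
  shows "- L \<le> \<Phi> \<theta> (i \<psi>)"
proof (cases "\<beta> \<le> \<theta> + pi")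
  case True
  have "- L \<le> \<Phi> \<theta> (i \<beta>)" using True \<theta> \<psi> by (intro fence_bound[OF \<alpha> \<beta> meet]) auto
  also have "\<dots> \<le> \<Phi> \<theta> (i \<psi>)" using True \<psi> \<theta> by (intro \<Phi>_advance) auto
  finally show ?thesis .
next
  case False
  have "- L \<le> \<Phi> (\<beta> - pi) (i \<beta>)" using pi_gt3 by (intro fence_bound[OF \<alpha> \<beta> meet]) auto
  also have "\<dots> \<le> \<Phi> \<theta> (i (\<theta> + pi))" using \<Phi>_antipodal_antimono[of \<theta> "\<beta> - pi"] False by simp
  also have "\<dots> \<le> \<Phi> \<theta> (i \<psi>)" using \<psi> \<theta> by (intro \<Phi>_advance) auto
  finally show ?thesis .
qed

text \<open>A direction \<open>\<theta>\<close> visible from \<open>q\<close> is visible from \<open>i \<psi>\<close>, hence a translate by \<open>k\<close> turns of a direction in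
  the visible arc of \<open>i \<psi>\<close> that ends at \<open>\<psi>\<close>.  On that arc \<open>\<Phi>\<close> lies in \<open>(- L, 0)\<close>.  So on any other turn the
  values at \<open>x0\<close> and at \<open>i \<psi>\<close> have the same sign.  On the arc itself \<open>x0\<close> may contribute a positive value
  if \<open>\<theta> < \<tau>\<close>; then \<open>\<Phi> \<theta> q\<close> is compared with \<open>\<Phi> \<tau> q\<close>, to which \<open>x0\<close> contributes nothing.\<close>

lemma left_cone_avoids:
  assumes \<alpha>: "\<tau>' - 2 * pi < \<alpha>" "\<alpha> \<le> \<tau>'" and \<beta>: "\<tau> \<le> \<beta>" "\<beta> < \<tau> + 2 * pi"
    and meet: "i \<beta> = i \<alpha>" "i \<beta> \<noteq> x0"
    and q: "q \<in> cone_over_arc x0 i \<tau> \<beta>" and vis: "excess K \<theta> q > 0"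
  shows "\<Phi> \<theta> q \<noteq> 0"
proof -
  obtain t \<psi> where t: "0 \<le> t" "t \<le> 1" and \<psi>: "\<tau> \<le> \<psi>" "\<psi> \<le> \<beta>"
    and q: "q = t *\<^sub>R x0 + (1 - t) *\<^sub>R i \<psi>"
    using q unfolding cone_over_arc_def by blast
  have eq: "excess K \<phi> q = t * excess K \<phi> x0 + (1 - t) * excess K \<phi> (i \<psi>)" for \<phi>
    unfolding q by (rule excess_convex_combination)
  have \<Phi>q: "\<Phi> \<phi> q = t * \<Phi> \<phi> x0 + (1 - t) * \<Phi> \<phi> (i \<psi>)" for \<phi>
    unfolding q by (rule \<Phi>_convex_combination)
  have t_x0: "t * excess K \<phi> x0 \<le> 0" for \<phi>
    using t excess_nonpos[OF x0_in] by (simp add: mult_nonneg_nonpos)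
  have "0 < (1 - t) * excess K \<theta> (i \<psi>)" using eq[of \<theta>] t_x0[of \<theta>] vis by linarith
  then have t1: "0 < 1 - t" and vis_\<psi>: "excess K \<theta> (i \<psi>) > 0" using t by (auto simp: zero_less_mult_iff)
  obtain k where k: "\<psi> - pi < \<theta> + of_int k * (2 * pi)" "\<theta> + of_int k * (2 * pi) < \<psi>"
    "excess K (\<theta> + of_int k * (2 * pi)) (i \<psi>) > 0"
    using visible_before[OF \<psi>(1) vis_\<psi>] by blast
  define \<theta>' where "\<theta>' = \<theta> + of_int k * (2 * pi)"
  have \<Phi>': "\<Phi> \<theta> (i \<psi>) = \<Phi> \<theta>' (i \<psi>) + of_int k * L" by (simp add: \<theta>'_def \<Phi>_period)
  have neg: "\<Phi> \<theta>' (i \<psi>) < 0" using k \<Phi>_neg_visible unfolding \<theta>'_def by blast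
  consider (zero) "k = 0" | (later) "k \<le> -1" | (earlier) "k \<ge> 1" by linarith
  then show ?thesis
  proof cases
    case zero
    then have [simp]: "\<theta>' = \<theta>" by (simp add: \<theta>'_def)
    show ?thesis
    proof (cases "\<tau> \<le> \<theta>")
      case True
      then have "\<Phi> \<theta> x0 \<le> 0" using \<Phi>_x0_antimono[OF True] \<Phi>_x0_\<tau> by simp
      then have "t * \<Phi> \<theta> x0 \<le> 0" "(1 - t) * \<Phi> \<theta> (i \<psi>) < 0"
        using t t1 neg by (auto simp: mult_nonneg_nonpos mult_pos_neg)
      then show ?thesis using \<Phi>q[of \<theta>] by simp
    next
      case False
      have \<tau>b: "\<psi> - pi < \<theta>" "\<theta> < \<psi>" using k zero by auto
      have "excess K \<tau> (i \<psi>) \<ge> 0"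
        using excess_pos_until[of \<psi> \<theta> \<tau>] \<tau>b False \<psi> vis_\<psi> by (cases "\<tau> = \<psi>") auto
      then have "excess K \<tau> q \<ge> 0" using eq[of \<tau>] \<Phi>_x0_\<tau> t1 by simp
      then have "\<Phi> \<theta> q < \<Phi> \<tau> q"
        using False vis \<tau>b \<psi> by (intro \<Phi>_strict_mono excess_pos_between[of \<theta> q \<tau>]) auto
      also have "\<Phi> \<tau> q = (1 - t) * \<Phi> \<tau> (i \<psi>)" using \<Phi>q[of \<tau>] \<Phi>_x0_\<tau> by simp
      also have "\<Phi> \<tau> (i \<psi>) \<le> \<Phi> \<psi> (i \<psi>)"
      proof (rule \<Phi>_mono[OF \<psi>(1)])
        fix \<phi> assume "\<tau> \<le> \<phi>" "\<phi> \<le> \<psi>"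
        then show "0 \<le> excess K \<phi> (i \<psi>)"
          using excess_pos_until[of \<psi> \<theta> \<phi>] \<tau>b False vis_\<psi> by (cases "\<phi> = \<psi>") auto
      qed
      then have "(1 - t) * \<Phi> \<tau> (i \<psi>) \<le> 0" using t1 by (simp add: mult_nonneg_nonpos)
      finally show ?thesis by simp
    qed
  next
    case later
    then have "of_int k \<le> (-1::real)" by simp
    then have "of_int k * (2 * pi) \<le> -1 * (2 * pi)" "of_int k * L \<le> -1 * L"
      using L_pos by (intro mult_right_mono; simp)+
    then have "\<tau> \<le> \<theta>" "\<Phi> \<theta> (i \<psi>) < 0" using k(1) \<psi>(1) neg \<Phi>' L_pos pi_gt3 by linarith+
    then have "t * \<Phi> \<theta> x0 \<le> 0" "(1 - t) * \<Phi> \<theta> (i \<psi>) < 0"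
      using t t1 \<Phi>_x0_antimono[of \<tau> \<theta>] \<Phi>_x0_\<tau> by (auto simp: mult_nonneg_nonpos mult_pos_neg)
    then show ?thesis using \<Phi>q[of \<theta>] by simp
  next
    case earlier
    then have "of_int k \<ge> (1::real)" by simp
    then have k1: "of_int k * (2 * pi) \<ge> 1 * (2 * pi)" "of_int k * L \<ge> 1 * L"
      using L_pos by (intro mult_right_mono; simp)+
    then have "\<theta> \<le> \<tau>" using k(2) \<psi>(2) \<beta>(2) by linarith
    then have x0: "0 \<le> t * \<Phi> \<theta> x0" using t \<Phi>_x0_antimono[of \<theta> \<tau>] \<Phi>_x0_\<tau> by simp
    obtain e where e: "e > 0" "\<And>\<phi>. \<bar>\<phi> - \<theta>'\<bar> < e \<Longrightarrow> excess K \<phi> (i \<psi>) > 0"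
      using excess_near[OF k(3)] unfolding \<theta>'_def by blast
    \<comment> \<open>moving back a little inside the visible arc makes the bound strict\<close>
    define \<theta>'' where "\<theta>'' = max (\<psi> - pi) (\<theta>' - e / 2)"
    have \<theta>'': "\<psi> - pi \<le> \<theta>''" "\<theta>'' < \<theta>'" "\<theta>' < \<psi>" "\<theta>' - e < \<theta>''"
      using k e by (auto simp: \<theta>''_def \<theta>'_def)
    have "- L \<le> \<Phi> \<theta>'' (i \<psi>)" using \<theta>'' by (intro \<Phi>_left_arc_bound[OF \<alpha> \<beta> meet \<psi>]) auto
    also have "\<dots> < \<Phi> \<theta>' (i \<psi>)"
      by (rule \<Phi>_strict_mono[OF \<theta>''(2)], rule e(2)) (use \<theta>'' in auto)
    finally have "0 < (1 - t) * \<Phi> \<theta> (i \<psi>)" using \<Phi>' k1 t1 by simp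
    then show ?thesis using \<Phi>q[of \<theta>] x0 by simp
  qed
qed

end

section \<open>Persistence of levels along expanding displacements\<close>

context support_potential
begin

text \<open>A direction of nonnegative excess is visible or is one of the two ends of the visible arc.\<close>

lemma visible_one_side:
  assumes "p \<notin> K" "excess K \<theta> p \<ge> 0"
  obtains (left) e where "0 < e" "e < pi" "\<And>\<eta>. 0 < \<eta> \<Longrightarrow> \<eta> \<le> e \<Longrightarrow> excess K (\<theta> - \<eta>) p > 0"
    | (right) e where "0 < e" "e < pi" "\<And>\<eta>. 0 < \<eta> \<Longrightarrow> \<eta> \<le> e \<Longrightarrow> excess K (\<theta> + \<eta>) p > 0"
proof -
  obtain \<theta>1 where "excess K \<theta>1 p > 0" using outside_visible[OF assms(1)] by blast
  then obtain v where v: "\<theta> - pi < v" "v \<le> \<theta> + pi" "excess K v p > 0"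
  proof -
    obtain k where "\<theta> - pi < \<theta>1 + of_int k * (2 * pi)" "\<theta>1 + of_int k * (2 * pi) \<le> \<theta> - pi + 2 * pi"
      by (rule reduce_mod_2pi)
    then show thesis
      using that[of "\<theta>1 + of_int k * (2 * pi)"] \<open>excess K \<theta>1 p > 0\<close> by (simp add: excess_2pi)
  qed
  consider "v < \<theta>" | "\<theta> < v" "v < \<theta> + pi" | "v = \<theta>" | "v = \<theta> + pi" using v by linarith
  then show thesis
  proof cases
    case 1
    show thesis
    proof (rule left[of "\<theta> - v"])
      fix \<eta> assume "0 < \<eta>" "\<eta> \<le> \<theta> - v"
      then show "excess K (\<theta> - \<eta>) p > 0"
        using excess_pos_between[of v p \<theta> "\<theta> - \<eta>"] v assms 1 by (cases "\<eta> = \<theta> - v") auto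
    qed (use 1 v in auto)
  next
    case 2
    show thesis
    proof (rule right[of "v - \<theta>"])
      fix \<eta> assume "0 < \<eta>" "\<eta> \<le> v - \<theta>"
      then show "excess K (\<theta> + \<eta>) p > 0"
        using excess_pos_between[of \<theta> p v "\<theta> + \<eta>"] v assms 2 by (cases "\<eta> = v - \<theta>") auto
    qed (use 2 in auto)
  next
    case 3
    then obtain e where e: "e > 0" "\<And>\<phi>. \<bar>\<phi> - \<theta>\<bar> < e \<Longrightarrow> excess K \<phi> p > 0"
      using excess_near v(3) by metis
    show thesis
    proof (rule right[of "min (e / 2) 1"])
      fix \<eta> assume "0 < \<eta>" "\<eta> \<le> min (e / 2) 1"
      then show "excess K (\<theta> + \<eta>) p > 0" using e(1) by (intro e(2)) auto
    qed (use e pi_gt3 in auto)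
  next
    case 4
    obtain y where "y \<in> K" using nonempty by blast
    then have "excess K \<theta> p + excess K (\<theta> + pi) p \<le> 0"
      using inner_le_support[of y \<theta>] inner_le_support[of y "\<theta> + pi"] by (simp add: excess_def)
    then show thesis using v 4 assms by simp
  qed
qed

text \<open>The critical case at the far end of the visible arc, where \<open>\<Phi>\<close> has its largest value and that value
  is the lowest one allowed.  The point \<open>y\<close> of contact lies ahead of \<open>p\<close> on the tangent, and \<open>p'\<close> is not
  closer to \<open>y\<close> than \<open>p\<close>; so \<open>p'\<close> has advanced towards \<open>y\<close> by at most \<open>(C h)\<^sup>2 / (2 c)\<close>, where \<open>c = dist p y\<close>, and
  for small \<open>h\<close> this is less than the tolerance \<open>\<epsilon> h\<close>.  If \<open>\<theta>\<close> is no longer visible from \<open>p'\<close>, it is replaced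
  by the new end of the arc, where \<open>\<Phi>\<close> is even larger.\<close>

lemma level_persists_left:
  assumes \<theta>: "excess K \<theta> p = 0" "\<Phi> \<theta> p = - B"
    and e: "0 < e" "e < pi" "\<And>\<eta>. 0 < \<eta> \<Longrightarrow> \<eta> \<le> e \<Longrightarrow> excess K (\<theta> - \<eta>) p > 0"
    and B: "0 < B" and \<epsilon>: "0 < \<epsilon>" and C: "0 \<le> C"
  obtains \<zeta> where "0 < \<zeta>"
    "\<And>p' h. 0 < h \<Longrightarrow> h < \<zeta> \<Longrightarrow> dist p p' \<le> C * h \<Longrightarrow> (\<And>y. y \<in> K \<Longrightarrow> dist p y \<le> dist p' y) \<Longrightarrow>
       \<exists>\<theta>'. excess K \<theta>' p' \<ge> 0 \<and> \<bar>\<Phi> \<theta>' p'\<bar> \<le> B + \<epsilon> * h"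
proof -
  obtain y where y: "y \<in> face K \<theta>" by (rule face_nonempty)
  define c where "c = tvec \<theta> \<bullet> (y - p)"
  have ny: "nvec \<theta> \<bullet> (y - p) = 0" using faceD(2)[OF y] \<theta>(1) by (simp add: excess_def inner_diff_right)
  have yp: "y - p = c *\<^sub>R tvec \<theta>" using frame_decomposition[of "y - p" \<theta>] by (simp add: ny c_def)
  have c: "c > 0"
  proof -
    have "nvec (\<theta> + - e) \<bullet> (y - p) < 0"
      using e(3)[of e] e(1) inner_le_support[OF faceD(1)[OF y], of "\<theta> - e"]
      by (simp add: excess_def inner_diff_right)
    then have "0 < sin e * c" unfolding nvec_add by (simp add: inner_diff_left ny c_def)
    then show ?thesis using sin_gt_zero[of e] e by (simp add: zero_less_mult_iff)
  qed
  define m where "m = excess K (\<theta> - e) p"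
  have m: "m > 0" using e(3)[of e] e(1) by (simp add: m_def)
  \<comment> \<open>the three bounds keep \<open>\<theta> - e\<close> visible, keep the values of \<open>\<Phi>\<close> below \<open>B\<close>, and absorb the quadratic loss\<close>
  define \<zeta> where "\<zeta> = min (min (m / (C + 1)) (B / (C + 1))) (2 * c * \<epsilon> / (C\<^sup>2 + 1))"
  have \<zeta>: "\<zeta> > 0" using m B c \<epsilon> C by (auto simp: \<zeta>_def intro!: divide_pos_pos add_nonneg_pos)
  show thesis
  proof (rule that[OF \<zeta>])
    fix p' h assume h: "0 < h" "h < \<zeta>" and d: "dist p p' \<le> C * h"
      and K: "\<And>y. y \<in> K \<Longrightarrow> dist p y \<le> dist p' y"
    have hC: "C * h < m" "C * h < B" "h * (C\<^sup>2 + 1) < 2 * c * \<epsilon>"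
    proof -
      have "h * (C + 1) < m" "h * (C + 1) < B" "h * (C\<^sup>2 + 1) < 2 * c * \<epsilon>"
        using h C by (auto simp: \<zeta>_def pos_less_divide_eq add_nonneg_pos)
      then show "C * h < m" "C * h < B" "h * (C\<^sup>2 + 1) < 2 * c * \<epsilon>" using h by (auto simp: algebra_simps)
    qed
    define v where "v = p' - p"
    have nv: "norm v \<le> C * h" using d by (simp add: v_def dist_norm norm_minus_commute)
    have "(dist p y)\<^sup>2 \<le> (dist p' y)\<^sup>2" using K[OF faceD(1)[OF y]] by (intro power_mono) auto
    moreover have "(dist p' y)\<^sup>2 = (dist p y)\<^sup>2 + (norm v)\<^sup>2 - 2 * c * (tvec \<theta> \<bullet> v)"
    proof -
      have "p' - y = v - c *\<^sub>R tvec \<theta>" unfolding yp[symmetric] v_def by simp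
      moreover have "p - y = - (c *\<^sub>R tvec \<theta>)" unfolding yp[symmetric] by simp
      ultimately show ?thesis
        unfolding dist_norm power2_norm_eq_inner
        by (simp add: inner_diff_left inner_diff_right inner_commute)
    qed
    ultimately have "2 * c * (tvec \<theta> \<bullet> v) \<le> (norm v)\<^sup>2" by simp
    also have "\<dots> \<le> (C * h)\<^sup>2" using nv by (intro power_mono) auto
    also have "\<dots> \<le> 2 * c * (\<epsilon> * h)"
    proof -
      have "h * C\<^sup>2 \<le> 2 * c * \<epsilon>" using hC(3) h by (simp add: algebra_simps)
      then have "h * (h * C\<^sup>2) \<le> h * (2 * c * \<epsilon>)" using h by (intro mult_left_mono) auto
      then show ?thesis by (simp add: power_mult_distrib power2_eq_square mult_ac)
    qed
    finally have tv: "tvec \<theta> \<bullet> v \<le> \<epsilon> * h" using c by simp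
    have low: "\<Phi> \<theta> p' \<ge> - (B + \<epsilon> * h)"
      using tv \<Phi>_point[of \<theta> p' p] \<theta>(2) by (simp add: v_def inner_diff_right)
    have near: "\<bar>\<Phi> \<phi> p' - \<Phi> \<phi> p\<bar> \<le> C * h" "\<bar>excess K \<phi> p' - excess K \<phi> p\<bar> \<le> C * h" for \<phi>
      using \<Phi>_point_dist[of \<phi> p' p] excess_point_dist[of \<phi> p' p] d by (auto simp: dist_commute)
    have \<epsilon>h: "0 < \<epsilon> * h" using \<epsilon> h by simp
    show "\<exists>\<theta>'. excess K \<theta>' p' \<ge> 0 \<and> \<bar>\<Phi> \<theta>' p'\<bar> \<le> B + \<epsilon> * h"
    proof (cases "excess K \<theta> p' \<ge> 0")
      case True
      moreover have "\<Phi> \<theta> p' \<le> B + \<epsilon> * h" using near(1)[of \<theta>] \<theta>(2) hC B \<epsilon>h by linarith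
      ultimately show ?thesis using low by (intro exI[of _ \<theta>]) auto
    next
      case False
      have "excess K (\<theta> - e) p' > 0" using near(2)[of "\<theta> - e"] hC(1) by (simp add: m_def)
      then obtain \<theta>' where \<theta>': "\<theta> - e \<le> \<theta>'" "\<theta>' \<le> \<theta>" "excess K \<theta>' p' = 0"
        using IVT2'[of "\<lambda>\<phi>. excess K \<phi> p'" \<theta> 0 "\<theta> - e"] False e(1) continuous_excess by auto
      have ne: "\<theta> - e < \<theta>'" using \<theta>' \<open>excess K (\<theta> - e) p' > 0\<close> by (cases "\<theta>' = \<theta> - e") auto
      have "\<Phi> \<theta> p' \<le> \<Phi> \<theta>' p'"
      proof (rule \<Phi>_antimono[OF \<theta>'(2)])
        fix \<phi> assume \<phi>: "\<theta>' \<le> \<phi>" "\<phi> \<le> \<theta>"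
        show "excess K \<phi> p' \<le> 0"
        proof (rule ccontr)
          assume pos: "\<not> excess K \<phi> p' \<le> 0"
          then have "\<theta>' < \<phi>" using \<phi> \<theta>' by (cases "\<theta>' = \<phi>") auto
          then have "excess K \<theta>' p' > 0"
            using excess_pos_between[of "\<theta> - e" p' \<phi> \<theta>'] pos \<open>excess K (\<theta> - e) p' > 0\<close> ne \<phi> e by auto
          then show False using \<theta>' by simp
        qed
      qed
      moreover have "\<Phi> \<theta>' p' \<le> B + \<epsilon> * h"
      proof -
        have "\<Phi> \<theta>' p \<le> \<Phi> \<theta> p"
        proof (rule \<Phi>_mono[OF \<theta>'(2)])
          fix \<phi> assume "\<theta>' \<le> \<phi>" "\<phi> \<le> \<theta>"
          then show "0 \<le> excess K \<phi> p" using e(3)[of "\<theta> - \<phi>"] \<theta>(1) \<theta>'(1) by (cases "\<phi> = \<theta>") auto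
        qed
        then show ?thesis using near(1)[of \<theta>'] \<theta>(2) hC(2) B \<epsilon>h by linarith
      qed
      ultimately show ?thesis using low \<theta>'(3) by (intro exI[of _ \<theta>']) auto
    qed
  qed
qed

lemma mirror_potential: "support_potential (cnj ` K) (\<lambda>\<theta>. - a (- \<theta>))"
proof
  show "compact (cnj ` K)" by (intro compact_continuous_image compact continuous_intros)
  show "cnj ` K \<noteq> {}" using nonempty by simp
  show "convex (cnj ` K)"
    by (intro convex_linear_image convex linear_cnj)
  show "((\<lambda>\<theta>. - a (- \<theta>)) has_real_derivative - support_fun (cnj ` K) \<theta>) (at \<theta>)" for \<theta>
    unfolding support_fun_cnj
    by (rule derivative_eq_intros DERIV_chain2[where f = a, OF potential] refl | simp)+
qed

lemma level_persists_right:
  assumes \<theta>: "excess K \<theta> p = 0" "\<Phi> \<theta> p = B"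
    and e: "0 < e" "e < pi" "\<And>\<eta>. 0 < \<eta> \<Longrightarrow> \<eta> \<le> e \<Longrightarrow> excess K (\<theta> + \<eta>) p > 0"
    and B: "0 < B" and \<epsilon>: "0 < \<epsilon>" and C: "0 \<le> C"
  obtains \<zeta> where "0 < \<zeta>"
    "\<And>p' h. 0 < h \<Longrightarrow> h < \<zeta> \<Longrightarrow> dist p p' \<le> C * h \<Longrightarrow> (\<And>y. y \<in> K \<Longrightarrow> dist p y \<le> dist p' y) \<Longrightarrow>
       \<exists>\<theta>'. excess K \<theta>' p' \<ge> 0 \<and> \<bar>\<Phi> \<theta>' p'\<bar> \<le> B + \<epsilon> * h"
proof -
  interpret m: support_potential "cnj ` K" "\<lambda>\<theta>. - a (- \<theta>)" by (rule mirror_potential)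
  have \<Phi>m: "m.\<Phi> \<theta> (cnj q) = - \<Phi> (- \<theta>) q" for \<theta> q
    by (simp add: m.\<Phi>_def \<Phi>_def inner_tvec_cnj)
  have cd: "dist (cnj u) (cnj v) = dist u v" for u v
    by (metis complex_cnj_diff complex_mod_cnj dist_norm)
  obtain \<zeta> where \<zeta>: "0 < \<zeta>"
    "\<And>p' h. 0 < h \<Longrightarrow> h < \<zeta> \<Longrightarrow> dist (cnj p) p' \<le> C * h \<Longrightarrow>
       (\<And>y. y \<in> cnj ` K \<Longrightarrow> dist (cnj p) y \<le> dist p' y) \<Longrightarrow>
       \<exists>\<theta>'. excess (cnj ` K) \<theta>' p' \<ge> 0 \<and> \<bar>m.\<Phi> \<theta>' p'\<bar> \<le> B + \<epsilon> * h"
  proof (rule m.level_persists_left[of "- \<theta>" "cnj p" B e \<epsilon> C])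
    show "excess (cnj ` K) (- \<theta>) (cnj p) = 0" "m.\<Phi> (- \<theta>) (cnj p) = - B"
      using \<theta> by (simp_all add: excess_cnj \<Phi>m)
    show "0 < excess (cnj ` K) (- \<theta> - \<eta>) (cnj p)" if "0 < \<eta>" "\<eta> \<le> e" for \<eta>
      using e(3)[OF that] by (simp add: excess_cnj add.commute)
  qed (use e B \<epsilon> C in blast)+
  show thesis
  proof (rule that[OF \<zeta>(1)])
    fix p' h assume h: "0 < h" "h < \<zeta>" "dist p p' \<le> C * h" "\<And>y. y \<in> K \<Longrightarrow> dist p y \<le> dist p' y"
    have "\<exists>\<theta>'. excess (cnj ` K) \<theta>' (cnj p') \<ge> 0 \<and> \<bar>m.\<Phi> \<theta>' (cnj p')\<bar> \<le> B + \<epsilon> * h"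
      by (rule \<zeta>(2)[OF h(1,2)]) (use h(3,4) in \<open>auto simp: cd\<close>)
    then show "\<exists>\<theta>'. excess K \<theta>' p' \<ge> 0 \<and> \<bar>\<Phi> \<theta>' p'\<bar> \<le> B + \<epsilon> * h"
      unfolding excess_cnj \<Phi>m by (metis abs_minus_cancel)
  qed
qed

lemma level_persists_strict:
  assumes "excess K \<theta> p > 0" "\<bar>\<Phi> \<theta> p\<bar> < B" "0 < \<epsilon>" "0 \<le> C"
  obtains \<zeta> where "0 < \<zeta>"
    "\<And>p' h. 0 < h \<Longrightarrow> h < \<zeta> \<Longrightarrow> dist p p' \<le> C * h \<Longrightarrow>
       \<exists>\<theta>'. excess K \<theta>' p' \<ge> 0 \<and> \<bar>\<Phi> \<theta>' p'\<bar> \<le> B + \<epsilon> * h"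
proof -
  define m where "m = min (excess K \<theta> p) (B - \<bar>\<Phi> \<theta> p\<bar>)"
  have m: "m > 0" using assms by (simp add: m_def)
  show thesis
  proof (rule that[of "m / (C + 1)"])
    show "0 < m / (C + 1)" using m assms by simp
    fix p' h assume h: "0 < h" "h < m / (C + 1)" "dist p p' \<le> C * h"
    have "h * (C + 1) < m" using h assms by (simp add: pos_less_divide_eq)
    then have "C * h < m" using h by (simp add: algebra_simps)
    then have "dist p' p < excess K \<theta> p" "dist p' p < B - \<bar>\<Phi> \<theta> p\<bar>"
      using h by (auto simp: m_def dist_commute)
    moreover have "0 < \<epsilon> * h" using assms h by simp
    ultimately show "\<exists>\<theta>'. excess K \<theta>' p' \<ge> 0 \<and> \<bar>\<Phi> \<theta>' p'\<bar> \<le> B + \<epsilon> * h"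
      using \<Phi>_point_dist[of \<theta> p' p] excess_point_dist[of \<theta> p' p] by (intro exI[of _ \<theta>]) linarith
  qed
qed

lemma \<Phi>_near:
  assumes "lo < \<Phi> \<theta> p" "\<Phi> \<theta> p < hi"
  obtains e where "e > 0" "\<And>\<phi>. \<bar>\<phi> - \<theta>\<bar> < e \<Longrightarrow> lo < \<Phi> \<phi> p \<and> \<Phi> \<phi> p < hi"
proof -
  have "isCont (\<lambda>\<phi>. \<Phi> \<phi> p) \<theta>" by (rule DERIV_isCont[OF \<Phi>_derivative])
  then have "\<forall>\<^sub>F \<phi> in at \<theta>. lo < \<Phi> \<phi> p \<and> \<Phi> \<phi> p < hi"
    using assms unfolding isCont_def by (intro eventually_conj order_tendstoD)
  then obtain e where "e > 0" "\<And>\<phi>. \<phi> \<noteq> \<theta> \<Longrightarrow> dist \<phi> \<theta> < e \<Longrightarrow> lo < \<Phi> \<phi> p \<and> \<Phi> \<phi> p < hi"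
    by (auto simp: eventually_at)
  then show thesis using assms by (intro that[of e]) (metis dist_real_def)+
qed

lemma strict_level_nearby:
  assumes pos: "excess K \<theta> p > 0" and \<theta>: "\<bar>\<Phi> \<theta> p\<bar> \<le> B" and B: "0 < B"
  obtains \<phi> where "excess K \<phi> p > 0" "\<bar>\<Phi> \<phi> p\<bar> < B"
proof -
  obtain e where e: "e > 0" "\<And>\<phi>. \<bar>\<phi> - \<theta>\<bar> < e \<Longrightarrow> excess K \<phi> p > 0"
    using excess_near[OF pos] by blast
  consider "\<bar>\<Phi> \<theta> p\<bar> < B" | "\<Phi> \<theta> p = - B" | "\<Phi> \<theta> p = B" using \<theta> by linarith
  then show thesis
  proof cases
    case 1 then show thesis using that pos by blast
  next
    case 2
    then have "- B - 1 < \<Phi> \<theta> p" "\<Phi> \<theta> p < B" using B by auto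
    then obtain d where d: "d > 0" "\<And>\<phi>. \<bar>\<phi> - \<theta>\<bar> < d \<Longrightarrow> - B - 1 < \<Phi> \<phi> p \<and> \<Phi> \<phi> p < B"
      using \<Phi>_near by blast
    define h where "h = min d e / 2"
    have h: "0 < h" "h < d" "h < e" using d(1) e(1) by (auto simp: h_def)
    have "\<Phi> \<theta> p < \<Phi> (\<theta> + h) p" using h e(2) by (intro \<Phi>_strict_mono) auto
    then show thesis using that[of "\<theta> + h"] d(2)[of "\<theta> + h"] e(2)[of "\<theta> + h"] h 2 by auto
  next
    case 3
    then have "- B < \<Phi> \<theta> p" "\<Phi> \<theta> p < B + 1" using B by auto
    then obtain d where d: "d > 0" "\<And>\<phi>. \<bar>\<phi> - \<theta>\<bar> < d \<Longrightarrow> - B < \<Phi> \<phi> p \<and> \<Phi> \<phi> p < B + 1"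
      using \<Phi>_near by blast
    define h where "h = min d e / 2"
    have h: "0 < h" "h < d" "h < e" using d(1) e(1) by (auto simp: h_def)
    have "\<Phi> (\<theta> - h) p < \<Phi> \<theta> p" using h e(2) by (intro \<Phi>_strict_mono) auto
    then show thesis using that[of "\<theta> - h"] d(2)[of "\<theta> - h"] e(2)[of "\<theta> - h"] h 3 by auto
  qed
qed

text \<open>The value \<open>\<Phi> \<theta> p\<close> can be moved strictly inside \<open>[- B, B]\<close> by moving \<open>\<theta>\<close> within the visible arc, and a
  strict inequality survives a small displacement, unless \<open>\<Phi>\<close> equals \<open>- B\<close> at the far end of the arc or
  \<open>B\<close> at the near end.  These are the two critical cases.\<close>

lemma level_persists:
  assumes p: "p \<notin> K" and \<theta>: "excess K \<theta> p \<ge> 0" "\<bar>\<Phi> \<theta> p\<bar> \<le> B"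
    and B: "0 < B" and \<epsilon>: "0 < \<epsilon>" and C: "0 \<le> C"
  obtains \<zeta> where "0 < \<zeta>"
    "\<And>p' h. 0 < h \<Longrightarrow> h < \<zeta> \<Longrightarrow> dist p p' \<le> C * h \<Longrightarrow> (\<And>y. y \<in> K \<Longrightarrow> dist p y \<le> dist p' y) \<Longrightarrow>
       \<exists>\<theta>'. excess K \<theta>' p' \<ge> 0 \<and> \<bar>\<Phi> \<theta>' p'\<bar> \<le> B + \<epsilon> * h"
proof (cases "\<exists>\<theta>. excess K \<theta> p > 0 \<and> \<bar>\<Phi> \<theta> p\<bar> < B")
  case True
  then show ?thesis using level_persists_strict[OF _ _ \<epsilon> C] that by metis
next
  case False
  then have none: "\<not> \<bar>\<Phi> \<phi> p\<bar> < B" if "excess K \<phi> p > 0" for \<phi> using that by blast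
  have zero: "excess K \<theta> p = 0"
    using strict_level_nearby[OF _ \<theta>(2) B] none \<theta>(1) by fastforce
  from p \<theta>(1) show ?thesis
  proof (cases rule: visible_one_side)
    case (left e)
    have inc: "\<Phi> (\<theta> - \<eta>) p < \<Phi> \<theta> p" if "0 < \<eta>" "\<eta> \<le> e" for \<eta>
    proof (rule \<Phi>_strict_mono)
      fix \<phi> assume "\<theta> - \<eta> < \<phi>" "\<phi> < \<theta>"
      then show "0 < excess K \<phi> p" using left(3)[of "\<theta> - \<phi>"] that by simp
    qed (use that in simp)
    have low: "\<Phi> \<theta> p = - B"
    proof (rule ccontr)
      assume "\<Phi> \<theta> p \<noteq> - B"
      then have "- B < \<Phi> \<theta> p" "\<Phi> \<theta> p < B + 1" using \<theta>(2) by auto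
      then obtain d where d: "d > 0" "\<And>\<phi>. \<bar>\<phi> - \<theta>\<bar> < d \<Longrightarrow> - B < \<Phi> \<phi> p \<and> \<Phi> \<phi> p < B + 1"
        using \<Phi>_near by blast
      define \<eta> where "\<eta> = min (d / 2) e"
      have \<eta>: "0 < \<eta>" "\<eta> \<le> e" "\<eta> < d" using d left by (auto simp: \<eta>_def)
      have "\<bar>\<Phi> (\<theta> - \<eta>) p\<bar> < B" using d(2)[of "\<theta> - \<eta>"] inc[OF \<eta>(1,2)] \<eta> \<theta>(2) by auto
      then show False using none[OF left(3)[OF \<eta>(1,2)]] by blast
    qed
    show ?thesis using level_persists_left[OF zero low left B \<epsilon> C] that by metis
  next
    case (right e)
    have inc: "\<Phi> \<theta> p < \<Phi> (\<theta> + \<eta>) p" if "0 < \<eta>" "\<eta> \<le> e" for \<eta>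
    proof (rule \<Phi>_strict_mono)
      fix \<phi> assume "\<theta> < \<phi>" "\<phi> < \<theta> + \<eta>"
      then show "0 < excess K \<phi> p" using right(3)[of "\<phi> - \<theta>"] that by simp
    qed (use that in simp)
    have high: "\<Phi> \<theta> p = B"
    proof (rule ccontr)
      assume "\<Phi> \<theta> p \<noteq> B"
      then have "- B - 1 < \<Phi> \<theta> p" "\<Phi> \<theta> p < B" using \<theta>(2) by auto
      then obtain d where d: "d > 0" "\<And>\<phi>. \<bar>\<phi> - \<theta>\<bar> < d \<Longrightarrow> - B - 1 < \<Phi> \<phi> p \<and> \<Phi> \<phi> p < B"
        using \<Phi>_near by blast
      define \<eta> where "\<eta> = min (d / 2) e"
      have \<eta>: "0 < \<eta>" "\<eta> \<le> e" "\<eta> < d" using d right by (auto simp: \<eta>_def)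
      have "\<bar>\<Phi> (\<theta> + \<eta>) p\<bar> < B" using d(2)[of "\<theta> + \<eta>"] inc[OF \<eta>(1,2)] \<eta> \<theta>(2) by auto
      then show False using none[OF right(3)[OF \<eta>(1,2)]] by blast
    qed
    show ?thesis using level_persists_right[OF zero high right B \<epsilon> C] that by metis
  qed
qed

end

section \<open>Points reached from the start\<close>

context unrolling
begin

text \<open>\<open>\<Phi>\<close> drops by \<open>L\<close> in each turn and varies with the point by at most the distance.\<close>

lemma \<Phi>_level_bounded:
  obtains R where "\<And>\<theta> p. norm p \<le> M \<Longrightarrow> \<bar>\<Phi> \<theta> p\<bar> \<le> B \<Longrightarrow> \<bar>\<theta>\<bar> \<le> R"
proof -
  have "bounded ((\<lambda>\<theta>. \<Phi> \<theta> 0) ` {0..2 * pi})"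
    by (intro compact_imp_bounded compact_continuous_image continuous_\<Phi>) auto
  then obtain A where "\<forall>y\<in>(\<lambda>\<theta>. \<Phi> \<theta> 0) ` {0..2 * pi}. norm y \<le> A"
    unfolding bounded_iff by (elim exE)
  then have A: "\<bar>\<Phi> \<theta> 0\<bar> \<le> A" if "0 \<le> \<theta>" "\<theta> \<le> 2 * pi" for \<theta> using that by simp
  define R where "R = 2 * pi + (A + B + M) / L * (2 * pi)"
  have "\<bar>\<theta>\<bar> \<le> R" if p: "norm p \<le> M" "\<bar>\<Phi> \<theta> p\<bar> \<le> B" for \<theta> p
  proof -
    obtain k where k: "0 < \<theta> + of_int k * (2 * pi)" "\<theta> + of_int k * (2 * pi) \<le> 0 + 2 * pi"
      by (rule reduce_mod_2pi)
    have "\<Phi> \<theta> p - of_int k * L = \<Phi> (\<theta> + of_int k * (2 * pi)) p" by (simp add: \<Phi>_period)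
    moreover have "\<bar>\<Phi> (\<theta> + of_int k * (2 * pi)) 0\<bar> \<le> A" using k by (intro A) auto
    moreover have "\<bar>\<Phi> (\<theta> + of_int k * (2 * pi)) p - \<Phi> (\<theta> + of_int k * (2 * pi)) 0\<bar> \<le> M"
      using \<Phi>_point_dist[of "\<theta> + of_int k * (2 * pi)" p 0] p by simp
    ultimately have "\<bar>of_int k * L\<bar> \<le> A + B + M" using p(2) by linarith
    then have "\<bar>of_int k\<bar> \<le> (A + B + M) / L" using L_pos by (simp add: abs_mult field_simps)
    then have "\<bar>of_int k\<bar> * (2 * pi) \<le> (A + B + M) / L * (2 * pi)" by (intro mult_right_mono) auto
    then have "\<bar>of_int k * (2 * pi)\<bar> \<le> (A + B + M) / L * (2 * pi)" by (simp add: abs_mult)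
    then show ?thesis using k unfolding R_def by linarith
  qed
  then show thesis using that by blast
qed

lemma level_limit:
  assumes "p \<longlonglongrightarrow> q" "B \<longlonglongrightarrow> c" "\<And>n. \<exists>\<theta>. excess K \<theta> (p n) \<ge> 0 \<and> \<bar>\<Phi> \<theta> (p n)\<bar> \<le> B n"
  shows "\<exists>\<theta>. excess K \<theta> q \<ge> 0 \<and> \<bar>\<Phi> \<theta> q\<bar> \<le> c"
proof -
  obtain \<theta> where \<theta>: "\<And>n. excess K (\<theta> n) (p n) \<ge> 0" "\<And>n. \<bar>\<Phi> (\<theta> n) (p n)\<bar> \<le> B n"
    using assms(3) by metis
  have "Bseq p" "Bseq B" using assms(1,2) convergentI convergent_imp_Bseq by blast+
  then obtain M B' where M: "\<And>n. norm (p n) \<le> M" and B': "\<And>n. norm (B n) \<le> B'"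
    unfolding Bseq_def by blast
  obtain R where R: "\<And>\<theta> p. norm p \<le> M \<Longrightarrow> \<bar>\<Phi> \<theta> p\<bar> \<le> B' \<Longrightarrow> \<bar>\<theta>\<bar> \<le> R"
    using \<Phi>_level_bounded by blast
  have "\<theta> n \<in> {-R..R}" for n
    using R[of "p n" "\<theta> n"] M[of n] \<theta>(2)[of n] B'[of n] by (auto simp: abs_le_iff)
  then obtain l r where l: "strict_mono r" "(\<theta> \<circ> r) \<longlonglongrightarrow> l"
    using compact_Icc[of "-R" R, unfolded compact_def, rule_format, of \<theta>] by blast
  have pr: "(\<lambda>n. p (r n)) \<longlonglongrightarrow> q" and Br: "(\<lambda>n. B (r n)) \<longlonglongrightarrow> c"
    using LIMSEQ_subseq_LIMSEQ[OF assms(1) l(1)] LIMSEQ_subseq_LIMSEQ[OF assms(2) l(1)]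
    unfolding o_def .
  have lim: "(\<lambda>n. f (\<theta> (r n)) (p (r n))) \<longlonglongrightarrow> f l q"
    if cont: "isCont (\<lambda>\<theta>. f \<theta> q) l" and lip: "\<And>\<theta> p q. \<bar>f \<theta> p - f \<theta> q\<bar> \<le> dist p q"
    for f :: "real \<Rightarrow> complex \<Rightarrow> real"
  proof -
    have A: "(\<lambda>n. f (\<theta> (r n)) q) \<longlonglongrightarrow> f l q"
      using isCont_tendsto_compose[OF cont, of "\<theta> \<circ> r" sequentially] l(2) by (simp add: o_def)
    have B: "(\<lambda>n. f (\<theta> (r n)) (p (r n)) - f (\<theta> (r n)) q) \<longlonglongrightarrow> 0"
    proof (rule Lim_null_comparison)
      show "\<forall>\<^sub>F n in sequentially. norm (f (\<theta> (r n)) (p (r n)) - f (\<theta> (r n)) q) \<le> dist (p (r n)) q"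
        using lip by simp
      show "(\<lambda>n. dist (p (r n)) q) \<longlonglongrightarrow> 0" using pr by (rule tendsto_dist_iff[THEN iffD1])
    qed
    show ?thesis using tendsto_add[OF A B] by simp
  qed
  have "(\<lambda>n. excess K (\<theta> (r n)) (p (r n))) \<longlonglongrightarrow> excess K l q"
    using continuous_excess[of UNIV q]
    by (intro lim excess_point_dist) (simp add: continuous_on_eq_continuous_at)
  then have "excess K l q \<ge> 0" using \<theta>(1) by (intro LIMSEQ_le_const) auto
  moreover have "(\<lambda>n. \<bar>\<Phi> (\<theta> (r n)) (p (r n))\<bar>) \<longlonglongrightarrow> \<bar>\<Phi> l q\<bar>"
    by (intro tendsto_rabs lim \<Phi>_point_dist DERIV_isCont[OF \<Phi>_derivative])
  then have "\<bar>\<Phi> l q\<bar> \<le> c" using Br by (rule LIMSEQ_le) (use \<theta>(2) in blast)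
  ultimately show ?thesis by blast
qed

lemma \<Phi>_x0_start: "excess K \<theta>0 x0 = 0" "\<Phi> \<theta>0 x0 = 0"
  using excess_face[OF start(1)] \<Phi>_i[of \<theta>0] start(2) by simp_all

lemma \<Phi>_constant_on_normal_cone:
  assumes "\<And>\<phi>. \<phi> \<in> closed_segment \<theta>0 \<theta> \<Longrightarrow> excess K \<phi> x0 = 0"
  shows "\<Phi> \<theta> x0 = 0"
proof (cases "\<theta>0 \<le> \<theta>")
  case True
  then have "\<And>\<phi>. \<theta>0 \<le> \<phi> \<Longrightarrow> \<phi> \<le> \<theta> \<Longrightarrow> excess K \<phi> x0 = 0"
    using assms by (simp add: closed_segment_eq_real_ivl)
  then show ?thesis using \<Phi>_mono[OF True, of x0] \<Phi>_antimono[OF True, of x0] \<Phi>_x0_start by fastforce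
next
  case False
  then have le: "\<theta> \<le> \<theta>0" by simp
  then have "\<And>\<phi>. \<theta> \<le> \<phi> \<Longrightarrow> \<phi> \<le> \<theta>0 \<Longrightarrow> excess K \<phi> x0 = 0"
    using assms by (simp add: closed_segment_eq_real_ivl)
  then show ?thesis using \<Phi>_mono[OF le, of x0] \<Phi>_antimono[OF le, of x0] \<Phi>_x0_start by fastforce
qed

text \<open>As \<open>p\<close> tends to \<open>x0\<close>, the directions visible from \<open>p\<close> accumulate at normals of \<open>x0\<close>.  Representatives
  within half a turn of \<open>\<theta>0\<close> accumulate at the component of \<open>\<theta>0\<close>, on which \<open>\<Phi> \<theta> x0\<close> is constantly \<open>0\<close>: the
  direction opposite to \<open>nvec \<theta>0\<close> is not a normal of \<open>x0\<close>, since \<open>K\<close> has positive width.\<close>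

lemma level_near_start:
  assumes int: "interior K \<noteq> {}" and \<delta>: "\<delta> > 0"
  obtains \<kappa> where "\<kappa> > 0"
    "\<And>p. p \<notin> K \<Longrightarrow> dist p x0 < \<kappa> \<Longrightarrow> \<exists>\<theta>. excess K \<theta> p \<ge> 0 \<and> \<bar>\<Phi> \<theta> p\<bar> \<le> \<delta>"
proof -
  define W where "W = {\<theta>0 - pi..\<theta>0 + pi}"
  have width: "excess K (\<theta>0 + pi) x0 \<noteq> 0"
  proof
    assume "excess K (\<theta>0 + pi) x0 = 0"
    then have "nvec \<theta>0 \<bullet> y = nvec \<theta>0 \<bullet> x0" if "y \<in> K" for y
      using \<Phi>_x0_start(1) inner_le_support[OF that, of \<theta>0] inner_le_support[OF that, of "\<theta>0 + pi"]
      by (simp add: excess_def)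
    then have "K \<subseteq> {y. nvec \<theta>0 \<bullet> y = nvec \<theta>0 \<bullet> x0}" by blast
    then have "interior K \<subseteq> interior {y. nvec \<theta>0 \<bullet> y = nvec \<theta>0 \<bullet> x0}" by (rule interior_mono)
    moreover have "nvec \<theta>0 \<noteq> 0" using norm_nvec[of \<theta>0] by force
    ultimately show False using int by (simp add: interior_hyperplane)
  qed
  have zero: "\<Phi> \<theta> x0 = 0" if "\<theta> \<in> W" "excess K \<theta> x0 = 0" for \<theta>
  proof (rule \<Phi>_constant_on_normal_cone)
    fix \<phi> assume \<phi>: "\<phi> \<in> closed_segment \<theta>0 \<theta>"
    have "\<theta> \<noteq> \<theta>0 + pi" using width that by auto
    moreover have "\<theta> \<noteq> \<theta>0 - pi"
      using width that excess_2pi[of "\<theta>0 - pi" 1 x0] by (auto simp: add.commute)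
    ultimately have w: "\<bar>\<theta> - \<theta>0\<bar> < pi" using that by (auto simp: W_def)
    have "excess K \<phi> x0 \<ge> 0"
    proof (cases \<theta> \<theta>0 rule: linorder_cases)
      case less
      then have "sin (\<theta>0 - \<theta>) * excess K \<phi> x0 \<ge> 0" "sin (\<theta>0 - \<theta>) > 0"
        using excess_between[of \<theta> \<phi> \<theta>0 x0] \<phi> w that \<Phi>_x0_start
        by (auto simp: closed_segment_eq_real_ivl intro!: sin_gt_zero)
      then show ?thesis by (simp add: zero_le_mult_iff)
    next
      case equal then show ?thesis using \<phi> \<Phi>_x0_start by simp
    next
      case greater
      then have "sin (\<theta> - \<theta>0) * excess K \<phi> x0 \<ge> 0" "sin (\<theta> - \<theta>0) > 0"
        using excess_between[of \<theta>0 \<phi> \<theta> x0] \<phi> w that \<Phi>_x0_start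
        by (auto simp: closed_segment_eq_real_ivl intro!: sin_gt_zero)
      then show ?thesis by (simp add: zero_le_mult_iff)
    qed
    then show "excess K \<phi> x0 = 0" using excess_nonpos[OF x0_in, of \<phi>] by simp
  qed
  define F where "F = {\<theta> \<in> W. \<delta> / 2 \<le> \<bar>\<Phi> \<theta> x0\<bar>}"
  have "compact F"
  proof -
    have "closed {\<theta>. \<delta> / 2 \<le> \<bar>\<Phi> \<theta> x0\<bar>}"
      by (intro closed_Collect_le continuous_intros continuous_\<Phi>)
    then have "compact (W \<inter> {\<theta>. \<delta> / 2 \<le> \<bar>\<Phi> \<theta> x0\<bar>})"
      unfolding W_def by (intro compact_Int_closed) auto
    then show ?thesis by (simp add: F_def Int_def)
  qed
  obtain \<kappa>0 where \<kappa>0: "\<kappa>0 > 0" "\<And>\<theta>. \<theta> \<in> F \<Longrightarrow> excess K \<theta> x0 \<le> - \<kappa>0"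
  proof (cases "F = {}")
    case False
    then obtain m where m: "m \<in> F" "\<And>\<theta>. \<theta> \<in> F \<Longrightarrow> excess K \<theta> x0 \<le> excess K m x0"
      using continuous_attains_sup[OF \<open>compact F\<close> False continuous_excess] by blast
    have "excess K m x0 \<noteq> 0" using zero[of m] m(1) \<delta> by (auto simp: F_def)
    then have "excess K m x0 < 0" using excess_nonpos[OF x0_in, of m] by simp
    then show ?thesis using m(2) that[of "- excess K m x0"] by simp
  qed (use that[of 1] in auto)
  show thesis
  proof (rule that[of "min \<kappa>0 (\<delta> / 2)"])
    show "min \<kappa>0 (\<delta> / 2) > 0" using \<kappa>0 \<delta> by simp
    fix p assume p: "p \<notin> K" "dist p x0 < min \<kappa>0 (\<delta> / 2)"
    obtain \<theta>1 where \<theta>1: "excess K \<theta>1 p > 0" using outside_visible[OF p(1)] by blast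
    obtain k where k: "\<theta>0 - pi < \<theta>1 + of_int k * (2 * pi)" "\<theta>1 + of_int k * (2 * pi) \<le> \<theta>0 - pi + 2 * pi"
      by (rule reduce_mod_2pi)
    define \<theta> where "\<theta> = \<theta>1 + of_int k * (2 * pi)"
    have \<theta>: "\<theta> \<in> W" "excess K \<theta> p > 0" using k \<theta>1 by (auto simp: W_def \<theta>_def excess_2pi)
    have "excess K \<theta> x0 > - \<kappa>0" using excess_point_dist[of \<theta> p x0] \<theta>(2) p(2) by linarith
    then have "\<theta> \<notin> F" using \<kappa>0(2)[of \<theta>] by force
    then have "\<bar>\<Phi> \<theta> x0\<bar> < \<delta> / 2" using \<theta>(1) by (simp add: F_def)
    then have "\<bar>\<Phi> \<theta> p\<bar> \<le> \<delta>" using \<Phi>_point_dist[of \<theta> p x0] p(2) by linarith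
    then show "\<exists>\<theta>. excess K \<theta> p \<ge> 0 \<and> \<bar>\<Phi> \<theta> p\<bar> \<le> \<delta>" using \<theta>(2) by (intro exI[of _ \<theta>]) auto
  qed
qed

text \<open>At each point of the path some level of size at most \<open>\<epsilon> (1 + (\<sigma> - u))\<close> is attained with nonnegative
  excess.  The constant part of the tolerance starts the induction at \<open>x0\<close>, where nothing is visible,
  and the linear part pays for the quadratic losses of the steps.  Finally \<open>\<epsilon>\<close> tends to \<open>0\<close>.\<close>

theorem path_reaches_level:
  assumes int: "interior K \<noteq> {}" and uv: "u \<le> v" and C: "0 \<le> C"
    and lip: "\<And>\<sigma> \<sigma>'. u \<le> \<sigma> \<Longrightarrow> \<sigma> \<le> \<sigma>' \<Longrightarrow> \<sigma>' \<le> v \<Longrightarrow> dist (g \<sigma>) (g \<sigma>') \<le> C * (\<sigma>' - \<sigma>)"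
    and gu: "g u = x0"
    and out: "\<And>\<sigma>. u < \<sigma> \<Longrightarrow> \<sigma> \<le> v \<Longrightarrow> g \<sigma> \<notin> K"
    and mono: "\<And>\<sigma> \<sigma>' y. u \<le> \<sigma> \<Longrightarrow> \<sigma> \<le> \<sigma>' \<Longrightarrow> \<sigma>' \<le> v \<Longrightarrow> y \<in> K \<Longrightarrow> dist (g \<sigma>) y \<le> dist (g \<sigma>') y"
  shows "\<exists>\<theta>. excess K \<theta> (g v) \<ge> 0 \<and> \<Phi> \<theta> (g v) = 0"
proof -
  have approx: "\<exists>\<theta>. excess K \<theta> (g v) \<ge> 0 \<and> \<bar>\<Phi> \<theta> (g v)\<bar> \<le> \<epsilon> * (1 + (v - u))" if \<epsilon>: "\<epsilon> > 0" for \<epsilon>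
  proof (rule right_step_induction[where P = "\<lambda>\<sigma>. \<exists>\<theta>. excess K \<theta> (g \<sigma>) \<ge> 0 \<and> \<bar>\<Phi> \<theta> (g \<sigma>)\<bar> \<le> \<epsilon> * (1 + (\<sigma> - u))", OF uv])
    show "\<exists>\<theta>. excess K \<theta> (g u) \<ge> 0 \<and> \<bar>\<Phi> \<theta> (g u)\<bar> \<le> \<epsilon> * (1 + (u - u))"
      using \<Phi>_x0_start \<epsilon> by (intro exI[of _ \<theta>0]) (simp add: gu)
  next
    fix \<sigma> assume \<sigma>: "u \<le> \<sigma>" "\<sigma> < v" and "\<exists>\<theta>. excess K \<theta> (g \<sigma>) \<ge> 0 \<and> \<bar>\<Phi> \<theta> (g \<sigma>)\<bar> \<le> \<epsilon> * (1 + (\<sigma> - u))"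
    then obtain \<theta> where \<theta>: "excess K \<theta> (g \<sigma>) \<ge> 0" "\<bar>\<Phi> \<theta> (g \<sigma>)\<bar> \<le> \<epsilon> * (1 + (\<sigma> - u))" by blast
    show "\<exists>\<zeta>>0. \<forall>h. 0 < h \<longrightarrow> h < \<zeta> \<longrightarrow> \<sigma> + h \<le> v \<longrightarrow>
        (\<exists>\<theta>. excess K \<theta> (g (\<sigma> + h)) \<ge> 0 \<and> \<bar>\<Phi> \<theta> (g (\<sigma> + h))\<bar> \<le> \<epsilon> * (1 + (\<sigma> + h - u)))"
    proof (cases "\<sigma> = u")
      case True
      obtain \<kappa> where \<kappa>: "\<kappa> > 0"
        "\<And>p. p \<notin> K \<Longrightarrow> dist p x0 < \<kappa> \<Longrightarrow> \<exists>\<theta>. excess K \<theta> p \<ge> 0 \<and> \<bar>\<Phi> \<theta> p\<bar> \<le> \<epsilon>"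
        using level_near_start[OF int \<epsilon>] by blast
      show ?thesis
      proof (rule exI[of _ "\<kappa> / (C + 1)"], intro conjI allI impI)
        show "0 < \<kappa> / (C + 1)" using \<kappa> C by simp
        fix h assume h: "0 < h" "h < \<kappa> / (C + 1)" "\<sigma> + h \<le> v"
        have "h * (C + 1) < \<kappa>" using h C by (simp add: pos_less_divide_eq)
        then have "C * h < \<kappa>" using h by (simp add: algebra_simps)
        moreover have "dist (g (\<sigma> + h)) x0 \<le> C * h"
          using lip[of u "u + h"] h True gu by (simp add: dist_commute)
        ultimately obtain \<phi> where \<phi>: "excess K \<phi> (g (\<sigma> + h)) \<ge> 0" "\<bar>\<Phi> \<phi> (g (\<sigma> + h))\<bar> \<le> \<epsilon>"
          using \<kappa>(2)[of "g (\<sigma> + h)"] out[of "\<sigma> + h"] h \<sigma> by auto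
        moreover have "\<epsilon> * 1 \<le> \<epsilon> * (1 + (\<sigma> + h - u))" using \<epsilon> h \<sigma> by (intro mult_left_mono) auto
        ultimately show "\<exists>\<theta>. excess K \<theta> (g (\<sigma> + h)) \<ge> 0 \<and> \<bar>\<Phi> \<theta> (g (\<sigma> + h))\<bar> \<le> \<epsilon> * (1 + (\<sigma> + h - u))"
          by (intro exI[of _ \<phi>]) auto
      qed
    next
      case False
      have B: "0 < \<epsilon> * (1 + (\<sigma> - u))" using \<epsilon> \<sigma> by simp
      have "g \<sigma> \<notin> K" using out[of \<sigma>] False \<sigma> by simp
      then obtain \<zeta> where \<zeta>: "0 < \<zeta>" "\<And>p' h. 0 < h \<Longrightarrow> h < \<zeta> \<Longrightarrow> dist (g \<sigma>) p' \<le> C * h \<Longrightarrow>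
         (\<And>y. y \<in> K \<Longrightarrow> dist (g \<sigma>) y \<le> dist p' y) \<Longrightarrow>
         \<exists>\<theta>'. excess K \<theta>' p' \<ge> 0 \<and> \<bar>\<Phi> \<theta>' p'\<bar> \<le> \<epsilon> * (1 + (\<sigma> - u)) + \<epsilon> * h"
        using level_persists[OF _ \<theta> B \<epsilon> C] by metis
      show ?thesis
      proof (rule exI[of _ \<zeta>], intro conjI allI impI)
        fix h assume h: "0 < h" "h < \<zeta>" "\<sigma> + h \<le> v"
        have "\<exists>\<theta>'. excess K \<theta>' (g (\<sigma> + h)) \<ge> 0 \<and> \<bar>\<Phi> \<theta>' (g (\<sigma> + h))\<bar> \<le> \<epsilon> * (1 + (\<sigma> - u)) + \<epsilon> * h"
          by (rule \<zeta>(2)[OF h(1,2)]) (use lip[of \<sigma> "\<sigma> + h"] mono[of \<sigma> "\<sigma> + h"] h \<sigma> in auto)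
        moreover have "\<epsilon> * (1 + (\<sigma> - u)) + \<epsilon> * h = \<epsilon> * (1 + (\<sigma> + h - u))" by (simp add: algebra_simps)
        ultimately show "\<exists>\<theta>. excess K \<theta> (g (\<sigma> + h)) \<ge> 0 \<and> \<bar>\<Phi> \<theta> (g (\<sigma> + h))\<bar> \<le> \<epsilon> * (1 + (\<sigma> + h - u))"
          by simp
      qed (rule \<zeta>(1))
    qed
  next
    fix s \<sigma>
    assume s: "\<And>n. u \<le> s n \<and> s n \<le> v \<and> (\<exists>\<theta>. excess K \<theta> (g (s n)) \<ge> 0 \<and> \<bar>\<Phi> \<theta> (g (s n))\<bar> \<le> \<epsilon> * (1 + (s n - u)))"
      and lim: "s \<longlonglongrightarrow> \<sigma>"
    have \<sigma>: "u \<le> \<sigma>" "\<sigma> \<le> v" using s lim by (auto intro: LIMSEQ_le_const LIMSEQ_le_const2)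
    have "(\<lambda>n. g (s n)) \<longlonglongrightarrow> g \<sigma>"
    proof (rule metric_tendsto_imp_tendsto)
      show "(\<lambda>n. C * (s n - \<sigma>)) \<longlonglongrightarrow> 0"
        using tendsto_mult[OF tendsto_const[of C] LIM_zero[OF lim]] by simp
      show "\<forall>\<^sub>F n in sequentially. dist (g (s n)) (g \<sigma>) \<le> dist (C * (s n - \<sigma>)) 0"
      proof (intro always_eventually allI)
        fix n show "dist (g (s n)) (g \<sigma>) \<le> dist (C * (s n - \<sigma>)) 0"
          using lip[of "s n" \<sigma>] lip[of \<sigma> "s n"] s[of n] \<sigma> C
          by (cases "s n \<le> \<sigma>") (auto simp: dist_commute abs_mult)
      qed
    qed
    moreover have "(\<lambda>n. \<epsilon> * (1 + (s n - u))) \<longlonglongrightarrow> \<epsilon> * (1 + (\<sigma> - u))" by (intro tendsto_intros lim)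
    ultimately show "\<exists>\<theta>. excess K \<theta> (g \<sigma>) \<ge> 0 \<and> \<bar>\<Phi> \<theta> (g \<sigma>)\<bar> \<le> \<epsilon> * (1 + (\<sigma> - u))"
      by (rule level_limit) (use s in blast)
  qed
  have "\<exists>\<theta>. excess K \<theta> (g v) \<ge> 0 \<and> \<bar>\<Phi> \<theta> (g v)\<bar> \<le> 0"
  proof (rule level_limit)
    show "(\<lambda>n. g v) \<longlonglongrightarrow> g v" by simp
    show "(\<lambda>n. inverse (real (Suc n)) * (1 + (v - u))) \<longlonglongrightarrow> 0"
      using tendsto_mult_left_zero[OF LIMSEQ_inverse_real_of_nat] by blast
    show "\<exists>\<theta>. excess K \<theta> (g v) \<ge> 0 \<and> \<bar>\<Phi> \<theta> (g v)\<bar> \<le> inverse (real (Suc n)) * (1 + (v - u))" for n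
      by (rule approx) simp
  qed
  then show ?thesis by auto
qed

end

context unrolling
begin

text \<open>Choose \<open>\<beta>\<close> so that the segment points in direction \<open>tvec \<beta>\<close> and \<open>\<theta>0\<close> lies in \<open>[\<beta> - \<pi>, \<beta>]\<close>, the normal
  cone of \<open>x0\<close>.  Unrolling the segment is explicit: \<open>\<Phi>\<close> is constantly \<open>0\<close> at \<open>x0\<close> on this cone, \<open>- l\<close> at \<open>b\<close> on
  the half turn after it and \<open>l\<close> at \<open>b\<close> on the half turn before it.  Points behind \<open>x0\<close> lie on a normal
  through \<open>x0\<close>.  For the others the intermediate value theorem applies between the line of the
  segment and the line from \<open>p\<close> to \<open>b\<close>: \<open>p\<close> is not closer to \<open>b\<close> than \<open>x0\<close>, so the value on the latter has the
  right sign.\<close>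

lemma segment_reaches_level:
  assumes K: "K = closed_segment x0 b" "x0 \<noteq> b" and far: "dist x0 b \<le> dist p b"
  shows "\<exists>\<theta>. excess K \<theta> p \<ge> 0 \<and> \<Phi> \<theta> p = 0"
proof -
  define l where "l = dist x0 b"
  have l: "l > 0" using K(2) by (simp add: l_def)
  obtain \<beta> where \<beta>: "b - x0 = l *\<^sub>R tvec \<beta>" "\<theta>0 \<le> \<beta>" "\<beta> \<le> \<theta>0 + pi"
  proof -
    obtain \<rho> \<omega> where \<omega>: "0 \<le> \<rho>" "b - x0 = \<rho> *\<^sub>R nvec \<omega>" by (rule obtain_polar)
    have "\<rho> = l" using arg_cong[OF \<omega>(2), of norm] \<omega>(1) by (simp add: l_def dist_norm norm_minus_commute)
    have "tvec (\<omega> - pi / 2) = nvec \<omega>" by (simp add: tvec_def nvec_def sin_diff cos_diff)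
    moreover obtain k where k: "\<theta>0 - pi < \<omega> - pi / 2 + of_int k * (2 * pi)"
        "\<omega> - pi / 2 + of_int k * (2 * pi) \<le> \<theta>0 - pi + 2 * pi"
      by (rule reduce_mod_2pi)
    ultimately have t: "tvec (\<omega> - pi / 2 + of_int k * (2 * pi)) = nvec \<omega>" by (simp only: tvec_2pi)
    define \<beta> where "\<beta> = \<omega> - pi / 2 + of_int k * (2 * pi)"
    have bt: "b - x0 = l *\<^sub>R tvec \<beta>" using \<omega>(2) t \<open>\<rho> = l\<close> by (simp add: \<beta>_def)
    have "nvec \<theta>0 \<bullet> (b - x0) \<le> 0"
      using \<Phi>_x0_start(1) inner_le_support[of b \<theta>0] by (simp add: K excess_def inner_diff_right)
    then have s: "sin (\<theta>0 - \<beta>) \<le> 0" using l by (simp add: bt frame_inner mult_le_0_iff)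
    have "\<theta>0 \<le> \<beta>"
    proof (rule ccontr)
      assume "\<not> \<theta>0 \<le> \<beta>"
      then have "sin (\<theta>0 - \<beta>) > 0" using k by (intro sin_gt_zero) (auto simp: \<beta>_def)
      then show False using s by simp
    qed
    then show thesis using that[OF bt] k by (auto simp: \<beta>_def)
  qed
  have x0b: "excess K \<phi> x0 = max 0 (nvec \<phi> \<bullet> (b - x0)) * (-1)" for \<phi>
  proof -
    have "support_fun K \<phi> = nvec \<phi> \<bullet> x0 + max 0 (nvec \<phi> \<bullet> (b - x0))"
    proof (rule antisym)
      obtain y where y: "y \<in> face K \<phi>" by (rule face_nonempty)
      then obtain u where u: "0 \<le> u" "u \<le> 1" "y = (1 - u) *\<^sub>R x0 + u *\<^sub>R b"
        using faceD(1)[OF y] by (auto simp: K in_segment)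
      have "support_fun K \<phi> = nvec \<phi> \<bullet> x0 + u * (nvec \<phi> \<bullet> (b - x0))"
        using faceD(2)[OF y] by (simp add: u(3) inner_add_right inner_diff_right algebra_simps)
      also have "u * (nvec \<phi> \<bullet> (b - x0)) \<le> u * max 0 (nvec \<phi> \<bullet> (b - x0))" using u by (intro mult_left_mono) auto
      also have "\<dots> \<le> 1 * max 0 (nvec \<phi> \<bullet> (b - x0))" using u by (intro mult_right_mono) auto
      finally show "support_fun K \<phi> \<le> nvec \<phi> \<bullet> x0 + max 0 (nvec \<phi> \<bullet> (b - x0))" by simp
    next
      show "nvec \<phi> \<bullet> x0 + max 0 (nvec \<phi> \<bullet> (b - x0)) \<le> support_fun K \<phi>"
        using inner_le_support[of x0 \<phi>] inner_le_support[of b \<phi>] by (simp add: K inner_diff_right max_def)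
    qed
    then show ?thesis by (simp add: excess_def)
  qed
  have s\<beta>: "nvec \<phi> \<bullet> (b - x0) = l * sin (\<phi> - \<beta>)" for \<phi> by (simp add: \<beta>(1) frame_inner)
  have ex_x0: "excess K \<phi> x0 = 0" if "\<beta> - pi \<le> \<phi>" "\<phi> \<le> \<beta>" for \<phi>
  proof -
    have "sin (\<beta> - \<phi>) \<ge> 0" using that by (intro sin_ge_zero) auto
    then have "sin (\<phi> - \<beta>) \<le> 0" by (metis minus_diff_eq neg_le_0_iff_le sin_minus)
    then have "l * sin (\<phi> - \<beta>) \<le> 0" using l by (simp add: mult_nonneg_nonpos)
    then show ?thesis by (simp add: x0b s\<beta>)
  qed
  have ex_b: "excess K \<phi> b = 0" if "sin (\<phi> - \<beta>) \<ge> 0" for \<phi>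
  proof -
    have "excess K \<phi> b = excess K \<phi> x0 + nvec \<phi> \<bullet> (b - x0)" by (simp add: excess_def inner_diff_right)
    then show ?thesis using that l by (simp add: x0b s\<beta>)
  qed
  have \<Phi>_x0: "\<Phi> \<phi> x0 = 0" if "\<beta> - pi \<le> \<phi>" "\<phi> \<le> \<beta>" for \<phi>
  proof (rule \<Phi>_constant_on_normal_cone)
    fix \<psi> assume "\<psi> \<in> closed_segment \<theta>0 \<phi>"
    then have "\<beta> - pi \<le> \<psi>" "\<psi> \<le> \<beta>" using that \<beta> by (auto simp: closed_segment_eq_real_ivl split: if_splits)
    then show "excess K \<psi> x0 = 0" by (rule ex_x0)
  qed
  define d where "d = dist p b"
  have d: "l \<le> d" using far by (simp add: l_def d_def)
  obtain \<phi>0 where \<phi>0: "p - b = d *\<^sub>R tvec \<phi>0"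
  proof -
    obtain \<rho> \<omega> where \<omega>: "0 \<le> \<rho>" "p - b = \<rho> *\<^sub>R nvec \<omega>" by (rule obtain_polar)
    have "\<rho> = d" using arg_cong[OF \<omega>(2), of norm] \<omega>(1) by (simp add: d_def dist_norm)
    moreover have "tvec (\<omega> - pi / 2) = nvec \<omega>" by (simp add: tvec_def nvec_def sin_diff cos_diff)
    ultimately show thesis using \<omega>(2) that[of "\<omega> - pi / 2"] by simp
  qed
  have ex_p: "excess K \<phi> p = excess K \<phi> q + nvec \<phi> \<bullet> (p - q)" for \<phi> q by (simp add: excess_def inner_diff_right)
  have \<Phi>_p: "\<Phi> \<phi> p = \<Phi> \<phi> q - tvec \<phi> \<bullet> (p - q)" for \<phi> q by (simp add: \<Phi>_def inner_diff_right)
  consider (behind) "tvec \<beta> \<bullet> (p - x0) \<le> 0" | (left) "tvec \<beta> \<bullet> (p - x0) \<ge> 0" "nvec \<beta> \<bullet> (p - x0) \<ge> 0"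
    | (right) "tvec \<beta> \<bullet> (p - x0) \<ge> 0" "nvec \<beta> \<bullet> (p - x0) \<le> 0" by linarith
  then show ?thesis
  proof cases
    case behind
    obtain \<rho> \<omega> where \<omega>: "0 \<le> \<rho>" "p - x0 = \<rho> *\<^sub>R nvec \<omega>" by (rule obtain_polar)
    obtain k where k: "\<beta> - pi < \<omega> + of_int k * (2 * pi)" "\<omega> + of_int k * (2 * pi) \<le> \<beta> - pi + 2 * pi"
      by (rule reduce_mod_2pi)
    define \<theta> where "\<theta> = \<omega> + of_int k * (2 * pi)"
    have n: "nvec \<theta> = nvec \<omega>" by (simp only: \<theta>_def nvec_2pi)
    have good: ?thesis if "\<beta> - pi \<le> \<phi>" "\<phi> \<le> \<beta>" "p - x0 = \<rho> *\<^sub>R nvec \<phi>" for \<phi>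
      using that \<omega>(1) ex_x0[OF that(1,2)] \<Phi>_x0[OF that(1,2)] ex_p[of \<phi> x0] \<Phi>_p[of \<phi> x0]
      by (intro exI[of _ \<phi>]) (simp add: frame_inner)
    show ?thesis
    proof (cases "\<rho> = 0 \<or> \<theta> \<le> \<beta>")
      case True
      then show ?thesis
      proof
        assume "\<rho> = 0" then show ?thesis using good[of \<beta>] \<omega>(2) by simp
      next
        assume "\<theta> \<le> \<beta>" then show ?thesis using good[of \<theta>] \<omega>(2) n k by (simp add: \<theta>_def)
      qed
    next
      case False
      have "\<rho> * sin (\<theta> - \<beta>) \<le> 0" using behind by (simp add: \<omega>(2) frame_inner flip: n)
      then have "sin (\<theta> - \<beta>) \<le> 0" using False \<omega>(1) by (simp add: mult_le_0_iff)
      then have "\<not> \<theta> - \<beta> < pi" using sin_gt_zero[of "\<theta> - \<beta>"] False by force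
      then have "\<theta> = \<beta> - pi + of_int 1 * (2 * pi)" using k by (simp add: \<theta>_def)
      then have "nvec \<theta> = nvec (\<beta> - pi)" by (simp only: nvec_2pi)
      then show ?thesis using good[of "\<beta> - pi"] \<omega>(2) n by simp
    qed
  next
    case left
    obtain k where k: "\<beta> - pi < \<phi>0 + pi + of_int k * (2 * pi)" "\<phi>0 + pi + of_int k * (2 * pi) \<le> \<beta> - pi + 2 * pi"
      by (rule reduce_mod_2pi)
    define \<phi> where "\<phi> = \<phi>0 + pi + of_int k * (2 * pi)"
    have "tvec \<phi> = - tvec \<phi>0" unfolding \<phi>_def tvec_2pi by simp
    then have pb: "p - b = - (d *\<^sub>R tvec \<phi>)" using \<phi>0 by simp
    have "nvec \<beta> \<bullet> (p - b) \<ge> 0"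
      using left(2) s\<beta>[of \<beta>] by (simp add: inner_diff_right)
    then have "d * sin (\<beta> - \<phi>) \<le> 0" by (simp add: pb frame_inner)
    then have s: "sin (\<beta> - \<phi>) \<le> 0" using l d by (simp add: mult_le_0_iff)
    have \<phi>: "\<beta> \<le> \<phi>" "\<phi> \<le> \<beta> + pi"
      using s sin_gt_zero[of "\<beta> - \<phi>"] k by (force simp: \<phi>_def)+
    have pos: "excess K \<psi> p \<ge> 0" if "\<beta> \<le> \<psi>" "\<psi> \<le> \<phi>" for \<psi>
    proof -
      have "excess K \<psi> b = 0" using that \<phi> by (intro ex_b sin_ge_zero) auto
      moreover have "sin (\<phi> - \<psi>) \<ge> 0" using that \<phi> by (intro sin_ge_zero) auto
      then have "sin (\<psi> - \<phi>) \<le> 0" by (metis minus_diff_eq neg_le_0_iff_le sin_minus)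
      then have "d * sin (\<psi> - \<phi>) \<le> 0" using l d by (simp add: mult_nonneg_nonpos)
      ultimately show ?thesis by (simp add: ex_p[of \<psi> b] pb frame_inner)
    qed
    have "\<Phi> \<phi> b = \<Phi> \<beta> b"
    proof -
      have "excess K \<psi> b = 0" if "\<beta> \<le> \<psi>" "\<psi> \<le> \<phi>" for \<psi>
        using that \<phi> by (intro ex_b sin_ge_zero) auto
      then show ?thesis using \<Phi>_mono[OF \<phi>(1), of b] \<Phi>_antimono[OF \<phi>(1), of b] by fastforce
    qed
    also have "\<dots> = - l"
    proof -
      have "\<Phi> \<beta> b = \<Phi> \<beta> x0 - tvec \<beta> \<bullet> (b - x0)" by (simp add: \<Phi>_def inner_diff_right)
      then show ?thesis using \<Phi>_x0[of \<beta>] by (simp add: \<beta>(1) frame_inner)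
    qed
    finally have "\<Phi> \<phi> p = - l + d" by (simp add: \<Phi>_p[of \<phi> b] pb frame_inner)
    moreover have "\<Phi> \<beta> p \<le> 0" using left(1) \<Phi>_p[of \<beta> x0] \<Phi>_x0[of \<beta>] by simp
    ultimately obtain \<theta> where "\<beta> \<le> \<theta>" "\<theta> \<le> \<phi>" "\<Phi> \<theta> p = 0"
      using IVT'[of "\<lambda>\<theta>. \<Phi> \<theta> p" \<beta> 0 \<phi>] \<phi> d continuous_\<Phi> by auto
    then show ?thesis using pos by blast
  next
    case right
    obtain k where k: "\<beta> - 2 * pi - pi < \<phi>0 + of_int k * (2 * pi)" "\<phi>0 + of_int k * (2 * pi) \<le> \<beta> - 2 * pi - pi + 2 * pi"
      by (rule reduce_mod_2pi)
    define \<phi> where "\<phi> = \<phi>0 + of_int k * (2 * pi)"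
    have "tvec \<phi> = tvec \<phi>0" unfolding \<phi>_def tvec_2pi by simp
    then have pb: "p - b = d *\<^sub>R tvec \<phi>" using \<phi>0 by simp
    have "nvec \<beta> \<bullet> (p - b) \<le> 0"
      using right(2) s\<beta>[of \<beta>] by (simp add: inner_diff_right)
    then have "d * sin (\<beta> - \<phi>) \<le> 0" by (simp add: pb frame_inner)
    then have s: "sin (\<beta> - \<phi>) \<le> 0" using l d by (simp add: mult_le_0_iff)
    have shift: "sin (u - 2 * pi) = sin u" for u :: real by (simp add: sin_diff)
    have \<phi>: "\<beta> - 2 * pi \<le> \<phi>" "\<phi> \<le> \<beta> - pi"
      using s sin_gt_zero[of "\<beta> - \<phi> - 2 * pi"] shift[of "\<beta> - \<phi>"] k by (force simp: \<phi>_def)+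
    have ex_b': "excess K \<psi> b = 0" if "\<beta> - 2 * pi \<le> \<psi>" "\<psi> \<le> \<beta> - pi" for \<psi>
    proof (rule ex_b)
      have "sin (\<psi> - \<beta> + 2 * pi) \<ge> 0" using that by (intro sin_ge_zero) auto
      then show "sin (\<psi> - \<beta>) \<ge> 0" by simp
    qed
    have pos: "excess K \<psi> p \<ge> 0" if "\<phi> \<le> \<psi>" "\<psi> \<le> \<beta> - pi" for \<psi>
    proof -
      have "excess K \<psi> b = 0" using that \<phi> by (intro ex_b') auto
      moreover have "sin (\<psi> - \<phi>) \<ge> 0" using that \<phi> by (intro sin_ge_zero) auto
      then have "d * sin (\<psi> - \<phi>) \<ge> 0" using l d by simp
      ultimately show ?thesis by (simp add: ex_p[of \<psi> b] pb frame_inner)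
    qed
    have t': "tvec (\<beta> - pi) = - tvec \<beta>" using tvec_plus_pi[of "\<beta> - pi"] by simp
    have "\<Phi> \<phi> b = \<Phi> (\<beta> - pi) b"
      using \<Phi>_mono[OF \<phi>(2), of b] \<Phi>_antimono[OF \<phi>(2), of b] \<phi>(1) ex_b' by fastforce
    also have "\<dots> = l"
    proof -
      have "\<Phi> (\<beta> - pi) b = \<Phi> (\<beta> - pi) x0 - tvec (\<beta> - pi) \<bullet> (b - x0)" by (simp add: \<Phi>_def inner_diff_right)
      then show ?thesis using \<Phi>_x0[of "\<beta> - pi"] by (simp add: t' \<beta>(1) frame_inner)
    qed
    finally have "\<Phi> \<phi> p = l - d" by (simp add: \<Phi>_p[of \<phi> b] pb frame_inner)
    moreover have "\<Phi> (\<beta> - pi) p \<ge> 0" using right(1) \<Phi>_p[of "\<beta> - pi" x0] \<Phi>_x0[of "\<beta> - pi"] by (simp add: t')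
    ultimately obtain \<theta> where "\<phi> \<le> \<theta>" "\<theta> \<le> \<beta> - pi" "\<Phi> \<theta> p = 0"
      using IVT'[of "\<lambda>\<theta>. \<Phi> \<theta> p" \<phi> 0 "\<beta> - pi"] \<phi> d continuous_\<Phi> by auto
    then show ?thesis using pos by blast
  qed
qed

end

section \<open>Reflection and the right involute\<close>

lemma cnj_cnj_image: "cnj ` cnj ` K = K"
  by (simp add: image_image)

text \<open>The coordinates of both curves along the support lines are primitives of \<open>- h\<close> with the same value at
  \<open>\<theta>0\<close>.\<close>

lemma unrolling_unique:
  assumes "unrolling K L x0 i \<theta>0 \<tau>"
    and "unrolling (cnj ` K) L (cnj x0) (\<lambda>\<theta>. cnj (j (- \<theta>))) (- \<theta>0) \<tau>'"
  shows "i = j"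
proof -
  interpret u: unrolling K L x0 i \<theta>0 \<tau> by fact
  interpret m: unrolling "cnj ` K" L "cnj x0" "\<lambda>\<theta>. cnj (j (- \<theta>))" "- \<theta>0" \<tau>' by fact
  have j: "((\<lambda>\<theta>. tvec \<theta> \<bullet> j \<theta>) has_real_derivative - support_fun K \<theta>) (at \<theta>)" for \<theta>
  proof -
    have "((\<lambda>\<theta>. - (tvec (- \<theta>) \<bullet> cnj (j (- (- \<theta>))))) has_real_derivative
        - (- support_fun (cnj ` K) (- \<theta>) * - 1)) (at \<theta>)"
      by (intro DERIV_minus DERIV_chain2[where f = "\<lambda>\<theta>. tvec \<theta> \<bullet> cnj (j (- \<theta>))"] m.derivative
          derivative_eq_intros) auto
    then show ?thesis by (simp add: inner_tvec_cnj support_fun_cnj)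
  qed
  have "tvec \<theta> \<bullet> i \<theta> - tvec \<theta> \<bullet> j \<theta> = tvec \<theta>0 \<bullet> i \<theta>0 - tvec \<theta>0 \<bullet> j \<theta>0" for \<theta>
  proof (rule DERIV_isconst_all[of "\<lambda>\<theta>. tvec \<theta> \<bullet> i \<theta> - tvec \<theta> \<bullet> j \<theta>", rule_format])
    show "((\<lambda>\<theta>. tvec \<theta> \<bullet> i \<theta> - tvec \<theta> \<bullet> j \<theta>) has_real_derivative 0) (at \<theta>)" for \<theta>
      using DERIV_diff[OF u.derivative j] by simp
  qed
  moreover have "i \<theta>0 = j \<theta>0" using u.start(2) m.start(2) by simp
  ultimately have "tvec \<theta> \<bullet> i \<theta> = tvec \<theta> \<bullet> j \<theta>" for \<theta> by simp
  moreover have "nvec \<theta> \<bullet> i \<theta> = nvec \<theta> \<bullet> j \<theta>" for \<theta>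
    using u.inner_nvec[of \<theta>] m.inner_nvec[of "- \<theta>"] by (simp add: inner_nvec_cnj support_fun_cnj)
  ultimately show ?thesis by (intro ext) (metis frame_eqI)
qed

lemma two_sided_mirror:
  assumes "two_sided_unrolling K L x0 i \<theta>0 \<tau> \<tau>'"
  shows "two_sided_unrolling (cnj ` K) L (cnj x0) (\<lambda>\<theta>. cnj (i (- \<theta>))) (- \<theta>0) (- \<tau>') (- \<tau>)"
proof -
  interpret u: two_sided_unrolling K L x0 i \<theta>0 \<tau> \<tau>' by fact
  have *: "unrolling (cnj ` cnj ` K) L (cnj (cnj x0)) (\<lambda>\<theta>. cnj (cnj (i (- (- \<theta>))))) (- (- \<theta>0)) (- (- \<tau>))"
    unfolding cnj_cnj_image complex_cnj_cnj minus_minus by (rule u.unrolling_axioms)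
  have "\<nexists>p. cnj ` K = {p}"
  proof
    assume "\<exists>p. cnj ` K = {p}"
    then obtain p where "cnj ` K = {p}" by blast
    then have "cnj ` cnj ` K = {cnj p}" by simp
    then show False using u.not_point unfolding cnj_cnj_image by blast
  qed
  with * show ?thesis
    by (intro two_sided_unrolling.intro two_sided_unrolling_axioms.intro u.mirror.unrolling_axioms)
qed

lemma Lim_at_left_reflect: "Lim (at_left \<theta>) (\<lambda>\<theta>. f (- \<theta>)) = Lim (at_right (- \<theta>)) f"
  for f :: "real \<Rightarrow> real"
proof -
  have "((\<lambda>\<theta>. f (- \<theta>)) \<longlongrightarrow> l) (at_left \<theta>) = (f \<longlongrightarrow> l) (at_right (- \<theta>))" for l
    by (simp add: at_left_minus[of \<theta>] filterlim_filtermap)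
  then show ?thesis unfolding t2_space_class.Lim_def by simp
qed

lemma right_arc_mirror:
  assumes "right_arc_fun K L xr s0 \<theta>0 sr"
  shows "left_arc_fun (cnj ` K) L (cnj \<circ> xr) s0 (- \<theta>0) (\<lambda>\<theta>. sr (- \<theta>))"
proof -
  have a: "antimono sr" "\<And>\<theta>. continuous (at_left \<theta>) sr" "\<And>\<theta>. sr (\<theta> + 2 * pi) = sr \<theta> - L"
    "\<And>\<theta>. bij_betw xr {Lim (at_right \<theta>) sr..sr \<theta>} (face K \<theta>)"
    "s0 \<in> {Lim (at_right \<theta>0) sr..sr \<theta>0}"
    using assms by (auto simp: right_arc_fun_def)
  have "continuous (at_right \<theta>) (\<lambda>\<theta>. sr (- \<theta>))" for \<theta>
    using a(2)[of "- \<theta>"] unfolding continuous_within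
    unfolding at_right_minus[of \<theta>] filterlim_filtermap by simp
  moreover have "bij_betw (cnj \<circ> xr) {Lim (at_right (- \<theta>)) sr..sr (- \<theta>)} (face (cnj ` K) \<theta>)" for \<theta>
    unfolding face_cnj
    by (rule bij_betw_trans[OF a(4)]) (auto simp: bij_betw_def intro: inj_onI)
  moreover have "sr (- (\<theta> + 2 * pi)) = sr (- \<theta>) + L" for \<theta> using a(3)[of "- \<theta> - 2 * pi"] by simp
  ultimately show ?thesis
    using a(1,5) by (simp add: left_arc_fun_def Lim_at_left_reflect mono_def antimono_def)
qed

lemma right_involute_mirror:
  "left_involute (cnj \<circ> xr) (\<lambda>\<theta>. sr (- \<theta>)) s0 = (\<lambda>\<theta>. cnj (right_involute xr sr s0 (- \<theta>)))"
  by (simp add: left_involute_def right_involute_def cnj_tvec fun_eq_iff)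

lemma theta_minus_mirror: "theta_plus (\<lambda>\<theta>. sr (- \<theta>)) s0 = - theta_minus sr s0"
proof -
  have "uminus ` {\<theta>. sr (- \<theta>) > s0} = {\<theta>. sr \<theta> > s0}"
    by (auto simp: image_iff) (metis minus_minus)
  then show ?thesis by (simp add: theta_plus_def theta_minus_def Inf_real_def)
qed

lemma curve_length_cnj: "curve_length (cnj \<circ> x) a b = curve_length x a b"
proof -
  have "dist (cnj u) (cnj v) = dist u v" for u v
    by (metis complex_cnj_diff complex_mod_cnj dist_norm)
  then show ?thesis by (simp add: curve_length_def)
qed

text \<open>Both involutes are unrollings, the right one after reflection, and they agree by uniqueness.\<close>

lemma involute_data_two_sided:
  assumes "involute_data K x0 L xl xr s0 \<theta>0 sl sr" and K: "compact K" "K \<noteq> {}" "convex K" "\<nexists>p. K = {p}"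
  shows "two_sided_unrolling K L x0 (left_involute xl sl s0) \<theta>0 (theta_plus sl s0) (theta_minus sr s0)"
    and "right_involute xr sr s0 = left_involute xl sl s0"
proof -
  have d: "boundary_arclength_param K L xl" "boundary_arclength_param K L xr" "xl s0 = x0" "xr s0 = x0"
    "left_arc_fun K L xl s0 \<theta>0 sl" "right_arc_fun K L xr s0 \<theta>0 sr"
    using assms(1) by (auto simp: involute_data_def)
  have p: "0 < L" "\<And>s. xl (s + L) = xl s" "\<And>s. xr (s + L) = xr s"
    "\<And>a b. a \<le> b \<Longrightarrow> curve_length xl a b = ennreal (b - a)"
    "\<And>a b. a \<le> b \<Longrightarrow> curve_length xr a b = ennreal (b - a)"
    using d(1,2) by (auto simp: boundary_arclength_param_def)
  interpret plane_body K by unfold_locales (rule K)+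
  interpret l: left_arc K L xl s0 \<theta>0 sl
    by unfold_locales (fact p d)+
  interpret r: left_arc "cnj ` K" L "cnj \<circ> xr" s0 "- \<theta>0" "\<lambda>\<theta>. sr (- \<theta>)"
  proof
    show "compact (cnj ` K)" by (intro compact_continuous_image K continuous_intros)
    show "cnj ` K \<noteq> {}" using K by simp
    show "convex (cnj ` K)" by (intro convex_linear_image K linear_cnj)
    show "left_arc_fun (cnj ` K) L (cnj \<circ> xr) s0 (- \<theta>0) (\<lambda>\<theta>. sr (- \<theta>))" using d by (rule_tac right_arc_mirror)
  qed (use p in \<open>simp_all add: curve_length_cnj\<close>)
  have l: "unrolling K L x0 (left_involute xl sl s0) \<theta>0 (theta_plus sl s0)"
    using l.involute_unrolling by (simp add: d)
  have r: "unrolling (cnj ` K) L (cnj x0) (\<lambda>\<theta>. cnj (right_involute xr sr s0 (- \<theta>))) (- \<theta>0) (- theta_minus sr s0)"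
    using r.involute_unrolling by (simp add: d right_involute_mirror theta_minus_mirror)
  show eq: "right_involute xr sr s0 = left_involute xl sl s0" using unrolling_unique[OF l r] by simp
  show "two_sided_unrolling K L x0 (left_involute xl sl s0) \<theta>0 (theta_plus sl s0) (theta_minus sr s0)"
    using l r K(4) unfolding eq by (intro two_sided_unrolling.intro two_sided_unrolling_axioms.intro)
qed

section \<open>The fence is avoided\<close>

context two_sided_unrolling
begin

lemma right_cone_avoids:
  assumes \<alpha>: "\<tau>' - 2 * pi < \<alpha>" "\<alpha> \<le> \<tau>'" and \<beta>: "\<tau> \<le> \<beta>" "\<beta> < \<tau> + 2 * pi"
    and meet: "i \<beta> = i \<alpha>" "i \<beta> \<noteq> x0"
    and q: "q \<in> cone_over_arc x0 i \<alpha> \<tau>'" and vis: "excess K \<theta> q > 0"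
  shows "\<Phi> \<theta> q \<noteq> 0"
proof -
  interpret m: two_sided_unrolling "cnj ` K" L "cnj x0" "\<lambda>\<theta>. cnj (i (- \<theta>))" "- \<theta>0" "- \<tau>'" "- \<tau>"
    by (rule two_sided_mirror) (rule two_sided_unrolling_axioms)
  have "mirror.\<Phi> (- \<theta>) (cnj q) \<noteq> 0"
  proof (rule m.left_cone_avoids[of "- \<beta>" "- \<alpha>"])
    obtain t \<psi> where t: "0 \<le> t" "t \<le> 1" "\<alpha> \<le> \<psi>" "\<psi> \<le> \<tau>'" "q = t *\<^sub>R x0 + (1 - t) *\<^sub>R i \<psi>"
      using q unfolding cone_over_arc_def by blast
    then show "cnj q \<in> cone_over_arc (cnj x0) (\<lambda>\<theta>. cnj (i (- \<theta>))) (- \<tau>') (- \<alpha>)"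
      unfolding cone_over_arc_def by (intro CollectI exI[of _ t] exI[of _ "- \<psi>"]) simp
    show "0 < excess (cnj ` K) (- \<theta>) (cnj q)" using vis by (simp add: excess_cnj)
  qed (use \<alpha> \<beta> meet in auto)
  moreover have "mirror.\<Phi> (- \<theta>) (cnj q) = - \<Phi> \<theta> q"
    unfolding mirror.\<Phi>_def \<Phi>_def by (simp add: inner_tvec_cnj)
  ultimately show ?thesis by simp
qed

text \<open>Pushing \<open>p\<close> along \<open>nvec \<theta>\<close> changes the excess but not \<open>\<Phi> \<theta> p\<close>.\<close>

lemma level_in_closure:
  assumes \<alpha>: "\<tau>' - 2 * pi < \<alpha>" "\<alpha> \<le> \<tau>'" and \<beta>: "\<tau> \<le> \<beta>" "\<beta> < \<tau> + 2 * pi"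
    and meet: "i \<beta> = i \<alpha>" "i \<beta> \<noteq> x0"
    and J: "J \<subseteq> cone_over_arc x0 i \<tau> \<beta> \<union> cone_over_arc x0 i \<alpha> \<tau>'"
    and p: "excess K \<theta> p \<ge> 0" "\<Phi> \<theta> p = 0"
  shows "p \<in> closure (UNIV - (J \<union> K))"
  unfolding closure_approachable
proof (intro allI impI)
  fix e :: real assume e: "0 < e"
  define q where "q = p + (e / 2) *\<^sub>R nvec \<theta>"
  have vis: "excess K \<theta> q > 0" using p(1) e by (simp add: q_def excess_def inner_add_right frame_inner)
  have "\<Phi> \<theta> q = 0" using p(2) by (simp add: q_def \<Phi>_def inner_add_right frame_inner)
  then have "q \<notin> J"
    using J left_cone_avoids[OF \<alpha> \<beta> meet _ vis] right_cone_avoids[OF \<alpha> \<beta> meet _ vis] by blast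
  moreover have "q \<notin> K" using vis excess_nonpos[of q \<theta>] by force
  moreover have "dist q p < e" using e by (simp add: q_def dist_norm)
  ultimately show "\<exists>y\<in>UNIV - (J \<union> K). dist y p < e" by (intro bexI[of _ q]) auto
qed

end

section \<open>Curves that expand from a convex body\<close>

text \<open>Apply the hypothesis to the point of the ball that lies furthest in the direction from \<open>p\<close> to \<open>p'\<close>.\<close>

lemma dist_sq_gain:
  fixes p p' y0 :: complex
  assumes K: "cball y0 R \<subseteq> K" "0 < R" and mono: "\<And>y. y \<in> K \<Longrightarrow> dist p y \<le> dist p' y"
  shows "2 * R * dist p p' \<le> (dist p' y0)\<^sup>2 - (dist p y0)\<^sup>2"
proof (cases "p = p'")
  case False
  define d where "d = dist p p'"
  have d: "d > 0" using False by (simp add: d_def)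
  define w where "w = (R / d) *\<^sub>R (p' - p)"
  have nw: "norm w = R" using d K(2) by (simp add: w_def d_def dist_norm norm_minus_commute)
  then have "y0 + w \<in> K" using K(1) by (intro subsetD[OF K(1)]) (simp add: dist_norm)
  then have "(dist p (y0 + w))\<^sup>2 \<le> (dist p' (y0 + w))\<^sup>2" using mono by (intro power_mono) auto
  moreover have "(dist u (y0 + w))\<^sup>2 = (dist u y0)\<^sup>2 - 2 * ((u - y0) \<bullet> w) + (norm w)\<^sup>2" for u
  proof -
    have "u - (y0 + w) = (u - y0) - w" by simp
    then show ?thesis
      unfolding dist_norm power2_norm_eq_inner
      by (simp add: inner_diff_left inner_diff_right inner_add_left inner_add_right inner_commute)
  qed
  moreover have "(p' - y0) \<bullet> w - (p - y0) \<bullet> w = R * d"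
  proof -
    have "(p' - y0) \<bullet> w - (p - y0) \<bullet> w = (p' - p) \<bullet> w" by (simp add: inner_diff_left)
    also have "\<dots> = R / d * (norm (p' - p))\<^sup>2" by (simp add: w_def power2_norm_eq_inner)
    also have "\<dots> = R * d" using d by (simp add: d_def dist_norm norm_minus_commute power2_eq_square)
    finally show ?thesis .
  qed
  ultimately show ?thesis by (simp add: d_def)
qed simp

text \<open>The squared distance \<open>S\<close> to the centre of a ball inside \<open>K\<close> is strictly increasing along the curve and
  maps it onto an interval, by connectedness.  Its inverse parametrizes the curve, and it is Lipschitz
  by \<open>dist_sq_gain\<close>.  The curve does not return to \<open>K\<close>: the distance of \<open>x0\<close> to a point of \<open>K\<close> on the curve
  could not exceed the distance of that point to itself.\<close>

lemma SDC_from_path: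
  assumes sdc: "SDC_from K \<gamma> r" and start: "starting_point \<gamma> r x0"
    and int: "interior K \<noteq> {}" and p: "p \<in> \<gamma>"
  obtains g u v C where "u \<le> v" "0 \<le> C" "g u = x0" "g v = p"
    "\<And>\<sigma> \<sigma>'. u \<le> \<sigma> \<Longrightarrow> \<sigma> \<le> \<sigma>' \<Longrightarrow> \<sigma>' \<le> v \<Longrightarrow> dist (g \<sigma>) (g \<sigma>') \<le> C * (\<sigma>' - \<sigma>)"
    "\<And>\<sigma>. u < \<sigma> \<Longrightarrow> \<sigma> \<le> v \<Longrightarrow> g \<sigma> \<notin> K"
    "\<And>\<sigma> \<sigma>' y. u \<le> \<sigma> \<Longrightarrow> \<sigma> \<le> \<sigma>' \<Longrightarrow> \<sigma>' \<le> v \<Longrightarrow> y \<in> K \<Longrightarrow> dist (g \<sigma>) y \<le> dist (g \<sigma>') y"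
proof -
  obtain y0 R where R: "0 < R" "cball y0 R \<subseteq> K"
    using int by (metis all_not_in_conv mem_interior_cball)
  have conn: "connected \<gamma>" and ord: "linear_order_on \<gamma> r"
    and mono: "\<And>a b y. (a, b) \<in> r \<Longrightarrow> y \<in> K \<Longrightarrow> dist a y \<le> dist b y"
    using sdc unfolding SDC_from_def SDC_def self_distancing_def by blast+
  have refl: "\<And>a. a \<in> \<gamma> \<Longrightarrow> (a, a) \<in> r" and total: "\<And>a b. a \<in> \<gamma> \<Longrightarrow> b \<in> \<gamma> \<Longrightarrow> a \<noteq> b \<Longrightarrow> (a, b) \<in> r \<or> (b, a) \<in> r"
    using ord unfolding linear_order_on_def partial_order_on_def preorder_on_def refl_on_def total_on_def by blast+
  have x0: "x0 \<in> \<gamma>" "\<And>a. a \<in> \<gamma> \<Longrightarrow> (x0, a) \<in> r" using start by (auto simp: starting_point_def)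
  define S where "S a = (dist a y0)\<^sup>2" for a
  have S: "2 * R * dist a b \<le> S b - S a" if "(a, b) \<in> r" for a b
    unfolding S_def by (rule dist_sq_gain[OF R(2,1)]) (rule mono[OF that])
  have inj: "inj_on S \<gamma>"
  proof (rule inj_onI)
    fix a b assume ab: "a \<in> \<gamma>" "b \<in> \<gamma>" "S a = S b"
    show "a = b"
    proof (rule ccontr)
      assume ne: "a \<noteq> b"
      then have "2 * R * dist a b \<le> 0" using total[OF ab(1,2)] S[of a b] S[of b a] ab(3) by (auto simp: dist_commute)
      then show False using ne R by (simp add: mult_le_0_iff)
    qed
  qed
  define g where "g = inv_into \<gamma> S"
  define u v where "u = S x0" and "v = S p"
  have "connected (S ` \<gamma>)"
    unfolding S_def by (intro connected_continuous_image conn continuous_intros)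
  then have "is_interval (S ` \<gamma>)" by (simp add: is_interval_connected_1)
  then have "\<sigma> \<in> S ` \<gamma>" if "u \<le> \<sigma>" "\<sigma> \<le> v" for \<sigma>
    by (rule mem_is_interval_1_I[of _ u v]) (use that x0(1) p in \<open>simp_all add: u_def v_def\<close>)
  then have g: "g \<sigma> \<in> \<gamma>" "S (g \<sigma>) = \<sigma>" if "u \<le> \<sigma>" "\<sigma> \<le> v" for \<sigma>
    using that unfolding g_def by (auto intro: inv_into_into f_inv_into_f)
  have gS: "g (S a) = a" if "a \<in> \<gamma>" for a using inv_into_f_f[OF inj that] by (simp add: g_def)
  have gr: "(g \<sigma>, g \<sigma>') \<in> r" if "u \<le> \<sigma>" "\<sigma> \<le> \<sigma>'" "\<sigma>' \<le> v" for \<sigma> \<sigma>'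
  proof (rule ccontr)
    assume n: "(g \<sigma>, g \<sigma>') \<notin> r"
    have g2: "g \<sigma> \<in> \<gamma>" "S (g \<sigma>) = \<sigma>" "g \<sigma>' \<in> \<gamma>" "S (g \<sigma>') = \<sigma>'" using g that by auto
    have ne: "g \<sigma> \<noteq> g \<sigma>'" using n refl[OF g2(1)] by auto
    then have "(g \<sigma>', g \<sigma>) \<in> r" using total n g2 by blast
    then have "2 * R * dist (g \<sigma>') (g \<sigma>) \<le> \<sigma> - \<sigma>'" using S g2 by metis
    then have "2 * R * dist (g \<sigma>') (g \<sigma>) \<le> 0" using that by simp
    then show False using ne R by (simp add: mult_le_0_iff)
  qed
  show thesis
  proof (rule that[of u v "1 / (2 * R)" g])
    have "0 \<le> 2 * R * dist x0 p" using R by simp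
    then show "u \<le> v" using S[OF x0(2)[OF p]] by (simp add: u_def v_def)
    show "0 \<le> 1 / (2 * R)" using R by simp
    show "g u = x0" "g v = p" using gS x0 p by (auto simp: u_def v_def)
    show "dist (g \<sigma>) (g \<sigma>') \<le> 1 / (2 * R) * (\<sigma>' - \<sigma>)" if "u \<le> \<sigma>" "\<sigma> \<le> \<sigma>'" "\<sigma>' \<le> v" for \<sigma> \<sigma>'
      using S[OF gr[OF that]] g[of \<sigma>] g[of \<sigma>'] that R by (simp add: field_simps)
    show "dist (g \<sigma>) y \<le> dist (g \<sigma>') y" if "u \<le> \<sigma>" "\<sigma> \<le> \<sigma>'" "\<sigma>' \<le> v" "y \<in> K" for \<sigma> \<sigma>' y
      using mono[OF gr[OF that(1-3)] that(4)] .
    show "g \<sigma> \<notin> K" if "u < \<sigma>" "\<sigma> \<le> v" for \<sigma>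
    proof
      assume "g \<sigma> \<in> K"
      then have "dist x0 (g \<sigma>) \<le> dist (g \<sigma>) (g \<sigma>)" using g that by (intro mono x0(2)) auto
      then have "S x0 = \<sigma>" using g(2)[of \<sigma>] that by simp
      then show False using that by (simp add: u_def)
    qed
  qed
qed

lemma flat_body_segment:
  fixes K :: "complex set"
  assumes K: "convex K" "compact K" "K \<noteq> {}" "interior K = {}" "\<nexists>p. K = {p}"
    and x0: "x0 \<in> K" "x0 \<notin> rel_interior K"
  obtains b where "K = closed_segment x0 b" "x0 \<noteq> b"
proof -
  obtain a c where a: "a \<noteq> 0" "K \<subseteq> {x. a \<bullet> x = c}" using empty_interior_subset_hyperplane[OF K(1,4)] by blast
  obtain \<rho> \<theta> where \<rho>: "0 \<le> \<rho>" "a = \<rho> *\<^sub>R nvec \<theta>" by (rule obtain_polar)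
  have "\<exists>k. x - y = k *\<^sub>R tvec \<theta>" if "x \<in> K" "y \<in> K" for x y
  proof -
    have "a \<bullet> x = a \<bullet> y" using a(2) that by auto
    then have "\<rho> * (nvec \<theta> \<bullet> (x - y)) = 0" unfolding \<rho>(2) by (simp add: inner_diff_right)
    then have "nvec \<theta> \<bullet> (x - y) = 0" using a(1) \<rho>(2) by auto
    then show ?thesis using frame_decomposition[of "x - y" \<theta>] by auto
  qed
  then have "collinear K" unfolding collinear_def by blast
  then obtain d b where db: "K = closed_segment d b"
    using compact_convex_collinear_segment[OF K(3,2,1)] by blast
  have ne: "d \<noteq> b" using db K(5) by auto
  then have "x0 = d \<or> x0 = b" using x0 db by (auto simp: rel_interior_closed_segment open_segment_def)
  then show thesis
    using that[of b] that[of d] db ne closed_segment_commute by blast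
qed

theorem theorem4p6:
  fixes K \<gamma> J :: "complex set" and r :: "complex rel" and x0 :: complex
  assumes "convex_body K" and "\<nexists>p. K = {p}"
    and "SDC_from K \<gamma> r" and "starting_point \<gamma> r x0" and "x0 \<in> frontier K"
    and "is_fence K x0 J"
  shows "\<gamma> \<subseteq> closure (UNIV - (J \<union> K))"
proof
  fix p assume p: "p \<in> \<gamma>"
  have K: "compact K" "K \<noteq> {}" "convex K" using assms(1) by (auto simp: convex_body_def)
  have x0: "x0 \<in> K" using assms(5) frontier_subset_closed[OF compact_imp_closed[OF K(1)]] by blast
  obtain L xl xr s0 \<theta>0 sl sr \<beta> \<alpha> where data: "involute_data K x0 L xl xr s0 \<theta>0 sl sr"
    and params: "fence_params x0 (left_involute xl sl s0) (right_involute xr sr s0)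
        (theta_plus sl s0) (theta_minus sr s0) \<beta> \<alpha>"
    and J: "J = (cone_over_arc x0 (left_involute xl sl s0) (theta_plus sl s0) \<beta> \<union>
             cone_over_arc x0 (right_involute xr sr s0) \<alpha> (theta_minus sr s0)) - interior K"
    using assms(6) unfolding is_fence_def by blast
  define i where "i = left_involute xl sl s0"
  note two = involute_data_two_sided[OF data K assms(2), folded i_def]
  interpret two_sided_unrolling K L x0 i \<theta>0 "theta_plus sl s0" "theta_minus sr s0" by (rule two(1))
  have "\<exists>\<theta>. excess K \<theta> p \<ge> 0 \<and> \<Phi> \<theta> p = 0"
  proof (cases "interior K = {}")
    case True
    have "x0 \<notin> rel_interior K" using assms(3,4) by (auto simp: SDC_from_def starting_point_def)
    then obtain b where b: "K = closed_segment x0 b" "x0 \<noteq> b"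
      using flat_body_segment[OF K(3,1,2) True assms(2) x0] by blast
    have "(x0, p) \<in> r" using assms(4) p by (simp add: starting_point_def)
    then have "dist x0 b \<le> dist p b" using assms(3) b(1) by (auto simp: SDC_from_def)
    then show ?thesis by (rule segment_reaches_level[OF b])
  next
    case False
    show ?thesis
    proof (rule SDC_from_path[OF assms(3,4) False p])
      fix g :: "real \<Rightarrow> complex" and u v C :: real
      assume g: "u \<le> v" "0 \<le> C" "g u = x0" "g v = p"
        "\<And>\<sigma> \<sigma>'. u \<le> \<sigma> \<Longrightarrow> \<sigma> \<le> \<sigma>' \<Longrightarrow> \<sigma>' \<le> v \<Longrightarrow> dist (g \<sigma>) (g \<sigma>') \<le> C * (\<sigma>' - \<sigma>)"
        "\<And>\<sigma>. u < \<sigma> \<Longrightarrow> \<sigma> \<le> v \<Longrightarrow> g \<sigma> \<notin> K"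
        "\<And>\<sigma> \<sigma>' y. u \<le> \<sigma> \<Longrightarrow> \<sigma> \<le> \<sigma>' \<Longrightarrow> \<sigma>' \<le> v \<Longrightarrow> y \<in> K \<Longrightarrow> dist (g \<sigma>) y \<le> dist (g \<sigma>') y"
      from path_reaches_level[OF False g(1,2,5,3,6,7)]
      show ?thesis by (simp add: g(4))
    qed
  qed
  then obtain \<theta> where \<theta>: "excess K \<theta> p \<ge> 0" "\<Phi> \<theta> p = 0" by blast
  have "theta_minus sr s0 - 2 * pi < \<alpha>" "\<alpha> \<le> theta_minus sr s0"
    "theta_plus sl s0 \<le> \<beta>" "\<beta> < theta_plus sl s0 + 2 * pi" "i \<beta> = i \<alpha>" "i \<beta> \<noteq> x0"
    using params unfolding fence_params_def i_def[symmetric] two(2) by auto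
  moreover have "J \<subseteq> cone_over_arc x0 i (theta_plus sl s0) \<beta> \<union> cone_over_arc x0 i \<alpha> (theta_minus sr s0)"
    unfolding J i_def[symmetric] two(2) by blast
  ultimately show "p \<in> closure (UNIV - (J \<union> K))" using \<theta> by (rule level_in_closure)
qed

end
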